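(* Let $T:X\to X$ be a conservative ergodic measure-preserving transformation of the measure space $(X,\mathcal B,\mu)$, where $\mu$ is $\sigma$-finite with $\mu(X)=\infty$, and let $E\in\mathcal B$ with $\mu(E)=1$. Let $f:X\to\mathbb R_{\ge0}$ be a non-negative measurable function with $f\notin L^1(X,\mu)$, and let $f^E$ be its induced version on $E$. With the notation of the context, assume that: (i) the sequence of random variables $(\varphi_E\circ T_E^{\,n-1})_{n\ge1}$ on $(E,\mu)$ is $\psi$-mixing with coefficient $\psi(n)$ fulfilling $\sum_{n\ge1}\psi(n)/n<\infty$; (ii) there exist $g_1,g_2:X\to\mathbb R_{\ge0}$, constant on the level sets $(E_n)$ of the hitting time function to $E$, such that: (a) $g_1(x)\le f(x)\le g_2(x)$ for $\mu$-a.e. $x\in X$; (b) the induced functions satisfy $g_i^E(n):=g_i^E|_{A_n}=n\,L_i(n)$ for $i=1,2$, where $L_1,L_2$ are normalised slowly varying functions and $L_1(n)\sim L_2(n)$ as $n\to\infty$; (c) for all functions $\tilde\xi(n)$ with $c\le\tilde\xi(n)\le\xi(n)$ for some constant $c>0$, one has $L_i(n\,\tilde\xi(n))\sim L_i(n)$ as $n\to\infty$, for $i=1,2$; (d) if $\Gamma_i(y):=\min\{k\in\mathbb N: g_i^E(k)>y\}$ for $i=1,2$, then for some $y_0>0$ $$\int_{y_0}^\infty\frac{y\,\big(\mu(A_{\ge\Gamma_i(y)})\big)^2}{\big(\int_0^y\mu(A_{\ge\Gamma_i(t)})\,dt\big)^2}\,dy<\infty ;$$ (e) if $\ell_i(n):=\sum_{k=0}^n\mu(A_{\ge\Gamma_i(k)})$,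 then for $i=1,2$ the function $\ell_i$ is super-slowly varying at infinity with rate function itself, and $\ell_i(\alpha(N))\sim L_i(N)\sum_{k=0}^N\mu(A_{>k})$ as $N\to\infty$. Then there exists a function $G:\mathbb N\to\mathbb R_{\ge0}$ which is asymptotically equivalent to $f^E$, that is, there exists a set $\tilde E\subset E$ with $\mu(\tilde E)=1$ such that for every sequence $(x_n)$ with $x_n\in A_n\cap\tilde E$ for all $n\in\mathbb N$ we have $f^E(x_n)\sim G(n)$ as $n\to\infty$; and for $\mu$-a.e. $x\in X$ $$\lim_{N\to\infty}\frac1{G(N)}\sum_{k=1}^N(f\circ T^{k-1})(x)=1 .$$
   Context: First return time: $\varphi_E(x)=\min\{k\ge1:T^k(x)\in E\}$ for $x\in E$ (finite a.e.); induced map $T_E(x)=T^{\varphi_E(x)}(x)$, which preserves the probability $\mu|_E$. Level sets $A_n=\{x\in E:\varphi_E(x)=n\}$, super-level sets $A_{>n}=\{x\in E:\varphi_E(x)>n\}$, and $A_{\ge n}=A_n\cup A_{>n}$. Hitting time: $h_E:X\to\mathbb N_0$, $h_E(x)=\min\{k\ge0:T^k(x)\in E\}$ (finite a.e.); $E_n=\{x\in X:h_E(x)=n\}$. Induced observable: for measurable $g:X\to\mathbb R$, $g^E(x)=\sum_{k=1}^{\varphi_E(x)}(g\circ T^{k-1})(x)$ for a.e. $x\in E$. If $g$ is constant on each $E_k$ with value $g_k$, then $g^E(x)=\sum_{k=0}^{n-1}g_k$ for all $x\in A_n$; this common value is denoted $g^E(n)$. $\alpha(n)=n/\sum_{j=0}^{n-1}\mu(A_{>j})$.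 For $t>0$ let $q(t)=\min\{j\in\mathbb N:\mu(A_{>j})\le 1/t\}$, and (for $n$ large enough that the logarithms make sense) $\xi(n)=\frac1n\,q\big(\alpha(n)\,\log(\alpha(n))\,\log^2(\log(\alpha(n)))\big)$, where $\log^2(\cdot)=(\log(\cdot))^2$. $\psi$-mixing: for a sequence $(Y_n)$ of random variables on a probability space with probability $\mathbb P$, let $\mathcal F_h^k$ be the $\sigma$-field generated by $(Y_n)_{h\le n\le k}$ and $\psi(n)=\sup\{|\frac{\mathbb P(B\cap C)}{\mathbb P(B)\mathbb P(C)}-1|: B\in\mathcal F_0^j, C\in\mathcal F_{j+n}^\infty,\mathbb P(B)>0,\mathbb P(C)>0,j\in\mathbb N\}$; the sequence is $\psi$-mixing if $\psi(n)\to0$. Normalised slowly varying: $L$ can be written as $L(x)=C\exp\big(\int_\kappa^x\frac{\eta(t)}t\,dt\big)$ with a constant $C>0$, $\kappa\ge0$ and $\eta(x)\to0$ as $x\to\infty$. Super-slowly varying: given $h:\mathbb R_{>0}\to\mathbb R_{>0}$, a function $\ell:\mathbb R_{>0}\to\mathbb R$ is super-slowly varying at infinity with rate function $h$ if $\lim_{x\to\infty}\ell(x\,h(x)^\delta)/\ell(x)=1$ uniformly in $0\le\delta\le1$. The function $\ell_i$ is extended to real arguments by $\ell_i(x)=\sum_{0\le k\le x}\mu(A_{\ge\Gamma_i(k)})$. $a(n)\sim b(n)$ means $a(n)/b(n)\to1$. *)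

theory Defs
  imports "HOL-Analysis.Analysis"
begin

text \<open>
  Throughout, \<open>X = space M\<close> and \<open>\<mu>\<close> is the measure of \<open>M\<close>. The symbol
  \<open>\<nat>\<close> of the source denotes the positive integers (\<open>\<nat>\<^sub>0\<close> is used there for
  the non-negative ones), so minima over \<open>\<nat>\<close> range over \<open>k \<ge> 1\<close>.
\<close>

definition preserves_measure :: "'a measure \<Rightarrow> ('a \<Rightarrow> 'a) \<Rightarrow> bool" where
  "preserves_measure M T \<longleftrightarrow>
     T \<in> measurable M M \<and> (\<forall>A\<in>sets M. emeasure M (T -` A \<inter> space M) = emeasure M A)"

definition conservative :: "'a measure \<Rightarrow> ('a \<Rightarrow> 'a) \<Rightarrow> bool" where
  "conservative M T \<longleftrightarrow>
     (\<forall>W\<in>sets M. disjoint_family (\<lambda>n. (T ^^ n) -` W \<inter> space M) \<longrightarrow> emeasure M W = 0)"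

definition ergodic :: "'a measure \<Rightarrow> ('a \<Rightarrow> 'a) \<Rightarrow> bool" where
  "ergodic M T \<longleftrightarrow>
     (\<forall>A\<in>sets M. T -` A \<inter> space M = A \<longrightarrow> emeasure M A = 0 \<or> emeasure M (space M - A) = 0)"


text \<open>
  The value 0 marks the points that never return (a null set of \<open>E\<close> in the conservative case);
  they then lie in no \<open>return_level T E n\<close> with \<open>n \<ge> 1\<close>, and the induced map fixes them.
\<close>
definition return_time :: "('a \<Rightarrow> 'a) \<Rightarrow> 'a set \<Rightarrow> 'a \<Rightarrow> nat" where
  "return_time T E x =
     (if \<exists>k\<ge>1. (T ^^ k) x \<in> E then LEAST k. 1 \<le> k \<and> (T ^^ k) x \<in> E else 0)"

definition induced_map :: "('a \<Rightarrow> 'a) \<Rightarrow> 'a set \<Rightarrow> 'a \<Rightarrow> 'a" where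
  "induced_map T E x = (T ^^ return_time T E x) x"

definition return_level :: "('a \<Rightarrow> 'a) \<Rightarrow> 'a set \<Rightarrow> nat \<Rightarrow> 'a set" where
  "return_level T E n = {x\<in>E. return_time T E x = n}"

definition return_gt :: "('a \<Rightarrow> 'a) \<Rightarrow> 'a set \<Rightarrow> nat \<Rightarrow> 'a set" where
  "return_gt T E n = {x\<in>E. return_time T E x > n}"

definition return_ge :: "('a \<Rightarrow> 'a) \<Rightarrow> 'a set \<Rightarrow> nat \<Rightarrow> 'a set" where
  "return_ge T E n = return_level T E n \<union> return_gt T E n"


text \<open>Only meaningful at points whose orbit meets \<open>E\<close>; the other points lie in no hitting level.\<close>
definition hitting_time :: "('a \<Rightarrow> 'a) \<Rightarrow> 'a set \<Rightarrow> 'a \<Rightarrow> nat" where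
  "hitting_time T E x = (LEAST k. (T ^^ k) x \<in> E)"

definition hitting_level :: "'a measure \<Rightarrow> ('a \<Rightarrow> 'a) \<Rightarrow> 'a set \<Rightarrow> nat \<Rightarrow> 'a set" where
  "hitting_level M T E n = {x\<in>space M. (\<exists>k. (T ^^ k) x \<in> E) \<and> hitting_time T E x = n}"

definition induced_obs :: "('a \<Rightarrow> 'a) \<Rightarrow> 'a set \<Rightarrow> ('a \<Rightarrow> real) \<Rightarrow> 'a \<Rightarrow> real" where
  "induced_obs T E g x = (\<Sum>k=1..return_time T E x. g ((T ^^ (k - 1)) x))"

text \<open>
  For \<open>g\<close> constant on the hitting levels: the number \<open>g\<^sup>E(n) = g\<^sub>0 + \<dots> + g\<^sub>n\<^sub>-\<^sub>1\<close>,
  where \<open>g\<^sub>k\<close> is the value of \<open>g\<close> on the \<open>k\<close>-th hitting level.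
  It is the common value of \<open>induced_obs T E g\<close> on \<open>return_level T E n\<close>, see
  \<open>induced_obs_eq_induced_value\<close> below.
\<close>
definition induced_value :: "'a measure \<Rightarrow> ('a \<Rightarrow> 'a) \<Rightarrow> 'a set \<Rightarrow> ('a \<Rightarrow> real) \<Rightarrow> nat \<Rightarrow> real" where
  "induced_value M T E g n = (\<Sum>k<n. the_elem (g ` hitting_level M T E k))"


definition alpha :: "'a measure \<Rightarrow> ('a \<Rightarrow> 'a) \<Rightarrow> 'a set \<Rightarrow> nat \<Rightarrow> real" where
  "alpha M T E n = real n / (\<Sum>j<n. measure M (return_gt T E j))"

definition tail_quantile :: "'a measure \<Rightarrow> ('a \<Rightarrow> 'a) \<Rightarrow> 'a set \<Rightarrow> real \<Rightarrow> nat" where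
  "tail_quantile M T E t = (LEAST j. 1 \<le> j \<and> measure M (return_gt T E j) \<le> 1 / t)"

text \<open>Only meaningful for large \<open>n\<close>, where the iterated logarithm is positive.\<close>
definition xi :: "'a measure \<Rightarrow> ('a \<Rightarrow> 'a) \<Rightarrow> 'a set \<Rightarrow> nat \<Rightarrow> real" where
  "xi M T E n =
     (let a = alpha M T E n
      in real (tail_quantile M T E (a * ln a * (ln (ln a))\<^sup>2)) / real n)"


definition Gam :: "'a measure \<Rightarrow> ('a \<Rightarrow> 'a) \<Rightarrow> 'a set \<Rightarrow> ('a \<Rightarrow> real) \<Rightarrow> real \<Rightarrow> nat" where
  "Gam M T E g y = (LEAST k. 1 \<le> k \<and> induced_value M T E g k > y)"

definition ell :: "'a measure \<Rightarrow> ('a \<Rightarrow> 'a) \<Rightarrow> 'a set \<Rightarrow> ('a \<Rightarrow> real) \<Rightarrow> real \<Rightarrow> real" where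
  "ell M T E g x =
     (\<Sum>k\<in>{k::nat. real k \<le> x}. measure M (return_ge T E (Gam M T E g (real k))))"


text \<open>
  The \<open>\<psi>\<close>-mixing coefficient of a sequence \<open>Y\<^sub>1, Y\<^sub>2, \<dots>\<close> of \<open>N\<close>-valued random variables
  on a probability space \<open>P\<close>. The sequence starts at index 1 (\<open>Y 0\<close> is ignored), and the
  coefficient may be infinite.
\<close>
definition generated_field ::
  "'a measure \<Rightarrow> 'b measure \<Rightarrow> (nat \<Rightarrow> 'a \<Rightarrow> 'b) \<Rightarrow> nat set \<Rightarrow> 'a set set" where
  "generated_field P N Y I =
     sigma_sets (space P) {Y n -` S \<inter> space P | n S. n \<in> I \<and> S \<in> sets N}"

definition psi_coeff ::
  "'a measure \<Rightarrow> 'b measure \<Rightarrow> (nat \<Rightarrow> 'a \<Rightarrow> 'b) \<Rightarrow> nat \<Rightarrow> ennreal" where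
  "psi_coeff P N Y n =
     Sup {ennreal \<bar>measure P (B \<inter> C) / (measure P B * measure P C) - 1\<bar> | j B C.
            1 \<le> j \<and> B \<in> generated_field P N Y {1..j} \<and> C \<in> generated_field P N Y {j + n..} \<and>
            measure P B > 0 \<and> measure P C > 0}"

definition psi_mixing :: "'a measure \<Rightarrow> 'b measure \<Rightarrow> (nat \<Rightarrow> 'a \<Rightarrow> 'b) \<Rightarrow> bool" where
  "psi_mixing P N Y \<longleftrightarrow> psi_coeff P N Y \<longlonglongrightarrow> 0"


definition normalised_slowly_varying :: "(real \<Rightarrow> real) \<Rightarrow> bool" where
  "normalised_slowly_varying L \<longleftrightarrow>
     (\<exists>C \<kappa> \<eta>. C > 0 \<and> \<kappa> \<ge> 0 \<and> (\<eta> \<longlongrightarrow> 0) at_top \<and>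
        (\<forall>x\<ge>\<kappa>. set_integrable lborel {\<kappa>..x} (\<lambda>t. \<eta> t / t) \<and>
                L x = C * exp (LBINT t:{\<kappa>..x}. \<eta> t / t)))"

definition super_slowly_varying :: "(real \<Rightarrow> real) \<Rightarrow> (real \<Rightarrow> real) \<Rightarrow> bool" where
  "super_slowly_varying l h \<longleftrightarrow>
     (\<forall>x>0. h x > 0) \<and>
     uniform_limit {0..1} (\<lambda>x \<delta>. l (x * h x powr \<delta>) / l x) (\<lambda>_. 1) at_top"


lemma induced_obs_eq_induced_value:
  assumes T: "T \<in> measurable M M" and E: "E \<subseteq> space M"
    and g: "\<And>k. g constant_on hitting_level M T E k"
    and x: "x \<in> return_level T E n" and n: "n \<ge> 1"
  shows "induced_obs T E g x = induced_value M T E g n"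
proof -
  have xE: "x \<in> E" and rt: "return_time T E x = n"
    using x by (auto simp: return_level_def)
  have ex: "\<exists>k\<ge>1. (T ^^ k) x \<in> E"
    using rt n unfolding return_time_def by (auto split: if_splits)
  have least: "n = (LEAST k. 1 \<le> k \<and> (T ^^ k) x \<in> E)"
    using rt ex unfolding return_time_def by auto
  have ret: "(T ^^ n) x \<in> E"
    unfolding least using LeastI_ex[of "\<lambda>k. 1 \<le> k \<and> (T ^^ k) x \<in> E"] ex by blast
  have nret: "(T ^^ k) x \<notin> E" if "1 \<le> k" "k < n" for k
    using not_less_Least[of k "\<lambda>k. 1 \<le> k \<and> (T ^^ k) x \<in> E"] that unfolding least by blast
  have sp: "(T ^^ k) x \<in> space M" for k
  proof (induction k)
    case 0 then show ?case using xE E by auto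
  next
    case (Suc k) then show ?case using measurable_space[OF T] by simp
  qed
  have val: "g y = the_elem (g ` hitting_level M T E k)" if "y \<in> hitting_level M T E k" for k y
  proof -
    obtain c where "\<forall>z\<in>hitting_level M T E k. g z = c"
      using g[of k] unfolding constant_on_def by blast
    then have "g ` hitting_level M T E k = {c}" and "g y = c" using that by auto
    then show ?thesis by simp
  qed
  have lev: "(T ^^ (n - k)) x \<in> hitting_level M T E k" if "1 \<le> k" "k < n" for k
  proof -
    have eq: "(T ^^ i) ((T ^^ (n - k)) x) = (T ^^ (i + (n - k))) x" for i
      by (simp add: funpow_add)
    have k: "(T ^^ k) ((T ^^ (n - k)) x) \<in> E"
      using ret that by (simp add: eq)
    have "hitting_time T E ((T ^^ (n - k)) x) = k"
      unfolding hitting_time_def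
    proof (rule Least_equality[where P = "\<lambda>i. (T ^^ i) ((T ^^ (n - k)) x) \<in> E", OF k])
      fix i assume i: "(T ^^ i) ((T ^^ (n - k)) x) \<in> E"
      show "k \<le> i"
      proof (rule ccontr)
        assume "\<not> k \<le> i"
        then have "1 \<le> i + (n - k)" "i + (n - k) < n" using that by auto
        then show False using nret i by (simp add: eq)
      qed
    qed
    then show ?thesis using sp k unfolding hitting_level_def by blast
  qed
  have x0: "x \<in> hitting_level M T E 0"
  proof -
    have "(T ^^ 0) x \<in> E" using xE by simp
    moreover from this have "hitting_time T E x = 0"
      unfolding hitting_time_def by (rule Least_eq_0)
    ultimately show ?thesis using xE E unfolding hitting_level_def by blast
  qed
  define v where "v k = the_elem (g ` hitting_level M T E k)" for k
  obtain m where m: "n = Suc m" using n by (cases n) auto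
  have "induced_obs T E g x = (\<Sum>j<n. g ((T ^^ j) x))"
    unfolding induced_obs_def rt
    by (rule sum.reindex_bij_witness[of _ Suc "\<lambda>k. k - 1"]) auto
  also have "\<dots> = g x + (\<Sum>j<m. g ((T ^^ Suc j) x))"
    unfolding m sum.lessThan_Suc_shift by simp
  also have "g x = v 0"
    using val[OF x0] by (simp add: v_def)
  also have "(\<Sum>j<m. g ((T ^^ Suc j) x)) = (\<Sum>j<m. v (Suc j))"
  proof (rule sum.reindex_bij_witness[of _ "\<lambda>j. m - Suc j" "\<lambda>j. m - Suc j"], goal_cases)
    case (5 j)
    then have "(T ^^ (n - (m - j))) x \<in> hitting_level M T E (m - j)"
      by (intro lev) (auto simp: m)
    moreover have "n - (m - j) = Suc j" "Suc (m - Suc j) = m - j" using 5 by (auto simp: m)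
    ultimately show ?case using val by (simp add: v_def)
  qed auto
  also have "v 0 + (\<Sum>j<m. v (Suc j)) = (\<Sum>j<n. v j)"
    unfolding m sum.lessThan_Suc_shift by simp
  finally show ?thesis by (simp add: induced_value_def v_def)
qed

end

theory Submission
  imports Defs
begin

text \<open>
  Write \<open>p j = \<mu> {x \<in> E. \<phi> x > j}\<close>, \<open>m n = p 0 + \<dots> + p (n - 1)\<close> and let \<open>\<gamma> k\<close> be the value of \<open>g\<^sub>2\<close> on the \<open>k\<close>-th
  hitting level, so that \<open>\<gamma> n\<close> is asymptotic to \<open>L n\<close>, and \<open>F n = \<gamma> 0 * p 0 + \<dots> + \<gamma> (n - 1) * p (n - 1)\<close>
  is the mean of \<open>g\<^sub>2\<^sup>E\<close> truncated at excursion length \<open>n\<close>. Condition (e) gives \<open>F n ~ L n * m n\<close>.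
  Comparing increments, \<open>L\<close> is almost constant on every stretch on which \<open>m\<close> varies by a bounded
  factor, and (d) becomes the summability of \<open>n (p n)\<^sup>2 / (m n)\<^sup>2\<close>. By Cauchy--Schwarz, the latter
  makes \<open>c / 2\<^sup>k\<close> summable over \<open>k\<close> when \<open>m c ~ \<eta> m (2\<^sup>k)\<close>, and likewise \<open>2\<^sup>k / d\<close> when
  \<open>m d ~ 2 m (2\<^sup>k)\<close>. Hence, for times of order \<open>2\<^sup>k\<close>, Borel--Cantelli shows that almost surely no
  excursion is longer than \<open>d\<close>, while Chebyshev's inequality, in which the covariances are
  controlled by the summability of \<open>\<psi>(n) / n\<close>, shows that the points with hitting time below \<open>c\<close>
  contribute only a fraction of order \<open>\<eta>\<close>. At all other points of the orbit \<open>f\<close> is close to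
  \<open>L N\<close>, so the Birkhoff sum is close to \<open>N L N\<close>, however the time is distributed among large and
  unfinished excursions.
\<close>

section \<open>Level spacing of slowly growing partial sums\<close>

text \<open>Along the induced map the variables \<open>g\<^sub>2\<^sup>E\<close> have infinite mean,
  since \<open>F\<close> tends to infinity. Their sums may therefore be ruled by single large terms,
  and the excursion running at time \<open>N\<close> may be comparable with \<open>N\<close>. So no
  law of large numbers for the induced sums is sought. Each orbit point is instead compared with
  \<open>L N\<close> according to its own hitting time, and probability enters only through the
  number and weight of points with small hitting time, which are sums of bounded truncated
  variables. Closeness is measured on the scale of \<open>m\<close>, not of \<open>n\<close>:
  \<open>N / c\<close> and \<open>d / N\<close> are unbounded, while \<open>m c\<close>,
  \<open>m N\<close> and \<open>m d\<close> stay within bounded factors of each other. The relation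
  of \<open>F\<close> to \<open>L * m\<close> arises because \<open>ell\<close> at \<open>y\<close>
  differs by at most \<open>1\<close> from the mean of the minimum of
  \<open>g\<^sub>2\<^sup>E\<close> and \<open>y\<close>. This mean equals \<open>F n\<close> at
  \<open>y = g\<^sub>2\<^sup>E(n)\<close>, an argument asymptotic to \<open>\<alpha>(n)\<close>
  times \<open>ell\<close> at \<open>\<alpha>(n)\<close>; super-slow variation lets
  \<open>\<alpha>(n)\<close> itself replace it.\<close>

lemma geometric_sum_recip_le:
  fixes a :: "nat \<Rightarrow> real" and s \<rho> :: real
  assumes a: "\<And>k. 0 < a k" and growth: "\<And>k. \<rho> * a k \<le> a (Suc k)" and \<rho>: "1 < \<rho>" and s: "0 \<le> s"
  shows "(\<Sum>k<n. if s \<le> a k then s / a k else 0) \<le> \<rho> / (\<rho> - 1)"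
proof -
  \<comment> \<open>Each summand is at most \<open>\<rho> / (\<rho> - 1)\<close> times the drop of
    the truncated ratio \<open>t\<close>, which decreases inside \<open>[0, 1]\<close>; the drops
    telescope.\<close>
  define t where "t k = min 1 (s / a k)" for k
  have ak: "a k \<le> a (Suc k)" for k
  proof -
    have "1 * a k \<le> \<rho> * a k" using a[of k] \<rho> by (intro mult_right_mono) auto
    then show ?thesis using growth[of k] by simp
  qed
  have "(\<Sum>k<n. if s \<le> a k then s / a k else 0) \<le> (\<Sum>k<n. \<rho> / (\<rho> - 1) * (t k - t (Suc k)))"
  proof (rule sum_mono)
    fix k
    show "(if s \<le> a k then s / a k else 0) \<le> \<rho> / (\<rho> - 1) * (t k - t (Suc k))"
    proof (cases "s \<le> a k")
      case True
      have "s / a (Suc k) \<le> s / (\<rho> * a k)"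
        using a \<rho> growth s by (intro divide_left_mono) (auto simp: mult_pos_pos)
      moreover have "t k = s / a k" "t (Suc k) \<le> s / a (Suc k)"
        using True a[of k] by (auto simp: t_def min_def divide_simps)
      ultimately have "t k - t (Suc k) \<ge> s / a k - s / (\<rho> * a k)" by linarith
      also have "s / a k - s / (\<rho> * a k) = (s / a k) * ((\<rho> - 1) / \<rho>)"
        using a[of k] \<rho> by (simp add: field_simps)
      finally have "\<rho> / (\<rho> - 1) * ((s / a k) * ((\<rho> - 1) / \<rho>)) \<le> \<rho> / (\<rho> - 1) * (t k - t (Suc k))"
        using \<rho> by (intro mult_left_mono) auto
      then show ?thesis using True \<rho> by simp
    next
      case False
      have "s / a (Suc k) \<le> s / a k"
        using ak[of k] a s by (intro divide_left_mono) auto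
      then have "t (Suc k) \<le> t k" by (auto simp: t_def)
      then show ?thesis using False \<rho> by simp
    qed
  qed
  also have "\<dots> = \<rho> / (\<rho> - 1) * (t 0 - t n)"
    by (simp only: sum_distrib_left[symmetric] sum_lessThan_telescope')
  also have "\<dots> \<le> \<rho> / (\<rho> - 1) * 1"
  proof (rule mult_left_mono)
    have "t 0 \<le> 1" "0 \<le> t n" using a[of n] s by (auto simp: t_def)
    then show "t 0 - t n \<le> 1" by linarith
  qed (use \<rho> in auto)
  finally show ?thesis by simp
qed

text \<open>Mirror image of the previous bound, for the terms below the threshold: the last
  admissible term dominates.\<close>

lemma geometric_sum_le:
  fixes a :: "nat \<Rightarrow> real" and s \<rho> :: real
  assumes a: "\<And>k. 0 < a k" and growth: "\<And>k. \<rho> * a k \<le> a (Suc k)" and \<rho>: "1 < \<rho>" and s: "0 < s"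
  shows "(\<Sum>k<n. if a k \<le> s then a k / s else 0) \<le> \<rho> / (\<rho> - 1)"
proof -
  define t where "t k = min 1 (a k / s)" for k
  define C where "C = \<rho> / (\<rho> - 1)"
  have C: "1 \<le> C" using \<rho> by (simp add: C_def)
  \<comment> \<open>The bound \<open>C * t n\<close> instead of \<open>C\<close> is what the
    induction carries; it leaves room for the next term as long as \<open>t\<close> has not reached
    \<open>1\<close>.\<close>
  have "(\<Sum>k<Suc n. if a k \<le> s then a k / s else 0) \<le> C * t n" for n
  proof (induction n)
    case 0
    have "0 \<le> t 0" using a[of 0] s by (simp add: t_def)
    then have "t 0 \<le> C * t 0" using C by (simp add: mult_le_cancel_right1)
    moreover have "(if a 0 \<le> s then a 0 / s else 0) \<le> t 0"
      using a[of 0] s by (auto simp: t_def)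
    ultimately show ?case by simp
  next
    case (Suc n)
    have "(if a (Suc n) \<le> s then a (Suc n) / s else 0) \<le> C * (t (Suc n) - t n)"
    proof (cases "a (Suc n) \<le> s")
      case True
      have "a n \<le> a (Suc n) / \<rho>" using growth[of n] \<rho> by (simp add: field_simps)
      then have "a n / s \<le> a (Suc n) / \<rho> / s" using s by (intro divide_right_mono) auto
      moreover have "t (Suc n) = a (Suc n) / s" "t n \<le> a n / s"
        using True s by (auto simp: t_def)
      ultimately have "t (Suc n) - t n \<ge> a (Suc n) / s - a (Suc n) / \<rho> / s" by linarith
      also have "a (Suc n) / s - a (Suc n) / \<rho> / s = (a (Suc n) / s) * ((\<rho> - 1) / \<rho>)"
        using \<rho> s by (simp add: field_simps)
      finally have "C * ((a (Suc n) / s) * ((\<rho> - 1) / \<rho>)) \<le> C * (t (Suc n) - t n)"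
        using C by (intro mult_left_mono) auto
      then show ?thesis using True \<rho> by (simp add: C_def)
    next
      case False
      have "a n \<le> a (Suc n)"
      proof -
        have "1 * a n \<le> \<rho> * a n" using a[of n] \<rho> by (intro mult_right_mono) auto
        then show ?thesis using growth[of n] by simp
      qed
      then have "t n \<le> t (Suc n)" using s by (auto simp: t_def min_def divide_simps)
      then show ?thesis using False C by simp
    qed
    then show ?case using Suc by (simp add: algebra_simps)
  qed
  note * = this
  show ?thesis
  proof (cases n)
    case 0
    then show ?thesis using \<rho> by simp
  next
    case (Suc l)
    have "C * t l \<le> C * 1" using C by (intro mult_left_mono) (auto simp: t_def)
    then show ?thesis using *[of l] Suc by (simp add: C_def)
  qed
qed

text \<open>Interchange of summation: the windows \<open>J k\<close> may overlap arbitrarily,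
  because the kernel gives each index \<open>j\<close> total mass at most \<open>C\<close>.\<close>

lemma summable_kernel_sum:
  fixes w :: "nat \<Rightarrow> real" and K :: "nat \<Rightarrow> nat \<Rightarrow> real"
  assumes w: "summable w" "\<And>j. 0 \<le> w j" and K: "\<And>k j. 0 \<le> K k j"
    and C: "\<And>n j. (\<Sum>k<n. K k j) \<le> C" and J: "\<And>k. finite (J k)"
  shows "summable (\<lambda>k. \<Sum>j\<in>J k. w j * K k j)"
proof (rule summableI_nonneg_bounded)
  show "0 \<le> (\<Sum>j\<in>J k. w j * K k j)" for k
    using w K by (intro sum_nonneg) auto
  fix n
  define U where "U = (\<Union>k<n. J k)"
  have fin: "finite U" unfolding U_def using J by auto
  have "0 \<le> C" using C[of 0 0] by simp
  have "(\<Sum>k<n. \<Sum>j\<in>J k. w j * K k j) \<le> (\<Sum>k<n. \<Sum>j\<in>U. w j * K k j)"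
    using w K fin by (intro sum_mono sum_mono2) (auto simp: U_def)
  also have "\<dots> = (\<Sum>j\<in>U. w j * (\<Sum>k<n. K k j))"
    by (subst sum.swap) (simp add: sum_distrib_left)
  also have "\<dots> \<le> (\<Sum>j\<in>U. w j * C)"
    using w C by (intro sum_mono mult_left_mono) auto
  also have "\<dots> = (\<Sum>j\<in>U. w j) * C" by (simp add: sum_distrib_right)
  also have "\<dots> \<le> suminf w * C"
    using w fin \<open>0 \<le> C\<close> by (intro mult_right_mono sum_le_suminf) auto
  finally show "(\<Sum>k<n. \<Sum>j\<in>J k. w j * K k j) \<le> suminf w * C" .
qed

text \<open>The true size is logarithmic. The square root suffices, because it leaves half a power
  of \<open>a / b\<close> in the Cauchy-Schwarz estimate that follows.\<close>

lemma sum_inverse_le_sqrt: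
  assumes "1 \<le> a" "a \<le> b"
  shows "(\<Sum>j=a..<b. 1 / real j) \<le> 2 * sqrt (real b / real a)"
  using assms(2)
proof (induction b rule: dec_induct)
  case base
  then show ?case by simp
next
  case (step b)
  show ?case
  \<comment> \<open>The general step needs \<open>v \<le> b / a\<close>, that is
    \<open>a * (b + 1) \<le> b\<^sup>2\<close>, which fails for \<open>b = a\<close>.\<close>
  proof (cases "b = a")
    case True
    have "1 \<le> sqrt (real (Suc a) / real a)" using assms(1) by (simp add: divide_simps)
    moreover have "1 / real a \<le> 1" using assms(1) by simp
    ultimately have "1 / real a \<le> 2 * sqrt (real (Suc a) / real a)" by linarith
    then show ?thesis using True by simp
  next
    case False
    then have ab: "a + 1 \<le> b" using step by simp
    define u v where "u = sqrt (real b / real a)" and "v = sqrt (real (Suc b) / real a)"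
    have v: "0 < v" "u \<le> v" using assms(1) by (auto simp: u_def v_def divide_right_mono)
    have sq: "v\<^sup>2 - u\<^sup>2 = 1 / real a"
      using assms(1) by (simp add: u_def v_def field_simps)
    have "v \<le> real b / real a"
    proof (rule power2_le_imp_le)
      have "real a * real (Suc b) \<le> (real b - 1) * (real b + 1)"
        using ab by (intro mult_mono) auto
      also have "\<dots> \<le> (real b)\<^sup>2" by (simp add: power2_eq_square algebra_simps)
      finally have "real a * real (Suc b) / (real a)\<^sup>2 \<le> (real b)\<^sup>2 / (real a)\<^sup>2"
        by (intro divide_right_mono) auto
      moreover have "v\<^sup>2 = real a * real (Suc b) / (real a)\<^sup>2"
        using assms(1) by (simp add: v_def power2_eq_square)
      ultimately show "v\<^sup>2 \<le> (real b / real a)\<^sup>2" by (simp add: power_divide)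
    qed simp
    then have "1 / real b \<le> 1 / (real a * v)"
      using assms(1) v ab by (intro divide_left_mono) (auto simp: field_simps)
    also have "\<dots> = (v\<^sup>2 - u\<^sup>2) / v" using sq by simp
    also have "\<dots> \<le> 2 * (v - u)"
    proof -
      have "v\<^sup>2 - u\<^sup>2 = (v - u) * (v + u)" by (simp add: power2_eq_square algebra_simps)
      also have "\<dots> \<le> (v - u) * (2 * v)" using v by (intro mult_left_mono) auto
      finally show ?thesis using v by (simp add: field_simps)
    qed
    finally show ?thesis using step unfolding u_def v_def by simp
  qed
qed

text \<open>Cauchy-Schwarz on the increment of \<open>m\<close>, with \<open>p j\<close> written as
  \<open>sqrt j * p j\<close> times \<open>1 / sqrt j\<close>: if \<open>m\<close> grows by a fixed
  factor although the weighted squares are small, then \<open>b / a\<close> must be large. The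
  common factor \<open>sqrt (a / b)\<close> is deliberately not cancelled; spread over the window it
  becomes a geometric kernel, which makes the bound summable over dyadic scales.\<close>

lemma ratio_le_of_sum_growth:
  fixes p :: "nat \<Rightarrow> real" and e :: real
  defines "m \<equiv> \<lambda>n. \<Sum>j<n. p j"
  assumes p: "\<And>j. 0 \<le> p j" and a: "1 \<le> a" "0 < m a" and e: "0 < e" and ab: "(1 + e) * m a \<le> m b"
  shows "real a / real b \<le> 2 * ((1 + e) / e)\<^sup>2 * sqrt (real a / real b) *
           (\<Sum>j=a..<b. real j * (p j)\<^sup>2 / (m j)\<^sup>2)"
proof -
  have mono: "m i \<le> m j" if "i \<le> j" for i j
    unfolding m_def using that p by (intro sum_mono2) auto
  have "m a < (1 + e) * m a" using a e by (simp add: algebra_simps)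
  then have ltab: "a < b" using ab mono[of b a] by (meson leI le_less_trans less_le_not_le)
  have mb: "0 < m b" using a mono[of a b] ltab by simp
  define W where "W = (\<Sum>j=a..<b. real j * (p j)\<^sup>2 / (m j)\<^sup>2)"
  have W0: "0 \<le> W" unfolding W_def by (intro sum_nonneg) auto
  have diff: "m b - m a = (\<Sum>j=a..<b. p j)"
    unfolding m_def using ltab by (subst sum.atLeastLessThan_concat[of 0 a b p, symmetric, unfolded atLeast0LessThan]) auto
  have "(e / (1 + e) * m b)\<^sup>2 \<le> (m b - m a)\<^sup>2"
  proof (rule power_mono)
    have "m a \<le> m b / (1 + e)" using ab e by (simp add: field_simps)
    moreover have "m b - m b / (1 + e) = e / (1 + e) * m b" using e by (simp add: field_simps)
    ultimately show "e / (1 + e) * m b \<le> m b - m a" by linarith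
  qed (use mb e in auto)
  also have "\<dots> = (\<Sum>j=a..<b. (sqrt (real j) * p j) * (1 / sqrt (real j)))\<^sup>2"
    unfolding diff using a by (intro arg_cong[of _ _ "\<lambda>x. x\<^sup>2"] sum.cong) auto
  also have "\<dots> \<le> (\<Sum>j=a..<b. (sqrt (real j) * p j)\<^sup>2) * (\<Sum>j=a..<b. (1 / sqrt (real j))\<^sup>2)"
    by (rule Cauchy_Schwarz_ineq_sum)
  also have "\<dots> = (\<Sum>j=a..<b. real j * (p j)\<^sup>2) * (\<Sum>j=a..<b. 1 / real j)"
    by (simp add: power_mult_distrib power_divide)
  also have "\<dots> \<le> (W * (m b)\<^sup>2) * (2 * sqrt (real b / real a))"
  proof (rule mult_mono)
    show "(\<Sum>j=a..<b. real j * (p j)\<^sup>2) \<le> W * (m b)\<^sup>2"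
      unfolding W_def sum_distrib_right
    proof (rule sum_mono)
      fix j assume j: "j \<in> {a..<b}"
      have mj: "0 < m j" "m j \<le> m b" using a mono[of a j] mono[of j b] j by auto
      then have "1 \<le> (m b)\<^sup>2 / (m j)\<^sup>2" by (simp add: power_mono)
      then have "real j * (p j)\<^sup>2 * 1 \<le> real j * (p j)\<^sup>2 * ((m b)\<^sup>2 / (m j)\<^sup>2)"
        by (intro mult_left_mono) auto
      then show "real j * (p j)\<^sup>2 \<le> real j * (p j)\<^sup>2 / (m j)\<^sup>2 * (m b)\<^sup>2" by simp
    qed
    show "(\<Sum>j=a..<b. 1 / real j) \<le> 2 * sqrt (real b / real a)"
      using a ltab by (intro sum_inverse_le_sqrt) auto
    show "0 \<le> W * (m b)\<^sup>2" using W0 by simp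
    show "0 \<le> (\<Sum>j=a..<b. 1 / real j)" by (intro sum_nonneg) auto
  qed
  finally have "(e / (1 + e))\<^sup>2 * (m b)\<^sup>2 \<le> (2 * W * sqrt (real b / real a)) * (m b)\<^sup>2"
    by (simp add: power_mult_distrib power_divide algebra_simps)
  then have key: "(e / (1 + e))\<^sup>2 \<le> 2 * W * sqrt (real b / real a)"
    using mb by (simp add: mult_le_cancel_right)
  define s where "s = sqrt (real a / real b)"
  have s: "0 < s" "s * s = real a / real b" using a ltab by (auto simp: s_def)
  have "sqrt (real b / real a) = 1 / s"
    unfolding s_def by (simp add: real_sqrt_divide)
  with key have "(e / (1 + e))\<^sup>2 * s \<le> 2 * W" using s by (simp add: field_simps)
  then have "s \<le> ((1 + e) / e)\<^sup>2 * (2 * W)"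
    using e by (simp add: field_simps power_divide)
  then have "s * s \<le> s * (((1 + e) / e)\<^sup>2 * (2 * W))" using s by (intro mult_left_mono) auto
  then show ?thesis using s unfolding W_def[symmetric] s_def[symmetric] by (simp add: mult_ac)
qed

section \<open>Truncation levels attached to the dyadic times\<close>

locale tail_sequence =
  fixes p :: "nat \<Rightarrow> real"
  assumes p_pos: "0 < p j" and p_antimono: "antimono p" and p_le_1: "p j \<le> 1"
    and sum_diverges: "filterlim (\<lambda>n. \<Sum>j<n. p j) at_top sequentially"
    and summable_squares: "summable (\<lambda>n. real n * (p n)\<^sup>2 / (\<Sum>j<n. p j)\<^sup>2)"
begin

definition m :: "nat \<Rightarrow> real" where "m n = (\<Sum>j<n. p j)"

definition w :: "nat \<Rightarrow> real" where "w n = real n * (p n)\<^sup>2 / (m n)\<^sup>2"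

lemma m_0 [simp]: "m 0 = 0" and m_Suc: "m (Suc n) = m n + p n"
  by (simp_all add: m_def)

lemma m_mono: "i \<le> j \<Longrightarrow> m i \<le> m j"
  unfolding m_def by (intro sum_mono2) (auto intro: less_imp_le p_pos)

lemma m_pos: "0 < n \<Longrightarrow> 0 < m n"
  unfolding m_def by (intro sum_pos) (auto intro: p_pos)

lemma m_nonneg: "0 \<le> m n"
  using m_pos[of n] by (cases "n = 0") auto

lemma m_at_top: "filterlim m at_top sequentially"
  using sum_diverges unfolding m_def[abs_def] .

lemma w_nonneg: "0 \<le> w n" and summable_w: "summable w"
  using summable_squares by (simp_all add: w_def[abs_def] m_def)

lemma ratio_le:
  assumes "1 \<le> a" "0 < e" "(1 + e) * m a \<le> m b"
  shows "real a / real b \<le> 2 * ((1 + e) / e)\<^sup>2 * sqrt (real a / real b) * (\<Sum>j=a..<b. w j)"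
  using ratio_le_of_sum_growth[of p a e b] assms m_pos[of a] less_imp_le[OF p_pos]
  unfolding w_def m_def by simp

lemma m_pow2_at_top: "filterlim (\<lambda>k. m (2 ^ k)) at_top sequentially"
proof (rule filterlim_compose[OF m_at_top])
  show "filterlim (\<lambda>k. 2 ^ k :: nat) at_top sequentially"
    by (rule filterlim_at_top_mono[OF filterlim_ident]) (simp add: less_imp_le)
qed

text \<open>The level \<open>c k\<close> is the first index at which \<open>m\<close> reaches the
  fraction \<open>\<eta>\<close> of \<open>m (2 ^ k)\<close>. As \<open>p \<le> 1\<close>, it
  overshoots by at most \<open>1\<close>.\<close>

lemma lower_level:
  assumes \<eta>: "0 < \<eta>" "\<eta> \<le> 1 / 2"
  obtains c :: "nat \<Rightarrow> nat" where "summable (\<lambda>k. real (c k) / 2 ^ k)"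
    "\<forall>\<^sub>F k in sequentially. \<eta> * m (2 ^ k) \<le> m (c k) \<and> m (c k) \<le> 2 * \<eta> * m (2 ^ k)"
    "filterlim c at_top sequentially"
proof -
  define c where "c k = (LEAST c. \<eta> * m (2 ^ k) \<le> m c)" for k
  have ex: "\<eta> * m (2 ^ k) \<le> m (2 ^ k)" for k
    using m_nonneg[of "2 ^ k"] \<eta> by (simp add: mult_left_le_one_le)
  have c1: "\<eta> * m (2 ^ k) \<le> m (c k)" for k
    unfolding c_def by (rule LeastI[of "\<lambda>c. \<eta> * m (2 ^ k) \<le> m c", OF ex])
  have c2: "m (c k) \<le> \<eta> * m (2 ^ k) + 1" for k
  proof (cases "c k")
    case 0
    then show ?thesis using \<eta> m_nonneg[of "2 ^ k"] by simp
  next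
    case (Suc i)
    then have "\<not> \<eta> * m (2 ^ k) \<le> m i"
      unfolding c_def using not_less_Least[of i "\<lambda>c. \<eta> * m (2 ^ k) \<le> m c"] by simp
    then show ?thesis using Suc m_Suc[of i] p_le_1[of i] by simp
  qed
  \<comment> \<open>From \<open>6\<close> on, the overshoot leaves
    \<open>m (c k) \<le> 2 / 3 * m (2 ^ k)\<close>, as \<open>ratio_le\<close> with
    \<open>e = 1 / 2\<close> requires; from \<open>1 / \<eta>\<close> on, it is absorbed by the
    factor \<open>2\<close> in the upper bound.\<close>
  have large: "\<forall>\<^sub>F k in sequentially. max 6 (1 / \<eta>) \<le> m (2 ^ k)"
    using m_pow2_at_top unfolding filterlim_at_top by blast
  \<comment> \<open>The constant of \<open>ratio_le\<close> at \<open>e = 1 / 2\<close> is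
    \<open>2 * 3\<^sup>2 = 18\<close>. On the window \<open>c k \<le> j\<close>, so
    \<open>sqrt (c k / 2 ^ k)\<close> is at most \<open>sqrt (j / 2 ^ k)\<close>, which is geometric
    in \<open>k\<close> with ratio \<open>sqrt 2\<close>.\<close>
  have bound: "real (c k) / 2 ^ k \<le> 18 * (\<Sum>j=c k..<2 ^ k. w j *
      (if sqrt (real j) \<le> sqrt 2 ^ k then sqrt (real j) / sqrt 2 ^ k else 0))"
    if "max 6 (1 / \<eta>) \<le> m (2 ^ k)" for k
  proof -
    have "0 < \<eta> * m (2 ^ k)" using that \<eta> by (intro mult_pos_pos) auto
    then have "1 \<le> c k" using c1[of k] by (cases "c k") auto
    moreover have "(1 + 1 / 2) * m (c k) \<le> m (2 ^ k)"
    proof -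
      have "\<eta> * m (2 ^ k) \<le> 1 / 2 * m (2 ^ k)" using \<eta> m_nonneg by (intro mult_right_mono) auto
      moreover have "6 \<le> m (2 ^ k)" using that by simp
      ultimately have "3 * m (c k) \<le> 2 * m (2 ^ k)" using c2[of k] by linarith
      then show ?thesis by simp
    qed
    ultimately have "real (c k) / 2 ^ k \<le> 18 * sqrt (real (c k) / 2 ^ k) * (\<Sum>j=c k..<2 ^ k. w j)"
      using ratio_le[of "c k" "1/2" "2 ^ k"] by (simp add: power2_eq_square)
    also have "\<dots> = 18 * (\<Sum>j=c k..<2 ^ k. w j * sqrt (real (c k) / 2 ^ k))"
      by (simp add: sum_distrib_left mult_ac)
    also have "\<dots> \<le> 18 * (\<Sum>j=c k..<2 ^ k. w j *
      (if sqrt (real j) \<le> sqrt 2 ^ k then sqrt (real j) / sqrt 2 ^ k else 0))"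
    proof (intro mult_left_mono sum_mono)
      fix j assume j: "j \<in> {c k..<2 ^ k}"
      have "real j \<le> 2 ^ k" using j by (simp add: of_nat_less_imp_less less_imp_le)
      then have "sqrt (real j) \<le> sqrt 2 ^ k" by (simp flip: real_sqrt_power)
      moreover have "sqrt (real (c k) / 2 ^ k) \<le> sqrt (real j) / sqrt 2 ^ k"
        using j by (simp add: real_sqrt_divide real_sqrt_power divide_right_mono)
      ultimately show "sqrt (real (c k) / 2 ^ k) \<le>
          (if sqrt (real j) \<le> sqrt 2 ^ k then sqrt (real j) / sqrt 2 ^ k else 0)" by simp
    qed (auto simp: w_nonneg)
    finally show ?thesis .
  qed
  have "summable (\<lambda>k. \<Sum>j\<in>{c k..<2 ^ k}. w j *
      (if sqrt (real j) \<le> sqrt 2 ^ k then sqrt (real j) / sqrt 2 ^ k else 0))"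
    by (rule summable_kernel_sum[where C = "sqrt 2 / (sqrt 2 - 1)"])
       (auto intro!: summable_w w_nonneg geometric_sum_recip_le)
  then have "summable (\<lambda>k. 18 * (\<Sum>j\<in>{c k..<2 ^ k}. w j *
      (if sqrt (real j) \<le> sqrt 2 ^ k then sqrt (real j) / sqrt 2 ^ k else 0)))"
    by (rule summable_mult)
  then have "summable (\<lambda>k. real (c k) / 2 ^ k)"
    by (rule summable_comparison_test_ev[rotated]) (use large bound in \<open>auto elim!: eventually_mono\<close>)
  moreover have "\<forall>\<^sub>F k in sequentially. \<eta> * m (2 ^ k) \<le> m (c k) \<and> m (c k) \<le> 2 * \<eta> * m (2 ^ k)"
    using large
  proof eventually_elim
    case (elim k)
    have "1 \<le> \<eta> * m (2 ^ k)" using elim \<eta> by (simp add: field_simps)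
    then show ?case using c1[of k] c2[of k] by simp
  qed
  moreover have "filterlim c at_top sequentially"
    unfolding filterlim_at_top
  proof
    fix Z :: nat
    have "\<forall>\<^sub>F k in sequentially. (m Z + 1) / \<eta> \<le> m (2 ^ k)"
      using m_pow2_at_top by (auto simp: filterlim_at_top)
    then show "\<forall>\<^sub>F k in sequentially. Z \<le> c k"
    proof eventually_elim
      case (elim k)
      then have "m Z < m (c k)" using c1[of k] \<eta> by (simp add: field_simps)
      then show ?case using m_mono[of "c k" Z] by (meson linorder_not_le nle_le)
    qed
  qed
  ultimately show ?thesis by (rule that)
qed

text \<open>Same argument with the window above \<open>2 ^ k\<close>: there \<open>j < d k\<close>,
  so the kernel is \<open>sqrt (2 ^ k / j)\<close>, increasing in \<open>k\<close> up to the
  threshold. Hence \<open>geometric_sum_le\<close> takes the place of its reciprocal form.\<close>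

lemma upper_level:
  obtains d :: "nat \<Rightarrow> nat" where "summable (\<lambda>k. 2 ^ k / real (d k))"
    "\<forall>\<^sub>F k in sequentially. 2 ^ k \<le> d k \<and> m (d k) \<le> 3 * m (2 ^ k)"
proof -
  define d where "d k = (LEAST d. 2 * m (2 ^ k) \<le> m d)" for k
  have d1: "2 * m (2 ^ k) \<le> m (d k)" for k
  proof -
    have "\<forall>\<^sub>F d in sequentially. 2 * m (2 ^ k) \<le> m d"
      using m_at_top by (auto simp: filterlim_at_top)
    then have "\<exists>d. 2 * m (2 ^ k) \<le> m d" by (auto simp: eventually_sequentially)
    then show ?thesis unfolding d_def by (rule LeastI_ex)
  qed
  have pos: "0 < m (2 ^ k)" for k using m_pos by simp
  have d2: "m (d k) \<le> 2 * m (2 ^ k) + 1" for k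
  proof (cases "d k")
    case 0
    then show ?thesis using pos[of k] by simp
  next
    case (Suc i)
    then have "\<not> 2 * m (2 ^ k) \<le> m i"
      unfolding d_def using not_less_Least[of i "\<lambda>d. 2 * m (2 ^ k) \<le> m d"] by simp
    then show ?thesis using Suc m_Suc[of i] p_le_1[of i] by simp
  qed
  have d3: "2 ^ k \<le> d k" for k
  proof (rule ccontr)
    assume "\<not> 2 ^ k \<le> d k"
    then have "m (d k) \<le> m (2 ^ k)" by (intro m_mono) simp
    then show False using d1[of k] pos[of k] by simp
  qed
  \<comment> \<open>The maximum with \<open>1\<close> only keeps \<open>s 0\<close> positive, as
    \<open>geometric_sum_le\<close> demands for every index.\<close>
  define s where "s j = sqrt (real (max 1 j))" for j :: nat
  have s_pos: "0 < s j" for j by (simp add: s_def)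
  \<comment> \<open>The constant of \<open>ratio_le\<close> at \<open>e = 1\<close> is
    \<open>2 * 2\<^sup>2 = 8\<close>.\<close>
  have bound: "2 ^ k / real (d k) \<le> 8 * (\<Sum>j=2 ^ k..<d k. w j *
      (if sqrt 2 ^ k \<le> s j then sqrt 2 ^ k / s j else 0))" for k
  proof -
    have "2 ^ k / real (d k) \<le> 8 * sqrt (2 ^ k / real (d k)) * (\<Sum>j=2 ^ k..<d k. w j)"
      using ratio_le[of "2 ^ k" 1 "d k"] d1[of k] by simp
    also have "\<dots> = 8 * (\<Sum>j=2 ^ k..<d k. w j * sqrt (2 ^ k / real (d k)))"
      by (simp add: sum_distrib_left mult_ac)
    also have "\<dots> \<le> 8 * (\<Sum>j=2 ^ k..<d k. w j *
      (if sqrt 2 ^ k \<le> s j then sqrt 2 ^ k / s j else 0))"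
    proof (intro mult_left_mono sum_mono)
      fix j assume j: "j \<in> {2 ^ k..<d k}"
      then have "1 \<le> j" by (meson atLeastLessThan_iff one_le_power one_le_numeral order_trans)
      then have sj: "s j = sqrt (real j)" by (simp add: s_def max_def)
      have "2 ^ k \<le> real j" using j by (metis atLeastLessThan_iff of_nat_le_iff of_nat_numeral of_nat_power)
      then have "sqrt 2 ^ k \<le> s j" by (simp add: sj flip: real_sqrt_power)
      moreover have "sqrt (2 ^ k / real (d k)) \<le> sqrt 2 ^ k / s j"
        using j \<open>1 \<le> j\<close> unfolding sj
        by (simp add: real_sqrt_divide real_sqrt_power divide_left_mono)
      ultimately show "sqrt (2 ^ k / real (d k)) \<le>
          (if sqrt 2 ^ k \<le> s j then sqrt 2 ^ k / s j else 0)" by simp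
    qed (auto simp: w_nonneg)
    finally show ?thesis .
  qed
  have "summable (\<lambda>k. \<Sum>j\<in>{2 ^ k..<d k}. w j *
      (if sqrt 2 ^ k \<le> s j then sqrt 2 ^ k / s j else 0))"
    by (rule summable_kernel_sum[where C = "sqrt 2 / (sqrt 2 - 1)"])
       (auto intro!: summable_w w_nonneg geometric_sum_le s_pos divide_nonneg_pos)
  then have "summable (\<lambda>k. 8 * (\<Sum>j\<in>{2 ^ k..<d k}. w j *
      (if sqrt 2 ^ k \<le> s j then sqrt 2 ^ k / s j else 0)))"
    by (rule summable_mult)
  then have "summable (\<lambda>k. 2 ^ k / real (d k))"
    by (rule summable_comparison_test_ev[rotated]) (use bound in auto)
  moreover have "\<forall>\<^sub>F k in sequentially. 2 ^ k \<le> d k \<and> m (d k) \<le> 3 * m (2 ^ k)"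
  proof -
    have "\<forall>\<^sub>F k in sequentially. 1 \<le> m (2 ^ k)"
      using m_pow2_at_top by (auto simp: filterlim_at_top)
    then show ?thesis
    proof eventually_elim
      case (elim k)
      then show ?case using d2[of k] d3[of k] by simp
    qed
  qed
  ultimately show ?thesis by (rule that)
qed

text \<open>On the window from \<open>n\<close> to \<open>2 * n\<close> the ratio is fixed at
  \<open>1 / 2\<close>, so growth by \<open>3 / 2\<close> would force a block of \<open>w\<close> of
  size at least \<open>(1 / 2) / 18 = 1 / 36\<close>, against the Cauchy criterion. The bound lets
  the dyadic values of \<open>\<alpha>\<close> grow geometrically and makes \<open>m\<close> at a
  time comparable with \<open>m\<close> at the next power of two.\<close>

lemma eventually_m_double_le: "\<forall>\<^sub>F n in sequentially. m (2 * n) \<le> 3 / 2 * m n"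
proof -
  obtain N where N: "\<And>a b. N \<le> a \<Longrightarrow> norm (\<Sum>j=a..<b. w j) < 1 / 36"
    using summable_w unfolding summable_Cauchy by (meson zero_less_divide_1_iff zero_less_numeral)
  have "m (2 * n) \<le> 3 / 2 * m n" if "max 1 N \<le> n" for n
  proof (rule ccontr)
    assume "\<not> m (2 * n) \<le> 3 / 2 * m n"
    then have "real n / real (2 * n) \<le> 18 * sqrt (real n / real (2 * n)) * (\<Sum>j=n..<2 * n. w j)"
      using ratio_le[of n "1/2" "2 * n"] that by (simp add: power2_eq_square)
    also have "\<dots> \<le> 18 * 1 * (\<Sum>j=n..<2 * n. w j)"
      using w_nonneg that by (intro mult_right_mono mult_left_mono sum_nonneg) auto
    also have "\<dots> < 1 / 2" using N[of n "2 * n"] that by simp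
    finally show False using that by simp
  qed
  then show ?thesis by (rule eventually_sequentiallyI)
qed

text \<open>
  The relative increments of \<open>F / m\<close> are \<open>o(1)\<close> times those of \<open>m\<close>, so \<open>F / m\<close>, and with it
  \<open>L\<close>, is almost constant on every stretch on which \<open>m\<close> varies by a bounded factor.
\<close>
lemma almost_constant:
  fixes \<gamma> \<phi> \<theta> L :: "nat \<Rightarrow> real"
  defines "F \<equiv> \<lambda>n. \<Sum>j<n. \<gamma> j * p j"
  assumes L: "\<forall>\<^sub>F n in sequentially. 0 < L n"
    and F: "(\<lambda>n. F n / (L n * m n)) \<longlonglongrightarrow> 1" and \<gamma>: "(\<lambda>n. \<gamma> n / L n) \<longlonglongrightarrow> 1"
    and \<phi>: "(\<lambda>n. \<phi> n / L n) \<longlonglongrightarrow> 1" and \<theta>: "(\<lambda>n. \<theta> n / L n) \<longlonglongrightarrow> 1"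
    and r: "1 \<le> r" and \<epsilon>: "0 < \<epsilon>"
  shows "\<exists>N. \<forall>x\<ge>N. \<forall>y\<ge>N. m x \<le> r * m y \<longrightarrow> m y \<le> r * m x \<longrightarrow> \<bar>\<phi> x - \<theta> y\<bar> \<le> \<epsilon> * \<theta> y"
proof -
  define \<rho> where "\<rho> n = F n / m n" for n
  have \<rho>L: "(\<lambda>n. \<rho> n / L n) \<longlonglongrightarrow> 1"
    using F by (simp add: \<rho>_def mult.commute)
  have pos_of: "\<forall>\<^sub>F n in sequentially. 0 < f n" if "(\<lambda>n. f n / L n) \<longlonglongrightarrow> 1" for f :: "nat \<Rightarrow> real"
  proof -
    have "\<forall>\<^sub>F n in sequentially. 0 < f n / L n"
      using order_tendstoD(1)[OF that, of 0] by simp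
    with L show ?thesis by eventually_elim (simp add: zero_less_divide_iff)
  qed
  note \<rho>_pos = pos_of[OF \<rho>L] and \<phi>_pos = pos_of[OF \<phi>] and \<theta>_pos = pos_of[OF \<theta>]
  have over_\<rho>: "(\<lambda>n. f n / \<rho> n) \<longlonglongrightarrow> 1" if "(\<lambda>n. f n / L n) \<longlonglongrightarrow> 1" for f :: "nat \<Rightarrow> real"
  proof -
    have "(\<lambda>n. (f n / L n) / (\<rho> n / L n)) \<longlonglongrightarrow> 1 / 1"
      by (intro tendsto_divide that \<rho>L) simp
    moreover have "\<forall>\<^sub>F n in sequentially. (f n / L n) / (\<rho> n / L n) = f n / \<rho> n"
      using L by eventually_elim simp
    ultimately have "(\<lambda>n. f n / \<rho> n) \<longlonglongrightarrow> 1 / 1" by (rule Lim_transform_eventually)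
    then show ?thesis by simp
  qed
  \<comment> \<open>Three errors share \<open>ln (1 + \<epsilon>)\<close> equally:
    \<open>\<phi> x\<close> against \<open>\<rho> x\<close>, \<open>\<rho> x\<close> against
    \<open>\<rho> y\<close>, and \<open>\<theta> y\<close> against \<open>\<rho> y\<close>. The
    middle one is at most \<open>2 * \<delta> * ln r\<close>; the summand \<open>1\<close> in the
    denominator avoids division by zero when \<open>r = 1\<close>.\<close>
  define \<delta> where "\<delta> = min (1 / 2) (ln (1 + \<epsilon>) / (6 * (1 + ln r)))"
  have lnr: "0 \<le> ln r" using r by simp
  have "\<delta> \<le> 1 / 2" unfolding \<delta>_def by (rule min.cobounded1)
  moreover have "0 < ln (1 + \<epsilon>) / (6 * (1 + ln r))" using \<epsilon> lnr by (intro divide_pos_pos) auto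
  ultimately have \<delta>: "0 < \<delta>" "\<delta> \<le> 1 / 2" by (auto simp: \<delta>_def)
  have ln_lim: "\<forall>\<^sub>F n in sequentially. \<bar>ln (f n / \<rho> n)\<bar> < ln (1 + \<epsilon>) / 3"
    if "(\<lambda>n. f n / L n) \<longlonglongrightarrow> 1" for f :: "nat \<Rightarrow> real"
  proof -
    have "(\<lambda>n. ln (f n / \<rho> n)) \<longlonglongrightarrow> ln 1"
      by (intro tendsto_ln over_\<rho> that) simp
    then have "(\<lambda>n. \<bar>ln (f n / \<rho> n)\<bar>) \<longlonglongrightarrow> 0" by (simp add: tendsto_rabs_zero)
    then show ?thesis using \<epsilon> by (intro order_tendstoD(2)) auto
  qed
  have "\<forall>\<^sub>F n in sequentially. \<bar>\<gamma> n / \<rho> n - 1\<bar> < \<delta>"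
  proof -
    have "(\<lambda>n. \<gamma> n / \<rho> n - 1) \<longlonglongrightarrow> 1 - 1" by (intro tendsto_diff over_\<rho> \<gamma> tendsto_const)
    then have "(\<lambda>n. \<bar>\<gamma> n / \<rho> n - 1\<bar>) \<longlonglongrightarrow> 0" by (simp add: tendsto_rabs_zero)
    then show ?thesis using \<delta> by (intro order_tendstoD(2)) auto
  qed
  then have "\<forall>\<^sub>F n in sequentially. \<bar>\<gamma> n / \<rho> n - 1\<bar> < \<delta> \<and> 0 < \<rho> n \<and> 0 < \<phi> n \<and> 0 < \<theta> n \<and> 0 < n \<and>
      \<bar>ln (\<phi> n / \<rho> n)\<bar> < ln (1 + \<epsilon>) / 3 \<and> \<bar>ln (\<theta> n / \<rho> n)\<bar> < ln (1 + \<epsilon>) / 3"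
    using \<rho>_pos \<phi>_pos \<theta>_pos ln_lim[OF \<phi>] ln_lim[OF \<theta>] eventually_gt_at_top[of 0]
    by eventually_elim blast
  then obtain N where N: "\<And>n. N \<le> n \<Longrightarrow> \<bar>\<gamma> n / \<rho> n - 1\<bar> < \<delta> \<and> 0 < \<rho> n \<and> 0 < \<phi> n \<and> 0 < \<theta> n \<and> 0 < n \<and>
      \<bar>ln (\<phi> n / \<rho> n)\<bar> < ln (1 + \<epsilon>) / 3 \<and> \<bar>ln (\<theta> n / \<rho> n)\<bar> < ln (1 + \<epsilon>) / 3"
    by (auto simp: eventually_sequentially)
  \<comment> \<open>\<open>\<rho>\<close> is the \<open>p\<close>-weighted average of the values of
    \<open>\<gamma>\<close>, so one more term multiplies it by \<open>1 + z\<close>, where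
    \<open>z\<close> is a relative error below \<open>\<delta>\<close> times
    \<open>p n / m (Suc n)\<close>. The latter is at most the increment of
    \<open>ln m\<close>.\<close>
  have increment: "\<bar>ln (\<rho> (Suc n)) - ln (\<rho> n)\<bar> \<le> 2 * \<delta> * (ln (m (Suc n)) - ln (m n))" if n: "N \<le> n" for n
  proof -
    define z where "z = (\<gamma> n / \<rho> n - 1) * (p n / m (Suc n))"
    have mp: "0 < m n" "0 < m (Suc n)" using N[OF n] m_pos by auto
    have rp: "0 < \<rho> n" "0 < \<rho> (Suc n)" using N[of n] N[of "Suc n"] n by auto
    have Fn: "F n = \<rho> n * m n" using mp by (simp add: \<rho>_def)
    have "\<rho> (Suc n) = (\<rho> n * m n + \<gamma> n * p n) / m (Suc n)"
      using Fn by (simp add: \<rho>_def F_def)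
    also have "\<dots> = \<rho> n + (\<gamma> n - \<rho> n) * (p n / m (Suc n))"
      using mp by (simp add: m_Suc field_simps)
    also have "(\<gamma> n - \<rho> n) * (p n / m (Suc n)) = \<rho> n * z"
    proof -
      have "\<rho> n * (\<gamma> n / \<rho> n - 1) = \<gamma> n - \<rho> n" using rp by (simp add: right_diff_distrib)
      then show ?thesis unfolding z_def by (metis mult.assoc)
    qed
    also have "\<rho> n + \<rho> n * z = \<rho> n * (1 + z)" by (simp add: algebra_simps)
    finally have eq: "\<rho> (Suc n) / \<rho> n = 1 + z" using rp by (simp add: field_simps)
    have q: "0 \<le> p n / m (Suc n)" "p n / m (Suc n) \<le> 1" "p n / m (Suc n) = 1 - m n / m (Suc n)"
      using mp p_pos[of n] m_nonneg[of n] by (auto simp: m_Suc field_simps)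
    have z: "\<bar>z\<bar> \<le> \<delta> * (p n / m (Suc n))"
      unfolding z_def abs_mult using q N[OF n] by (intro mult_mono) auto
    also have "\<dots> \<le> \<delta> * 1" using q \<delta> by (intro mult_left_mono) auto
    finally have z2: "\<bar>z\<bar> \<le> 1 / 2" using \<delta> by simp
    have "\<bar>ln (1 + z) - z\<bar> \<le> 2 * z\<^sup>2" by (rule abs_ln_one_plus_x_minus_x_bound[OF z2])
    also have "\<dots> = 2 * \<bar>z\<bar> * \<bar>z\<bar>" by (simp add: power2_eq_square)
    also have "\<dots> \<le> 1 * \<bar>z\<bar>" using z2 by (intro mult_right_mono) auto
    finally have "\<bar>ln (1 + z)\<bar> \<le> 2 * \<bar>z\<bar>" by linarith
    also have "\<dots> \<le> 2 * \<delta> * (p n / m (Suc n))" using z by simp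
    also have "\<dots> \<le> 2 * \<delta> * (ln (m (Suc n)) - ln (m n))"
    proof (intro mult_left_mono)
      have "ln (m n / m (Suc n)) \<le> m n / m (Suc n) - 1" using mp by (intro ln_le_minus_one) simp
      then show "p n / m (Suc n) \<le> ln (m (Suc n)) - ln (m n)"
        using q(3) mp by (simp add: ln_div)
    qed (use \<delta> in auto)
    finally have "\<bar>ln (\<rho> (Suc n) / \<rho> n)\<bar> \<le> 2 * \<delta> * (ln (m (Suc n)) - ln (m n))"
      unfolding eq .
    then show ?thesis using rp by (simp add: ln_div)
  qed
  have far: "\<bar>ln (\<rho> y) - ln (\<rho> x)\<bar> \<le> 2 * \<delta> * (ln (m y) - ln (m x))" if "N \<le> x" "x \<le> y" for x y
    using that(2)
  proof (induction y rule: dec_induct)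
    case base
    then show ?case by simp
  next
    case (step y)
    have "N \<le> y" using that(1) step.hyps by simp
    then have "\<bar>ln (\<rho> (Suc y)) - ln (\<rho> x)\<bar> \<le>
        2 * \<delta> * (ln (m y) - ln (m x)) + 2 * \<delta> * (ln (m (Suc y)) - ln (m y))"
      using increment[of y] step.IH by linarith
    then show ?case by (simp add: algebra_simps)
  qed
  have near: "\<bar>ln (\<rho> x) - ln (\<rho> y)\<bar> \<le> ln (1 + \<epsilon>) / 3"
    if xy: "N \<le> x" "N \<le> y" "m x \<le> r * m y" "m y \<le> r * m x" for x y
  proof -
    have *: "2 * \<delta> * (ln (m b) - ln (m a)) \<le> ln (1 + \<epsilon>) / 3" if "N \<le> a" "a \<le> b" "m b \<le> r * m a" for a b
    proof -
      have ma: "0 < m a" "0 < m b" using N[of a] N[of b] that m_pos by auto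
      then have "ln (m b) \<le> ln (r * m a)" using that r by (subst ln_le_cancel_iff) auto
      then have "ln (m b) - ln (m a) \<le> ln r" using ma r by (simp add: ln_mult)
      then have "2 * \<delta> * (ln (m b) - ln (m a)) \<le> 2 * \<delta> * (1 + ln r)"
        using \<delta> by (intro mult_left_mono) auto
      also have "\<dots> \<le> 2 * (ln (1 + \<epsilon>) / (6 * (1 + ln r))) * (1 + ln r)"
        using lnr by (intro mult_right_mono mult_left_mono) (auto simp: \<delta>_def)
      also have "\<dots> = ln (1 + \<epsilon>) / 3" using lnr by (simp add: field_simps)
      finally show ?thesis .
    qed
    show ?thesis
    proof (cases "x \<le> y")
      case True
      then show ?thesis using far[of x y] *[of x y] xy by (smt (verit))
    next
      case False
      then show ?thesis using far[of y x] *[of y x] xy by (smt (verit) linorder_linear)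
    qed
  qed
  show ?thesis
  proof (intro exI[of _ N] allI impI)
    fix x y assume xy: "N \<le> x" "N \<le> y" "m x \<le> r * m y" "m y \<le> r * m x"
    have pos: "0 < \<phi> x" "0 < \<theta> y" "0 < \<rho> x" "0 < \<rho> y" using N[of x] N[of y] xy by auto
    define t where "t = ln (\<phi> x / \<theta> y)"
    have "t = ln (\<phi> x / \<rho> x) + (ln (\<rho> x) - ln (\<rho> y)) - ln (\<theta> y / \<rho> y)"
      using pos by (simp add: t_def ln_div)
    then have t: "\<bar>t\<bar> \<le> ln (1 + \<epsilon>)"
      using near[OF xy] N[of x] N[of y] xy by linarith
    have et: "exp t = \<phi> x / \<theta> y" using pos by (simp add: t_def)
    have "exp t \<le> exp (ln (1 + \<epsilon>))" using t by simp
    then have up: "\<phi> x / \<theta> y \<le> 1 + \<epsilon>" using \<epsilon> et by simp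
    have "exp (- ln (1 + \<epsilon>)) \<le> exp t" using t by simp
    moreover have "1 - \<epsilon> \<le> exp (- ln (1 + \<epsilon>))"
    proof -
      have "(1 - \<epsilon>) * (1 + \<epsilon>) \<le> 1" by (simp add: algebra_simps)
      then show ?thesis using \<epsilon> by (simp add: exp_minus field_simps)
    qed
    ultimately have lo: "1 - \<epsilon> \<le> \<phi> x / \<theta> y" using et by simp
    have "\<phi> x \<le> (1 + \<epsilon>) * \<theta> y" "(1 - \<epsilon>) * \<theta> y \<le> \<phi> x"
      using up lo pos by (simp_all add: field_simps)
    then show "\<bar>\<phi> x - \<theta> y\<bar> \<le> \<epsilon> * \<theta> y" by (simp add: algebra_simps abs_le_iff)
  qed
qed

end

section \<open>Concentration under mixing of pairs\<close>

text \<open>Each distance from \<open>i\<close> occurs at most twice, once on either side.\<close>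

lemma sum_abs_diff_le:
  fixes f :: "nat \<Rightarrow> real"
  assumes f: "\<And>k. 0 \<le> f k" and i: "i < n"
  shows "(\<Sum>j<n. f (if i \<le> j then j - i else i - j)) \<le> 2 * (\<Sum>k<n. f k)"
proof -
  have "(\<Sum>j<n. f (if i \<le> j then j - i else i - j)) =
      (\<Sum>j\<in>{..<i} \<union> {i..<n}. f (if i \<le> j then j - i else i - j))"
    using i by (intro sum.cong) auto
  also have "\<dots> = (\<Sum>j<i. f (if i \<le> j then j - i else i - j)) +
      (\<Sum>j\<in>{i..<n}. f (if i \<le> j then j - i else i - j))"
    by (intro sum.union_disjoint) auto
  also have "(\<Sum>j<i. f (if i \<le> j then j - i else i - j)) = (\<Sum>k\<in>{0<..i}. f k)"
    by (rule sum.reindex_bij_witness[of _ "\<lambda>k. i - k" "\<lambda>j. i - j"]) auto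
  also have "(\<Sum>k\<in>{0<..i}. f k) \<le> (\<Sum>k<n. f k)"
    using i f by (intro sum_mono2) auto
  also have "(\<Sum>j\<in>{i..<n}. f (if i \<le> j then j - i else i - j)) = (\<Sum>k<n - i. f k)"
    by (rule sum.reindex_bij_witness[of _ "\<lambda>k. i + k" "\<lambda>j. j - i"]) auto
  also have "(\<Sum>k<n - i. f k) \<le> (\<Sum>k<n. f k)"
    using f by (intro sum_mono2) auto
  finally show ?thesis by simp
qed

text \<open>The form in which \<psi>-mixing enters Chebyshev's inequality: one-sided bounds on joint
  tails suffice for a second moment of nonnegative layer sums. Lags below \<open>K\<close>, at which
  the mixing coefficient may be infinite, are left uncontrolled.\<close>

locale mixing_tails = finite_measure P for P :: "'a measure" +
  fixes X :: "nat \<Rightarrow> 'a \<Rightarrow> nat" and p :: "nat \<Rightarrow> real" and \<psi> :: "nat \<Rightarrow> real" and K :: nat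
  assumes measure_space_eq_1: "measure P (space P) = 1"
    and X_measurable [measurable]: "\<And>j. X j \<in> measurable P (count_space UNIV)"
    and tail: "\<And>j l. measure P {x\<in>space P. l < X j x} = p l"
    and pair_tail: "\<And>i j l l'. i + K \<le> j \<Longrightarrow>
          measure P {x\<in>space P. l < X i x \<and> l' < X j x} \<le> (1 + \<psi> (j - i)) * (p l * p l')"
    and \<psi>_nonneg: "\<And>k. 0 \<le> \<psi> k"
begin

lemma p_nonneg: "0 \<le> p l"
  using tail[of l 0] measure_nonneg by metis

text \<open>Chebyshev's inequality; the pairs at distance less than \<open>K\<close> are not controlled by mixing
  and are estimated by the largest value of the summands.\<close>
lemma deviation_le:
  fixes \<gamma> :: "nat \<Rightarrow> real"
  defines "\<theta> c \<equiv> \<Sum>l<c. \<gamma> l * p l"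
  assumes \<gamma>: "\<And>l. 0 \<le> \<gamma> l" and \<theta>: "0 < \<theta> c" and n: "0 < n"
  shows "measure P {x\<in>space P. real n * \<theta> c / 2 \<le> \<bar>(\<Sum>i<n. \<Sum>l<min (X i x) c. \<gamma> l) - real n * \<theta> c\<bar>}
     \<le> 8 * real K * (\<Sum>l<c. \<gamma> l) / (real n * \<theta> c) + 8 * (\<Sum>k<n. \<psi> k) / real n"
proof -
  define A where "A i l = {x\<in>space P. l < X i x}" for i l
  have A [measurable]: "A i l \<in> sets P" for i l unfolding A_def by measurable
  \<comment> \<open>Layer decomposition of the truncated observable: expectations of products then
    reduce to joint tail probabilities.\<close>
  define Z where "Z i x = (\<Sum>l<c. \<gamma> l * indicator (A i l) x)" for i x
  define B where "B = (\<Sum>l<c. \<gamma> l)"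
  define t where "t = \<theta> c"
  have t: "0 < t" using \<theta> by (simp add: t_def)
  have B0: "0 \<le> B" unfolding B_def using \<gamma> by (intro sum_nonneg) auto
  have Z_eq: "(\<Sum>l<min (X i x) c. \<gamma> l) = Z i x" if "x \<in> space P" for i x
    unfolding Z_def
    by (rule sum.mono_neutral_cong_left) (use that in \<open>auto simp: A_def indicator_def\<close>)
  have Z_meas [measurable]: "Z i \<in> borel_measurable P" for i
    unfolding Z_def[abs_def] by measurable
  have Z_bound: "0 \<le> Z i x" "Z i x \<le> B" for i x
  proof -
    show "0 \<le> Z i x" unfolding Z_def using \<gamma> by (intro sum_nonneg) auto
    have "\<gamma> l * indicator (A i l) x \<le> \<gamma> l" for l
      using \<gamma>[of l] by (auto simp: indicator_def)
    then show "Z i x \<le> B" unfolding Z_def B_def by (intro sum_mono) auto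
  qed
  have Z_int: "integrable P (Z i)" for i
    by (rule integrable_const_bound[of _ B]) (use Z_bound in auto)
  have ZZ_int: "integrable P (\<lambda>x. Z i x * Z j x)" for i j
  proof (rule integrable_const_bound[of _ "B * B"])
    show "AE x in P. norm (Z i x * Z j x) \<le> B * B"
      using Z_bound B0 by (intro AE_I2) (auto simp: abs_mult intro!: mult_mono)
  qed auto
  have EZ: "(\<integral>x. Z i x \<partial>P) = t" for i
    unfolding Z_def t_def \<theta>_def using tail[of _ i]
    by (subst Bochner_Integration.integral_sum) (auto simp: A_def[symmetric] emeasure_eq_measure)
  have EZZ: "(\<integral>x. Z i x * Z j x \<partial>P) \<le> (1 + \<psi> (j - i)) * t\<^sup>2" if "i + K \<le> j" for i j
  proof -
    have int: "integrable P (\<lambda>x. \<gamma> l * \<gamma> l' * indicator (A i l \<inter> A j l') x)" for l l'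
      by (intro integrable_mult_right integrable_real_indicator) (auto simp: emeasure_eq_measure)
    have "(\<integral>x. Z i x * Z j x \<partial>P) =
        (\<integral>x. (\<Sum>l<c. \<Sum>l'<c. \<gamma> l * \<gamma> l' * indicator (A i l \<inter> A j l') x) \<partial>P)"
      unfolding Z_def sum_product by (simp add: indicator_inter_arith mult_ac)
    also have "\<dots> = (\<Sum>l<c. \<integral>x. (\<Sum>l'<c. \<gamma> l * \<gamma> l' * indicator (A i l \<inter> A j l') x) \<partial>P)"
      by (intro Bochner_Integration.integral_sum Bochner_Integration.integrable_sum int)
    also have "\<dots> = (\<Sum>l<c. \<Sum>l'<c. \<integral>x. \<gamma> l * \<gamma> l' * indicator (A i l \<inter> A j l') x \<partial>P)"
      by (intro sum.cong refl Bochner_Integration.integral_sum int)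
    also have "\<dots> = (\<Sum>l<c. \<Sum>l'<c. \<gamma> l * \<gamma> l' * measure P (A i l \<inter> A j l'))"
      by simp
    also have "\<dots> \<le> (\<Sum>l<c. \<Sum>l'<c. \<gamma> l * \<gamma> l' * ((1 + \<psi> (j - i)) * (p l * p l')))"
    proof (intro sum_mono mult_left_mono)
      fix l l'
      have "A i l \<inter> A j l' = {x\<in>space P. l < X i x \<and> l' < X j x}" by (auto simp: A_def)
      then show "measure P (A i l \<inter> A j l') \<le> (1 + \<psi> (j - i)) * (p l * p l')"
        using pair_tail[OF that] by simp
    qed (use \<gamma> in auto)
    also have "\<dots> = (1 + \<psi> (j - i)) * ((\<Sum>l<c. \<gamma> l * p l) * (\<Sum>l'<c. \<gamma> l' * p l'))"
      unfolding sum_product by (simp add: sum_distrib_left mult_ac)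
    finally show ?thesis by (simp add: t_def \<theta>_def power2_eq_square)
  qed
  \<comment> \<open>An upper bound for the excess of \<open>Z i * Z j\<close> in mean over
    \<open>t\<^sup>2\<close>, as a function of the distance. For close pairs one factor is bounded
    by \<open>B\<close>, which gives \<open>B * t\<close>.\<close>
  define f where "f k = t\<^sup>2 * \<psi> k + (if k < K then B * t else 0)" for k
  have f0: "0 \<le> f k" for k using t B0 \<psi>_nonneg by (simp add: f_def)
  have EZZ': "(\<integral>x. Z i x * Z j x \<partial>P) \<le> t\<^sup>2 + f (if i \<le> j then j - i else i - j)" for i j
  proof (cases "(if i \<le> j then j - i else i - j) < K")
    case True
    have "(\<integral>x. Z i x * Z j x \<partial>P) \<le> (\<integral>x. B * Z j x \<partial>P)"
      by (intro integral_mono ZZ_int integrable_mult_right Z_int mult_right_mono Z_bound)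
    also have "\<dots> = B * t" by (simp add: EZ)
    finally show ?thesis using True \<psi>_nonneg t by (simp add: f_def add_increasing)
  next
    case False
    show ?thesis
    proof (cases "i \<le> j")
      case True
      then show ?thesis using EZZ[of i j] False by (auto simp: f_def algebra_simps)
    next
      case F: False
      then show ?thesis using EZZ[of j i] False by (auto simp: f_def algebra_simps)
    qed
  qed
  define Q where "Q x = (\<Sum>i<n. Z i x)" for x
  have Q_meas [measurable]: "Q \<in> borel_measurable P" unfolding Q_def[abs_def] by measurable
  have Q_int: "integrable P Q" unfolding Q_def[abs_def] using Z_int by auto
  have EQ: "(\<integral>x. Q x \<partial>P) = real n * t" unfolding Q_def using Z_int EZ by simp
  have QQ: "(Q x)\<^sup>2 = (\<Sum>i<n. \<Sum>j<n. Z i x * Z j x)" for x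
    by (simp add: Q_def power2_eq_square sum_product)
  have QQ_int: "integrable P (\<lambda>x. (Q x)\<^sup>2)" unfolding QQ using ZZ_int by auto
  have sum_f: "(\<Sum>k<n. f k) \<le> t\<^sup>2 * (\<Sum>k<n. \<psi> k) + real K * (B * t)"
  proof -
    have "(\<Sum>k<n. if k < K then B * t else 0) = (\<Sum>k\<in>{..<n} \<inter> {..<K}. B * t)"
      by (simp add: sum.If_cases Int_def lessThan_def)
    also have "\<dots> \<le> real K * (B * t)"
      using B0 t card_mono[of "{..<K}" "{..<n} \<inter> {..<K}"] by (auto intro!: mult_right_mono)
    finally show ?thesis by (simp add: f_def sum.distrib sum_distrib_left)
  qed
  have "(\<integral>x. (Q x)\<^sup>2 \<partial>P) = (\<Sum>i<n. \<Sum>j<n. \<integral>x. Z i x * Z j x \<partial>P)"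
    unfolding QQ using ZZ_int by (simp add: Bochner_Integration.integral_sum)
  also have "\<dots> \<le> (\<Sum>i<n. \<Sum>j<n. t\<^sup>2 + f (if i \<le> j then j - i else i - j))"
    by (intro sum_mono EZZ')
  also have "\<dots> = (real n * t)\<^sup>2 + (\<Sum>i<n. \<Sum>j<n. f (if i \<le> j then j - i else i - j))"
    by (simp add: sum.distrib power2_eq_square)
  also have "\<dots> \<le> (real n * t)\<^sup>2 + (\<Sum>i<n. 2 * (\<Sum>k<n. f k))"
    using f0 by (intro add_left_mono sum_mono sum_abs_diff_le) auto
  also have "(\<Sum>i<n. 2 * (\<Sum>k<n. f k)) = 2 * real n * (\<Sum>k<n. f k)" by simp
  also have "2 * real n * (\<Sum>k<n. f k) \<le> 2 * real n * (t\<^sup>2 * (\<Sum>k<n. \<psi> k) + real K * (B * t))"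
    using sum_f by (intro mult_left_mono) auto
  finally have EQQ: "(\<integral>x. (Q x)\<^sup>2 \<partial>P) \<le>
      (real n * t)\<^sup>2 + 2 * real n * (t\<^sup>2 * (\<Sum>k<n. \<psi> k) + real K * (B * t))"
    by simp
  have sq: "(Q x - real n * t)\<^sup>2 = (Q x)\<^sup>2 - 2 * (real n * t) * Q x + (real n * t)\<^sup>2" for x
    by (simp add: power2_eq_square algebra_simps)
  have int2: "integrable P (\<lambda>x. (Q x - real n * t)\<^sup>2)"
    unfolding sq using QQ_int Q_int by auto
  have "(\<integral>x. (Q x - real n * t)\<^sup>2 \<partial>P) = (\<integral>x. (Q x)\<^sup>2 \<partial>P) - (real n * t)\<^sup>2"
    unfolding sq using QQ_int Q_int measure_space_eq_1
    by (simp add: EQ power2_eq_square)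
  also have "\<dots> \<le> 2 * real n * (t\<^sup>2 * (\<Sum>k<n. \<psi> k) + real K * (B * t))" using EQQ by simp
  finally have var: "(\<integral>x. (Q x - real n * t)\<^sup>2 \<partial>P) \<le>
      2 * real n * (t\<^sup>2 * (\<Sum>k<n. \<psi> k) + real K * (B * t))" .
  have pos: "0 < real n * t / 2" using n t by simp
  have "{x\<in>space P. real n * t / 2 \<le> \<bar>(\<Sum>i<n. \<Sum>l<min (X i x) c. \<gamma> l) - real n * t\<bar>} =
      {x\<in>space P. real n * t / 2 \<le> \<bar>Q x - real n * t\<bar>}"
    unfolding Q_def using Z_eq by auto
  then have "measure P {x\<in>space P. real n * t / 2 \<le> \<bar>(\<Sum>i<n. \<Sum>l<min (X i x) c. \<gamma> l) - real n * t\<bar>}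
      \<le> (\<integral>x. (Q x - real n * t)\<^sup>2 \<partial>P) / (real n * t / 2)\<^sup>2"
    using second_moment_method[of "\<lambda>x. Q x - real n * t", OF _ int2 pos] by simp
  also have "\<dots> \<le> 2 * real n * (t\<^sup>2 * (\<Sum>k<n. \<psi> k) + real K * (B * t)) / (real n * t / 2)\<^sup>2"
    by (intro divide_right_mono var) auto
  also have "\<dots> = 8 * real K * B / (real n * t) + 8 * (\<Sum>k<n. \<psi> k) / real n"
    using n t by (simp add: field_simps power2_eq_square)
  finally show ?thesis by (simp add: t_def B_def)
qed

end

section \<open>Return times and the induced map\<close>

locale recurrent_system =
  fixes M :: "'a measure" and T :: "'a \<Rightarrow> 'a" and E :: "'a set"
  assumes preserving: "preserves_measure M T"
    and conservative: "conservative M T"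
    and ergodic: "ergodic M T"
    and E_sets [measurable]: "E \<in> sets M"
    and E_measure: "emeasure M E = 1"
    and space_measure: "emeasure M (space M) = \<infinity>"
begin

abbreviation \<phi> :: "'a \<Rightarrow> nat" where "\<phi> \<equiv> return_time T E"
abbreviation S :: "'a \<Rightarrow> 'a" where "S \<equiv> induced_map T E"
abbreviation P :: "'a measure" where "P \<equiv> restrict_space M E"

definition p :: "nat \<Rightarrow> real" where "p n = measure M (return_gt T E n)"

lemma T_measurable [measurable]: "T \<in> measurable M M"
  and emeasure_vimage_T: "A \<in> sets M \<Longrightarrow> emeasure M (T -` A \<inter> space M) = emeasure M A"
  using preserving by (auto simp: preserves_measure_def)

lemma E_subset: "E \<subseteq> space M"
  using E_sets by (rule sets.sets_into_space)

lemma pow_measurable [measurable]: "(T ^^ n) \<in> measurable M M"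
  by (rule measurable_compose_n) simp

lemma pow_space: "x \<in> space M \<Longrightarrow> (T ^^ n) x \<in> space M"
  using measurable_space[OF pow_measurable] .

lemma emeasure_vimage_pow:
  "A \<in> sets M \<Longrightarrow> emeasure M ((T ^^ n) -` A \<inter> space M) = emeasure M A"
proof (induction n)
  case 0
  then show ?case using sets.sets_into_space by (simp add: Int_absorb2)
next
  case (Suc n)
  have eq: "(T ^^ Suc n) -` A \<inter> space M = T -` ((T ^^ n) -` A \<inter> space M) \<inter> space M"
    using measurable_space[OF T_measurable] by (auto simp: funpow_Suc_right simp del: funpow.simps)
  have "(T ^^ n) -` A \<inter> space M \<in> sets M" using Suc.prems by measurable
  then show ?case unfolding eq using Suc emeasure_vimage_T by metis
qed

lemma AE_pow:
  assumes "AE x in M. Q x"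
  shows "AE x in M. \<forall>n. Q ((T ^^ n) x)"
proof -
  obtain N where N: "{x\<in>space M. \<not> Q x} \<subseteq> N" "emeasure M N = 0" "N \<in> sets M"
    using assms by (rule AE_E)
  have "AE x in M. Q ((T ^^ n) x)" for n
  proof (rule AE_I)
    show "{x\<in>space M. \<not> Q ((T ^^ n) x)} \<subseteq> (T ^^ n) -` N \<inter> space M"
      using N pow_space by auto
    show "emeasure M ((T ^^ n) -` N \<inter> space M) = 0" using N emeasure_vimage_pow by simp
    show "(T ^^ n) -` N \<inter> space M \<in> sets M" using N by measurable
  qed
  then show ?thesis by (simp add: AE_all_countable)
qed

text \<open>The set is wandering: an orbit that visits it never meets \<open>E\<close> afterwards,
  so its preimages are disjoint.\<close>

lemma never_return_null: "emeasure M {x\<in>E. \<forall>k\<ge>1. (T ^^ k) x \<notin> E} = 0" (is "emeasure M ?W = 0")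
proof -
  have W: "?W \<in> sets M"
  proof -
    have "?W = {x\<in>space M. x \<in> E \<and> (\<forall>k. 1 \<le> k \<longrightarrow> (T ^^ k) x \<notin> E)}" using E_subset by auto
    also have "\<dots> \<in> sets M" by measurable
    finally show ?thesis .
  qed
  have dis: "(T ^^ i) -` ?W \<inter> (T ^^ j) -` ?W = {}" if "i < j" for i j
  proof -
    have "(T ^^ (j - i)) ((T ^^ i) x) = (T ^^ j) x" for x
      using that by (simp flip: funpow_add[unfolded o_def, THEN fun_cong])
    moreover have "1 \<le> j - i" using that by simp
    ultimately show ?thesis by (auto dest: spec)
  qed
  have "disjoint_family (\<lambda>n. (T ^^ n) -` ?W \<inter> space M)"
    unfolding disjoint_family_on_def
  proof (intro ballI impI)
    fix i j :: nat assume "i \<noteq> j"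
    then show "(T ^^ i) -` ?W \<inter> space M \<inter> ((T ^^ j) -` ?W \<inter> space M) = {}"
      using dis[of i j] dis[of j i] by (cases i j rule: linorder_cases) blast+
  qed
  then show ?thesis using conservative W unfolding conservative_def by blast
qed

text \<open>The set \<open>U\<close> of points with infinitely many visits is exactly invariant,
  hence null or conull. Were it null, almost every point of \<open>E\<close> would have a last visit
  to \<open>E\<close>, that is, an iterate among the points that never return; \<open>AE_pow\<close>
  rules this out.\<close>

lemma AE_frequently_hits: "AE x in M. \<exists>\<^sub>F k in sequentially. (T ^^ k) x \<in> E"
proof -
  define U where "U = {x\<in>space M. \<exists>\<^sub>F k in sequentially. (T ^^ k) x \<in> E}"
  have U_eq: "U = {x\<in>space M. \<forall>N. \<exists>k. N \<le> k \<and> (T ^^ k) x \<in> E}"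
    by (auto simp: U_def frequently_sequentially)
  have U [measurable]: "U \<in> sets M" unfolding U_eq by measurable
  have shift: "(\<exists>\<^sub>F k in sequentially. (T ^^ k) (T x) \<in> E) \<longleftrightarrow> (\<exists>\<^sub>F k in sequentially. (T ^^ k) x \<in> E)" for x
    using eventually_sequentially_Suc[of "\<lambda>k. (T ^^ k) x \<notin> E"]
    by (simp add: frequently_def funpow_Suc_right del: funpow.simps)
  have "T -` U \<inter> space M = U"
    using measurable_space[OF T_measurable] by (auto simp: U_def shift)
  then have "emeasure M U = 0 \<or> emeasure M (space M - U) = 0"
    using ergodic U unfolding ergodic_def by blast
  moreover have "emeasure M U \<noteq> 0"
  proof
    assume U0: "emeasure M U = 0"
    let ?W = "{x\<in>E. \<forall>k\<ge>1. (T ^^ k) x \<notin> E}"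
    have "AE x in M. x \<notin> ?W"
    proof (rule AE_I[OF _ never_return_null])
      have "?W = {x\<in>space M. x \<in> E \<and> (\<forall>k. 1 \<le> k \<longrightarrow> (T ^^ k) x \<notin> E)}" using E_subset by auto
      also have "\<dots> \<in> sets M" by measurable
      finally show "?W \<in> sets M" .
    qed auto
    then have "AE x in M. \<forall>n. (T ^^ n) x \<notin> ?W" by (rule AE_pow)
    moreover have "AE x in M. x \<notin> U" using U0 U by (intro AE_not_in) auto
    ultimately have "AE x in M. x \<notin> E"
    proof eventually_elim
      case (elim x)
      show ?case
      proof
        assume x: "x \<in> E"
        then have "\<not> (\<exists>\<^sub>F k in sequentially. (T ^^ k) x \<in> E)" using elim E_subset by (auto simp: U_def)
        then obtain N where N: "\<And>k. N \<le> k \<Longrightarrow> (T ^^ k) x \<notin> E"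
          by (auto simp: frequently_def eventually_sequentially)
        define K where "K = Max {k. (T ^^ k) x \<in> E}"
        have "{k. (T ^^ k) x \<in> E} \<subseteq> {..<N}" 
        proof
          fix k assume "k \<in> {k. (T ^^ k) x \<in> E}"
          then show "k \<in> {..<N}" using N[of k] by (cases "N \<le> k") auto
        qed
        then have fin: "finite {k. (T ^^ k) x \<in> E}" by (rule finite_subset) simp
        have "0 \<in> {k. (T ^^ k) x \<in> E}" using x by simp
        then have K: "(T ^^ K) x \<in> E" using Max_in[OF fin] unfolding K_def by blast
        have "(T ^^ k) ((T ^^ K) x) \<notin> E" if "1 \<le> k" for k
        proof
          assume "(T ^^ k) ((T ^^ K) x) \<in> E"
          then have "k + K \<in> {k. (T ^^ k) x \<in> E}" by (simp add: funpow_add)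
          then have "k + K \<le> K" unfolding K_def using fin by (rule Max_ge[rotated])
          then show False using that by simp
        qed
        then have "(T ^^ K) x \<in> ?W" using K by blast
        then show False using elim by blast
      qed
    qed
    then have "emeasure M E = 0" by (subst (asm) AE_iff_measurable[OF E_sets]) (use E_subset in auto)
    then show False using E_measure by simp
  qed
  ultimately have null: "emeasure M (space M - U) = 0" by blast
  have sub: "{x\<in>space M. \<not> (\<exists>\<^sub>F k in sequentially. (T ^^ k) x \<in> E)} \<subseteq> space M - U"
    by (auto simp: U_def)
  show ?thesis by (rule AE_I[OF sub null]) (use U in simp)
qed

lemma return_time_eq_LEAST:
  "\<exists>k\<ge>1. (T ^^ k) x \<in> E \<Longrightarrow> \<phi> x = (LEAST k. 1 \<le> k \<and> (T ^^ k) x \<in> E)"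
  unfolding return_time_def by (rule if_P)

lemma return_time_pos_iff: "0 < \<phi> x \<longleftrightarrow> (\<exists>k\<ge>1. (T ^^ k) x \<in> E)"
proof (cases "\<exists>k\<ge>1. (T ^^ k) x \<in> E")
  case True
  then have "1 \<le> (LEAST k. 1 \<le> k \<and> (T ^^ k) x \<in> E)"
    using LeastI_ex[of "\<lambda>k. 1 \<le> k \<and> (T ^^ k) x \<in> E"] by blast
  then have "0 < \<phi> x" unfolding return_time_eq_LEAST[OF True] by linarith
  then show ?thesis using True by blast
next
  case False
  then have "\<phi> x = 0" unfolding return_time_def by (rule if_not_P)
  then show ?thesis using False by simp
qed

lemma return_time_hits: "0 < \<phi> x \<Longrightarrow> (T ^^ \<phi> x) x \<in> E"
proof -
  assume "0 < \<phi> x"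
  then have ex: "\<exists>k\<ge>1. (T ^^ k) x \<in> E" by (simp add: return_time_pos_iff)
  show ?thesis
    unfolding return_time_eq_LEAST[OF ex]
    using LeastI_ex[of "\<lambda>k. 1 \<le> k \<and> (T ^^ k) x \<in> E"] ex by blast
qed

lemma not_hits_before: "\<lbrakk>1 \<le> k; k < \<phi> x\<rbrakk> \<Longrightarrow> (T ^^ k) x \<notin> E"
proof -
  assume k: "1 \<le> k" "k < \<phi> x"
  then have ex: "\<exists>k\<ge>1. (T ^^ k) x \<in> E" using return_time_pos_iff[of x] by simp
  show ?thesis
    using not_less_Least[of k "\<lambda>k. 1 \<le> k \<and> (T ^^ k) x \<in> E"] k
    unfolding return_time_eq_LEAST[OF ex] by blast
qed

lemma return_time_eqI:
  "\<lbrakk>1 \<le> n; (T ^^ n) x \<in> E; \<And>k. \<lbrakk>1 \<le> k; k < n\<rbrakk> \<Longrightarrow> (T ^^ k) x \<notin> E\<rbrakk> \<Longrightarrow> \<phi> x = n"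
proof -
  assume n: "1 \<le> n" "(T ^^ n) x \<in> E" and no: "\<And>k. \<lbrakk>1 \<le> k; k < n\<rbrakk> \<Longrightarrow> (T ^^ k) x \<notin> E"
  then have pos: "0 < \<phi> x" using return_time_pos_iff by blast
  show "\<phi> x = n"
  proof (cases "\<phi> x" n rule: linorder_cases)
    case less
    then show ?thesis using no[of "\<phi> x"] return_time_hits[OF pos] pos by simp
  next
    case greater
    then show ?thesis using not_hits_before[of n x] n by simp
  qed
qed

lemma return_time_measurable [measurable]: "\<phi> \<in> measurable M (count_space UNIV)"
  unfolding return_time_def by measurable

lemma induced_map_measurable [measurable]: "S \<in> measurable M M"
proof -
  have "(\<lambda>x. (T ^^ (\<phi> x)) x) \<in> measurable M M"
    by (rule measurable_compose_countable[where f = "\<lambda>n x. (T ^^ n) x" and g = \<phi>]) measurable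
  then show ?thesis by (simp add: induced_map_def[abs_def])
qed

lemma induced_pow_measurable [measurable]: "(S ^^ n) \<in> measurable M M"
  by (rule measurable_compose_n) simp

lemma induced_in_E: "x \<in> E \<Longrightarrow> S x \<in> E"
  using return_time_hits[of x] by (cases "\<phi> x = 0") (auto simp: induced_map_def)

lemma induced_pow_in_E: "x \<in> E \<Longrightarrow> (S ^^ n) x \<in> E"
  by (induction n) (auto intro: induced_in_E)

lemma sets_Collect_E: "{x\<in>space M. x \<in> E \<and> Q x} \<in> sets M \<Longrightarrow> {x\<in>E. Q x} \<in> sets M"
proof -
  assume "{x\<in>space M. x \<in> E \<and> Q x} \<in> sets M"
  moreover have "{x\<in>space M. x \<in> E \<and> Q x} = {x\<in>E. Q x}" using E_subset by auto
  ultimately show ?thesis by simp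
qed

lemma return_gt_sets [measurable]: "return_gt T E n \<in> sets M"
  unfolding return_gt_def by (rule sets_Collect_E) measurable

lemma return_level_sets [measurable]: "return_level T E n \<in> sets M"
  unfolding return_level_def by (rule sets_Collect_E) measurable

lemma subset_E_finite: "A \<subseteq> E \<Longrightarrow> emeasure M A < \<infinity>"
  using emeasure_mono[of A E M] E_measure by (metis E_sets ennreal_one_less_top infinity_ennreal_def le_less_trans)

lemma subset_E_emeasure: "A \<subseteq> E \<Longrightarrow> emeasure M A = ennreal (measure M A)"
  using subset_E_finite[of A] by (intro emeasure_eq_ennreal_measure) auto

lemma subset_E_fmeasurable: "\<lbrakk>A \<in> sets M; A \<subseteq> E\<rbrakk> \<Longrightarrow> A \<in> fmeasurable M"
  using subset_E_finite by (intro fmeasurableI)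

lemma measure_Un_disjoint:
  assumes "A \<in> sets M" "A \<subseteq> E" "B \<in> sets M" "B \<subseteq> E" "A \<inter> B = {}"
  shows "measure M (A \<union> B) = measure M A + measure M B"
proof (rule measure_Un_AE)
  show "AE x in M. x \<notin> A \<or> x \<notin> B" using assms(5) by (intro AE_I2) blast
qed (intro subset_E_fmeasurable assms)+

lemma measure_E: "measure M E = 1"
  using E_measure by (simp add: measure_def)

lemma never_return_measure: "measure M {x\<in>E. \<phi> x = 0} = 0"
proof -
  have "{x\<in>E. \<phi> x = 0} = {x\<in>E. \<forall>k\<ge>1. (T ^^ k) x \<notin> E}"
    using return_time_pos_iff by (metis neq0_conv)
  then show ?thesis using never_return_null by (simp add: measure_def)
qed

text \<open>Split the preimages of \<open>A\<close> according to whether the orbit starts in \<open>E\<close>, \<open>K\<close> times.\<close>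
lemma measure_eq_sum_first_hits:
  assumes A: "A \<in> sets M" "A \<subseteq> E"
  shows "emeasure M A = (\<Sum>n=1..K. emeasure M {x\<in>E. \<phi> x = n \<and> S x \<in> A}) +
    emeasure M {x\<in>space M. (T ^^ K) x \<in> A \<and> (\<forall>j<K. (T ^^ j) x \<notin> E)}"
proof (induction K)
  case 0
  have "{x\<in>space M. x \<in> A} = A" using A sets.sets_into_space by blast
  then show ?case by simp
next
  case (Suc K)
  note [measurable] = A(1)
  let ?R = "\<lambda>K. {x\<in>space M. (T ^^ K) x \<in> A \<and> (\<forall>j<K. (T ^^ j) x \<notin> E)}"
  let ?L = "{x\<in>E. \<phi> x = Suc K \<and> S x \<in> A}"
  have L: "?L \<in> sets M" by (rule sets_Collect_E) measurable
  have "emeasure M (?R K) = emeasure M (T -` ?R K \<inter> space M)"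
    by (rule emeasure_vimage_T[symmetric]) measurable
  also have "T -` ?R K \<inter> space M = ?L \<union> ?R (Suc K)"
  proof (intro equalityI subsetI)
    fix x assume x: "x \<in> T -` ?R K \<inter> space M"
    then have sp: "x \<in> space M" and hit: "(T ^^ Suc K) x \<in> A"
      and no: "\<And>j. j < K \<Longrightarrow> (T ^^ Suc j) x \<notin> E"
      by (auto simp: funpow_Suc_right simp del: funpow.simps)
    show "x \<in> ?L \<union> ?R (Suc K)"
    proof (cases "x \<in> E")
      case True
      have "\<phi> x = Suc K"
      proof (rule return_time_eqI)
        show "(T ^^ Suc K) x \<in> E" using hit A by blast
        show "(T ^^ k) x \<notin> E" if "1 \<le> k" "k < Suc K" for k
          using no[of "k - 1"] that by (cases k) auto
      qed simp
      then show ?thesis using True hit by (simp add: induced_map_def)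
    next
      case False
      have "(T ^^ j) x \<notin> E" if "j < Suc K" for j
        using no[of "j - 1"] that False by (cases j) auto
      then show ?thesis using hit sp by blast
    qed
  next
    fix x assume "x \<in> ?L \<union> ?R (Suc K)"
    then show "x \<in> T -` ?R K \<inter> space M"
    proof
      assume x: "x \<in> ?L"
      then have "(T ^^ Suc K) x \<in> A" by (auto simp: induced_map_def simp del: funpow.simps)
      moreover have "(T ^^ Suc j) x \<notin> E" if "j < K" for j
        using x not_hits_before[of "Suc j" x] that by simp
      ultimately show ?thesis
        using x E_subset measurable_space[OF T_measurable]
        by (auto simp: funpow_Suc_right simp del: funpow.simps)
    next
      assume x: "x \<in> ?R (Suc K)"
      then have "(T ^^ Suc j) x \<notin> E" if "j < K" for j using that by blast
      then show ?thesis
        using x measurable_space[OF T_measurable]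
        by (auto simp: funpow_Suc_right simp del: funpow.simps)
    qed
  qed
  also have "emeasure M (?L \<union> ?R (Suc K)) = emeasure M ?L + emeasure M (?R (Suc K))"
  proof (rule plus_emeasure[symmetric])
    show "?L \<inter> ?R (Suc K) = {}" by (auto dest: spec[of _ 0])
    show "?R (Suc K) \<in> sets M" by measurable
  qed (rule L)
  finally show ?case using Suc.IH by (simp add: add.assoc)
qed

text \<open>Letting \<open>K\<close> grow in \<open>measure_eq_sum_first_hits\<close> gives only an
  inequality, as the remainder is merely dropped. The inequalities for \<open>A\<close> and
  \<open>E - A\<close> both sum to the total mass \<open>1\<close>, so both are equalities.\<close>

lemma measure_induced_vimage:
  assumes A: "A \<in> sets M" "A \<subseteq> E"
  shows "measure M {x\<in>E. S x \<in> A} = measure M A"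
proof -
  have le: "measure M {x\<in>E. S x \<in> A} \<le> measure M A" if A: "A \<in> sets M" "A \<subseteq> E" for A
  proof -
    note [measurable] = A(1)
    let ?L = "\<lambda>n. {x\<in>E. \<phi> x = n \<and> S x \<in> A}"
    have L: "?L n \<in> sets M" for n by (rule sets_Collect_E) measurable
    have "emeasure M (\<Union>n. ?L (Suc n)) = (\<Sum>n. emeasure M (?L (Suc n)))"
      by (rule suminf_emeasure[symmetric]) (use L in \<open>auto simp: disjoint_family_on_def\<close>)
    also have "\<dots> \<le> emeasure M A"
    proof (rule suminf_le_const[OF _ ])
      show "summable (\<lambda>n. emeasure M (?L (Suc n)))" by simp
      fix K
      have "(\<Sum>n<K. emeasure M (?L (Suc n))) = (\<Sum>n=1..K. emeasure M (?L n))"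
        by (rule sum.reindex_bij_witness[of _ "\<lambda>n. n - 1" Suc]) auto
      also have "\<dots> \<le> emeasure M A" unfolding measure_eq_sum_first_hits[OF A, of K] by simp
      finally show "(\<Sum>n<K. emeasure M (?L (Suc n))) \<le> emeasure M A" .
    qed
    finally have "emeasure M (\<Union>n. ?L (Suc n)) \<le> emeasure M A" .
    moreover have sub: "(\<Union>n. ?L (Suc n)) \<subseteq> E" by auto
    ultimately have 1: "measure M (\<Union>n. ?L (Suc n)) \<le> measure M A"
      using subset_E_emeasure[OF sub] subset_E_emeasure[OF A(2)] by simp
    \<comment> \<open>The part \<open>?L 0\<close> comes from the convention that \<open>S\<close>
      fixes points that never return; it is a null set.\<close>
    have "{x\<in>E. S x \<in> A} = ?L 0 \<union> (\<Union>n. ?L (Suc n))"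
      by (auto simp: gr0_conv_Suc) (metis not0_implies_Suc)
    then have "measure M {x\<in>E. S x \<in> A} \<le> measure M (?L 0) + measure M (\<Union>n. ?L (Suc n))"
      using L by (simp only:) (intro measure_Un_le, auto)
    also have "measure M (?L 0) \<le> measure M {x\<in>E. \<phi> x = 0}"
    proof (rule measure_mono_fmeasurable)
      have "{x\<in>E. \<phi> x = 0} \<in> sets M" by (rule sets_Collect_E) measurable
      then show "{x\<in>E. \<phi> x = 0} \<in> fmeasurable M" by (rule subset_E_fmeasurable) auto
    qed (use L in auto)
    finally show ?thesis using 1 never_return_measure by simp
  qed
  note [measurable] = A(1)
  have m1: "{x\<in>E. S x \<in> A} \<in> sets M" by (rule sets_Collect_E) measurable
  have m2: "{x\<in>E. S x \<in> E - A} \<in> sets M" by (rule sets_Collect_E) measurable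
  have "measure M E = measure M ({x\<in>E. S x \<in> A} \<union> {x\<in>E. S x \<in> E - A})"
    using induced_in_E by (intro arg_cong[of _ _ "measure M"]) auto
  also have "\<dots> = measure M {x\<in>E. S x \<in> A} + measure M {x\<in>E. S x \<in> E - A}"
    by (rule measure_Un_disjoint) (use m1 m2 in auto)
  finally have 2: "1 = measure M {x\<in>E. S x \<in> A} + measure M {x\<in>E. S x \<in> E - A}"
    by (simp add: measure_E)
  have "measure M E = measure M (A \<union> (E - A))"
    using A by (intro arg_cong[of _ _ "measure M"]) auto
  also have "\<dots> = measure M A + measure M (E - A)"
    by (rule measure_Un_disjoint) (use A in auto)
  finally have "1 = measure M A + measure M (E - A)" by (simp add: measure_E)
  then show ?thesis using 2 le[OF A] le[of "E - A"] by auto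
qed

lemma measure_induced_pow_vimage:
  assumes A: "A \<in> sets M" "A \<subseteq> E"
  shows "measure M {x\<in>E. (S ^^ n) x \<in> A} = measure M A"
proof (induction n)
  case 0
  have "{x\<in>E. x \<in> A} = A" using A by auto
  then show ?case by simp
next
  case (Suc n)
  note [measurable] = A(1)
  have "{x\<in>E. (S ^^ Suc n) x \<in> A} = {x\<in>E. S x \<in> {x\<in>E. (S ^^ n) x \<in> A}}"
    using induced_in_E by (auto simp: funpow_Suc_right simp del: funpow.simps)
  moreover have "{x\<in>E. (S ^^ n) x \<in> A} \<in> sets M" by (rule sets_Collect_E) measurable
  ultimately show ?case using measure_induced_vimage[of "{x\<in>E. (S ^^ n) x \<in> A}"] Suc by simp
qed

lemma p_nonneg: "0 \<le> p n" by (simp add: p_def)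

lemma p_antimono: "antimono p"
proof (rule antimonoI)
  fix i j :: nat assume "i \<le> j"
  then have "return_gt T E j \<subseteq> return_gt T E i" by (auto simp: return_gt_def)
  moreover have "return_gt T E i \<in> fmeasurable M"
    by (rule subset_E_fmeasurable) (auto simp: return_gt_def)
  ultimately show "p j \<le> p i" unfolding p_def by (intro measure_mono_fmeasurable) auto
qed

lemma p_0: "p 0 = 1"
proof -
  have z: "{x\<in>E. \<phi> x = 0} \<in> sets M" by (rule sets_Collect_E) measurable
  have "measure M E = measure M (return_gt T E 0 \<union> {x\<in>E. \<phi> x = 0})"
    by (intro arg_cong[of _ _ "measure M"]) (auto simp: return_gt_def)
  also have "\<dots> = p 0 + measure M {x\<in>E. \<phi> x = 0}"
    unfolding p_def by (rule measure_Un_disjoint) (use z in \<open>auto simp: return_gt_def\<close>)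
  finally show ?thesis using measure_E never_return_measure by simp
qed

lemma p_le_1: "p n \<le> 1"
  using antimonoD[OF p_antimono, of 0 n] p_0 by simp

lemma p_tendsto_0: "p \<longlonglongrightarrow> 0"
proof -
  have "(\<lambda>n. measure M (return_gt T E n)) \<longlonglongrightarrow> measure M (\<Inter>n. return_gt T E n)"
  proof (rule Lim_measure_decseq)
    show "decseq (return_gt T E)" by (auto simp: decseq_def return_gt_def)
    show "emeasure M (return_gt T E i) \<noteq> \<infinity>" for i
      using subset_E_finite[of "return_gt T E i"] by (auto simp: return_gt_def)
  qed auto
  moreover have "(\<Inter>n. return_gt T E n) = {}" by (auto simp: return_gt_def)
  ultimately show ?thesis by (simp add: p_def[abs_def])
qed

lemma hitting_level_eq:
  "hitting_level M T E k = {x\<in>space M. (T ^^ k) x \<in> E \<and> (\<forall>j<k. (T ^^ j) x \<notin> E)}"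
proof (intro equalityI subsetI)
  fix x assume "x \<in> hitting_level M T E k"
  then show "x \<in> {x\<in>space M. (T ^^ k) x \<in> E \<and> (\<forall>j<k. (T ^^ j) x \<notin> E)}"
    using LeastI_ex[of "\<lambda>k. (T ^^ k) x \<in> E"] not_less_Least[of _ "\<lambda>k. (T ^^ k) x \<in> E"]
    by (auto simp: hitting_level_def hitting_time_def)
next
  fix x assume x: "x \<in> {x\<in>space M. (T ^^ k) x \<in> E \<and> (\<forall>j<k. (T ^^ j) x \<notin> E)}"
  have "(LEAST k. (T ^^ k) x \<in> E) = k"
  proof (rule Least_equality)
    fix j assume "(T ^^ j) x \<in> E"
    then show "k \<le> j" using x by (cases "j < k") auto
  qed (use x in blast)
  then show "x \<in> hitting_level M T E k" using x by (auto simp: hitting_level_def hitting_time_def)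
qed

lemma hitting_level_sets [measurable]: "hitting_level M T E k \<in> sets M"
  unfolding hitting_level_eq by measurable

text \<open>Take \<open>A = E\<close> in \<open>measure_eq_sum_first_hits\<close>: the remainder
  after \<open>k\<close> steps is exactly the \<open>k\<close>-th hitting level, and the first
  \<open>k\<close> return levels have total mass \<open>1 - p k\<close>.\<close>

lemma emeasure_hitting_level: "emeasure M (hitting_level M T E k) = ennreal (p k)"
proof -
  have sub: "return_level T E n \<subseteq> E" for n by (auto simp: return_level_def)
  have lev: "{x\<in>E. \<phi> x = n \<and> S x \<in> E} = return_level T E n" for n
    using induced_in_E by (auto simp: return_level_def)
  have z: "{x\<in>E. \<phi> x = 0} \<in> sets M" by (rule sets_Collect_E) measurable
  have decomp: "1 = (\<Sum>n=1..k. measure M (return_level T E n)) + p k"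
  proof (induction k)
    case 0
    then show ?case by (simp add: p_0)
  next
    case (Suc k)
    have "p k = measure M (return_level T E (Suc k) \<union> return_gt T E (Suc k))"
      unfolding p_def by (intro arg_cong[of _ _ "measure M"]) (auto simp: return_level_def return_gt_def)
    also have "\<dots> = measure M (return_level T E (Suc k)) + p (Suc k)"
      unfolding p_def
      by (rule measure_Un_disjoint) (auto simp: return_gt_def return_level_def)
    finally show ?case using Suc by simp
  qed
  have "emeasure M E = (\<Sum>n=1..k. emeasure M (return_level T E n)) + emeasure M (hitting_level M T E k)"
    using measure_eq_sum_first_hits[OF E_sets order_refl, of k] unfolding lev hitting_level_eq .
  also have "(\<Sum>n=1..k. emeasure M (return_level T E n)) = ennreal (1 - p k)"
  proof -
    have "(\<Sum>n=1..k. measure M (return_level T E n)) = 1 - p k" using decomp by linarith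
    then show ?thesis by (simp only: subset_E_emeasure[OF sub] sum_ennreal[OF measure_nonneg])
  qed
  finally have "ennreal 1 = ennreal (1 - p k) + emeasure M (hitting_level M T E k)"
    using E_measure by simp
  moreover have "ennreal 1 = ennreal (1 - p k) + ennreal (p k)"
    using p_le_1[of k] p_nonneg[of k] by (simp flip: ennreal_plus)
  ultimately have "ennreal (1 - p k) + emeasure M (hitting_level M T E k) = ennreal (1 - p k) + ennreal (p k)"
    by simp
  then show ?thesis unfolding ennreal_add_left_cancel by simp
qed

text \<open>Kac's formula: the hitting levels partition the space up to a null set, so their masses
  add up to the infinite total measure.\<close>

lemma suminf_p: "(\<Sum>k. ennreal (p k)) = \<infinity>"
proof -
  have ae: "AE x in M. x \<in> (\<Union>k. hitting_level M T E k)"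
    using AE_frequently_hits AE_space
  proof eventually_elim
    case (elim x)
    from elim(1) have "\<exists>k. (T ^^ k) x \<in> E" by (rule frequently_ex)
    then have "x \<in> hitting_level M T E (hitting_time T E x)"
      using elim(2) unfolding hitting_level_def by blast
    then show ?case by blast
  qed
  have "\<infinity> = emeasure M (\<Union>k. hitting_level M T E k)"
    unfolding space_measure[symmetric]
  proof (rule emeasure_eq_AE)
    show "AE x in M. x \<in> space M \<longleftrightarrow> x \<in> (\<Union>k. hitting_level M T E k)"
      using ae AE_space by eventually_elim simp
  qed measurable
  also have "\<dots> = (\<Sum>k. emeasure M (hitting_level M T E k))"
  proof (rule suminf_emeasure[symmetric])
    show "disjoint_family (hitting_level M T E)"
      by (auto simp: disjoint_family_on_def hitting_level_def)
  qed auto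
  finally show ?thesis by (simp add: emeasure_hitting_level)
qed

lemma not_summable_p: "\<not> summable p"
  using suminf_p p_nonneg suminf_ennreal2[of p] by auto

lemma sum_p_at_top: "filterlim (\<lambda>n. \<Sum>j<n. p j) at_top sequentially"
proof -
  have mono: "mono (\<lambda>n. \<Sum>j<n. p j)"
    by (intro monoI sum_mono2) (auto simp: p_nonneg)
  have "\<exists>n. B \<le> (\<Sum>j<n. p j)" for B
  proof (rule ccontr)
    assume "\<nexists>n. B \<le> (\<Sum>j<n. p j)"
    then have "summable p" by (intro summableI_nonneg_bounded[of p B]) (auto simp: p_nonneg not_le less_imp_le)
    then show False using not_summable_p by simp
  qed
  then show ?thesis
    unfolding filterlim_at_top eventually_sequentially using monoD[OF mono] by (meson order_trans)
qed

lemma p_pos: "0 < p n"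
proof (rule ccontr)
  assume "\<not> 0 < p n"
  then have "p j = 0" if "n \<le> j" for j
    using antimonoD[OF p_antimono that] p_nonneg[of n] p_nonneg[of j] by simp
  then have "summable p" by (intro summable_finite[of "{..<n}"]) auto
  then show False using not_summable_p by simp
qed

text \<open>Guarantees that \<open>the_elem\<close> in the induced value picks an actual value of
  the observable.\<close>

lemma hitting_level_nonempty: "hitting_level M T E k \<noteq> {}"
  using emeasure_hitting_level[of k] p_pos[of k] by auto

text \<open>Along an excursion of length \<open>n\<close> the hitting times are
  \<open>0, n - 1, ..., 1\<close>. This rearrangement is an involution, hence its own inverse in the
  reindexing.\<close>

lemma sum_excursion:
  fixes f :: "nat \<Rightarrow> real"
  assumes z: "z \<in> E"
  shows "(\<Sum>i<\<phi> z. f (hitting_time T E ((T ^^ i) z))) = (\<Sum>l<\<phi> z. f l)"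
proof (rule sum.reindex_bij_witness[of _ "\<lambda>i. if i = 0 then 0 else \<phi> z - i" "\<lambda>i. if i = 0 then 0 else \<phi> z - i"])
  fix i assume i: "i \<in> {..<\<phi> z}"
  have "hitting_time T E ((T ^^ i) z) = (if i = 0 then 0 else \<phi> z - i)"
    unfolding hitting_time_def
  proof (rule Least_equality)
    show "(T ^^ (if i = 0 then 0 else \<phi> z - i)) ((T ^^ i) z) \<in> E"
      using z i return_time_hits[of z] by (auto simp flip: funpow_add[unfolded o_def, THEN fun_cong])
    fix k assume k: "(T ^^ k) ((T ^^ i) z) \<in> E"
    then have k: "(T ^^ (k + i)) z \<in> E" by (simp add: funpow_add)
    show "(if i = 0 then 0 else \<phi> z - i) \<le> k"
    proof (rule ccontr)
      assume "\<not> (if i = 0 then 0 else \<phi> z - i) \<le> k"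
      then have "1 \<le> k + i" "k + i < \<phi> z" by (auto split: if_splits)
      then show False using k not_hits_before by blast
    qed
  qed
  then show "f (if i = 0 then 0 else \<phi> z - i) = f (hitting_time T E ((T ^^ i) z))" by simp
qed auto

lemma induced_pow_eq: "(S ^^ n) x = (T ^^ (\<Sum>j<n. \<phi> ((S ^^ j) x))) x"
proof (induction n)
  case (Suc n)
  have "(S ^^ Suc n) x = (T ^^ \<phi> ((S ^^ n) x)) ((S ^^ n) x)" by (simp add: induced_map_def)
  also have "\<dots> = (T ^^ \<phi> ((S ^^ n) x)) ((T ^^ (\<Sum>j<n. \<phi> ((S ^^ j) x))) x)"
    using Suc by (rule arg_cong)
  finally show ?case by (simp add: add.commute flip: funpow_add[unfolded o_def, THEN fun_cong])
qed simp

lemma sum_hitting_time: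
  fixes f :: "nat \<Rightarrow> real"
  assumes x: "x \<in> E"
  shows "(\<Sum>i<(\<Sum>j<n. \<phi> ((S ^^ j) x)). f (hitting_time T E ((T ^^ i) x))) =
    (\<Sum>j<n. \<Sum>l<\<phi> ((S ^^ j) x). f l)"
proof (induction n)
  case (Suc n)
  let ?s = "\<Sum>j<n. \<phi> ((S ^^ j) x)" and ?t = "\<phi> ((S ^^ n) x)"
  let ?h = "\<lambda>i. f (hitting_time T E ((T ^^ i) x))"
  have "(\<Sum>i<?s + ?t. ?h i) = (\<Sum>i<?s. ?h i) + (\<Sum>i\<in>{?s..<?s + ?t}. ?h i)"
    unfolding lessThan_atLeast0 by (rule sum.atLeastLessThan_concat[symmetric]) auto
  also have "(\<Sum>i\<in>{?s..<?s + ?t}. ?h i) = (\<Sum>i<?t. ?h (i + ?s))"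
    by (rule sum.reindex_bij_witness[of _ "\<lambda>i. i + ?s" "\<lambda>i. i - ?s"]) auto
  also have "\<dots> = (\<Sum>i<?t. f (hitting_time T E ((T ^^ i) ((S ^^ n) x))))"
    unfolding induced_pow_eq[of n x] by (simp add: funpow_add)
  also have "\<dots> = (\<Sum>l<?t. f l)"
    by (rule sum_excursion[OF induced_pow_in_E[OF x]])
  finally show ?case using Suc by simp
qed simp

end

section \<open>Truncated means of the induced observable\<close>

text \<open>Here the normalised form is essential: it gives
  \<open>L (n + 1) = L n * exp (I n)\<close> with \<open>n * I n\<close> tending to
  \<open>0\<close>, whereas slow variation alone does not control increments. The second claim shows
  that the value of the observable on the \<open>n\<close>-th level is asymptotic to
  \<open>L n\<close>.\<close>

lemma normalised_slowly_varying_increment: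
  assumes "normalised_slowly_varying L"
  shows "\<forall>\<^sub>F n in sequentially. 0 < L (real n)"
    and "(\<lambda>n. (real (Suc n) * L (real (Suc n)) - real n * L (real n)) / L (real n)) \<longlonglongrightarrow> 1"
proof -
  obtain C \<kappa> \<eta> where C: "0 < C" and \<kappa>: "0 \<le> \<kappa>" and \<eta>: "(\<eta> \<longlongrightarrow> 0) at_top"
    and L: "\<And>x. \<kappa> \<le> x \<Longrightarrow> set_integrable lborel {\<kappa>..x} (\<lambda>t. \<eta> t / t) \<and>
                L x = C * exp (LBINT t:{\<kappa>..x}. \<eta> t / t)"
    using assms unfolding normalised_slowly_varying_def by blast
  have pos: "0 < L x" if "\<kappa> \<le> x" for x using L[OF that] C by simp
  have large: "\<forall>\<^sub>F n in sequentially. \<kappa> \<le> real n"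
    using filterlim_real_sequentially by (auto simp: filterlim_at_top)
  then show ev_pos: "\<forall>\<^sub>F n in sequentially. 0 < L (real n)"
    by eventually_elim (rule pos)
  define I where "I n = (LBINT t:{real n<..real (Suc n)}. \<eta> t / t)" for n
  have step: "L (real (Suc n)) = L (real n) * exp (I n)" if "\<kappa> \<le> real n" for n
  proof -
    have eq: "{\<kappa>..real (Suc n)} = {\<kappa>..real n} \<union> {real n<..real (Suc n)}" using that by auto
    have int: "set_integrable lborel {\<kappa>..real (Suc n)} (\<lambda>t. \<eta> t / t)"
      using L[of "real (Suc n)"] that by simp
    have "(LBINT t:{\<kappa>..real (Suc n)}. \<eta> t / t) = (LBINT t:{\<kappa>..real n}. \<eta> t / t) + I n"
      unfolding I_def eq
      by (rule set_integral_Un; (rule set_integrable_subset[OF int])?) (use that in auto)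
    then show ?thesis using L[of "real n"] L[of "real (Suc n)"] that by (simp add: exp_add)
  qed
  have small: "\<forall>\<^sub>F n in sequentially. \<bar>I n\<bar> \<le> e / real n" if e: "0 < e" for e
  proof -
    have "\<forall>\<^sub>F x in at_top. \<bar>\<eta> x\<bar> < e"
      using order_tendstoD(2)[OF tendsto_rabs_zero[OF \<eta>] e] .
    then obtain B where B: "\<And>x. B \<le> x \<Longrightarrow> \<bar>\<eta> x\<bar> < e" by (auto simp: eventually_at_top_linorder)
    have "\<forall>\<^sub>F n in sequentially. B \<le> real n"
      using filterlim_real_sequentially by (auto simp: filterlim_at_top)
    then show ?thesis using large eventually_gt_at_top[of 0]
    proof eventually_elim
      case (elim n)
      have int: "set_integrable lborel {real n<..real (Suc n)} (\<lambda>t. \<eta> t / t)"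
        by (rule set_integrable_subset[of _ "{\<kappa>..real (Suc n)}"]) (use L[of "real (Suc n)"] elim in auto)
      have int': "set_integrable lborel {real n<..real (Suc n)} (\<lambda>t. e / real n)"
        unfolding set_integrable_def by simp
      have "norm (I n) \<le> (LBINT t:{real n<..real (Suc n)}. norm (\<eta> t / t))"
        unfolding I_def by (rule set_integral_norm_bound[OF int])
      also have "\<dots> \<le> (LBINT t:{real n<..real (Suc n)}. e / real n)"
      proof (rule set_integral_mono[OF set_integrable_norm[OF int] int'])
        fix t assume t: "t \<in> {real n<..real (Suc n)}"
        have "\<bar>\<eta> t\<bar> / \<bar>t\<bar> \<le> e / real n"
          using t elim B[of t] by (intro frac_le) auto
        then show "norm (\<eta> t / t) \<le> e / real n" by (simp add: abs_divide)
      qed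
      also have "\<dots> = e / real n" by (simp add: set_lebesgue_integral_def)
      finally show ?case by simp
    qed
  qed
  have lim: "(\<lambda>n. real (Suc n) * (exp (I n) - 1)) \<longlonglongrightarrow> 0"
  proof (rule LIMSEQ_I)
    fix r :: real assume r: "0 < r"
    \<comment> \<open>The final bound is \<open>4 * e < r\<close>; the cap \<open>1 / 2\<close>
      keeps \<open>I n\<close> in the range of \<open>exp_bound_lemma\<close>.\<close>
    define e where "e = min (1 / 2) (r / 5)"
    have e: "0 < e" "e \<le> 1 / 2" "e < r / 4" using r by (auto simp: e_def)
    have "\<forall>\<^sub>F n in sequentially. norm (real (Suc n) * (exp (I n) - 1) - 0) < r"
      using small[OF e(1)] eventually_gt_at_top[of 0]
    proof eventually_elim
      case (elim n)
      have "\<bar>I n\<bar> \<le> 1 / 2"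
      proof -
        have "e / real n \<le> e / 1" using elim e by (intro divide_left_mono) auto
        then show ?thesis using elim e by linarith
      qed
      then have "exp (I n) \<le> 1 + 2 * \<bar>I n\<bar>"
        using exp_bound_lemma[of "I n"] by simp
      then have "\<bar>exp (I n) - 1\<bar> \<le> 2 * \<bar>I n\<bar>"
        using exp_ge_add_one_self[of "I n"] by linarith
      then have "\<bar>exp (I n) - 1\<bar> \<le> 2 * (e / real n)" using elim by linarith
      then have "real (Suc n) * \<bar>exp (I n) - 1\<bar> \<le> (2 * real n) * (2 * (e / real n))"
        using elim by (intro mult_mono) auto
      also have "\<dots> = 4 * e" using elim by simp
      finally show ?case using e by (simp add: abs_mult)
    qed
    then show "\<exists>no. \<forall>n\<ge>no. norm (real (Suc n) * (exp (I n) - 1) - 0) < r"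
      by (simp add: eventually_sequentially)
  qed
  have "\<forall>\<^sub>F n in sequentially. 1 + real (Suc n) * (exp (I n) - 1) =
      (real (Suc n) * L (real (Suc n)) - real n * L (real n)) / L (real n)"
    using large
  proof eventually_elim
    case (elim n)
    then show ?case using step[OF elim] pos[OF elim] by (simp add: field_simps)
  qed
  moreover have "(\<lambda>n. 1 + real (Suc n) * (exp (I n) - 1)) \<longlonglongrightarrow> 1 + 0"
    by (intro tendsto_add tendsto_const lim)
  ultimately show "(\<lambda>n. (real (Suc n) * L (real (Suc n)) - real n * L (real n)) / L (real n)) \<longlonglongrightarrow> 1"
    using Lim_transform_eventually by fastforce
qed

text \<open>Pointwise comparison of the sum defining \<open>ell\<close> with a truncation; the
  additive \<open>1\<close> comes from counting integers from \<open>0\<close>.\<close>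

lemma card_nat_below:
  fixes v y :: real
  assumes "0 \<le> v" "0 \<le> y"
  shows "min v y \<le> real (card {k::nat. real k \<le> y \<and> real k < v})"
    and "real (card {k::nat. real k \<le> y \<and> real k < v}) \<le> min v y + 1"
proof -
  have "{k::nat. real k \<le> y \<and> real k < v} = {..<min (nat \<lceil>v\<rceil>) (Suc (nat \<lfloor>y\<rfloor>))}"
  proof (intro set_eqI)
    fix k :: nat
    have "real k < v \<longleftrightarrow> k < nat \<lceil>v\<rceil>"
      by (metis less_ceiling_iff of_int_of_nat_eq zless_nat_eq_int_zless)
    moreover have "real k \<le> y \<longleftrightarrow> k < Suc (nat \<lfloor>y\<rfloor>)"
      using assms by (simp add: less_Suc_eq_le le_nat_floor le_nat_iff le_floor_iff)
    ultimately show "k \<in> {k::nat. real k \<le> y \<and> real k < v} \<longleftrightarrow> k \<in> {..<min (nat \<lceil>v\<rceil>) (Suc (nat \<lfloor>y\<rfloor>))}"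
      by auto
  qed
  then have c: "card {k::nat. real k \<le> y \<and> real k < v} = min (nat \<lceil>v\<rceil>) (Suc (nat \<lfloor>y\<rfloor>))" by simp
  have "v \<le> real (nat \<lceil>v\<rceil>)" "real (nat \<lceil>v\<rceil>) \<le> v + 1" "y \<le> real (Suc (nat \<lfloor>y\<rfloor>))"
    "real (Suc (nat \<lfloor>y\<rfloor>)) \<le> y + 1"
    using assms by linarith+
  then show "min v y \<le> real (card {k::nat. real k \<le> y \<and> real k < v})"
    "real (card {k::nat. real k \<le> y \<and> real k < v}) \<le> min v y + 1"
    unfolding c of_nat_min by auto
qed

context recurrent_system
begin

definition m :: "nat \<Rightarrow> real" where "m n = (\<Sum>j<n. p j)"

lemma alpha_eq: "alpha M T E n = real n / m n"
  by (simp add: alpha_def m_def p_def)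

lemma m_at_top: "filterlim m at_top sequentially"
  using sum_p_at_top by (simp add: m_def[abs_def])

lemma m_pos: "0 < n \<Longrightarrow> 0 < m n"
  unfolding m_def by (intro sum_pos) (auto intro: p_pos)

lemma space_P [simp]: "space P = E"
  using E_subset by (simp add: space_restrict_space Int_absorb2)

lemma measure_P: "\<lbrakk>A \<subseteq> E\<rbrakk> \<Longrightarrow> measure P A = measure M A"
  using E_subset by (intro measure_restrict_space) (auto simp: Int_absorb2)

lemma emeasure_P: "\<lbrakk>A \<subseteq> E\<rbrakk> \<Longrightarrow> emeasure P A = emeasure M A"
  using E_subset by (intro emeasure_restrict_space) (auto simp: Int_absorb2)

lemma finite_measure_P: "finite_measure P"
  by (rule finite_measureI) (simp add: emeasure_P E_measure)

lemma measurable_P: "h \<in> measurable M N \<Longrightarrow> h \<in> measurable P N"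
  by (rule measurable_restrict_space1)

lemma return_time_measurable_P [measurable]: "\<phi> \<in> measurable P (count_space UNIV)"
  by (rule measurable_P) measurable

text \<open>As \<open>p\<close> tends to \<open>0\<close>, so do its averages
  \<open>m n / n\<close>, the reciprocals of \<open>\<alpha>(n)\<close>.\<close>

lemma alpha_at_top: "filterlim (alpha M T E) at_top sequentially"
  unfolding filterlim_at_top_gt[where c = 0]
proof (intro allI impI)
  fix Z :: real assume Z: "0 < Z"
  have "\<forall>\<^sub>F j in sequentially. p j < 1 / (2 * Z)"
    using Z by (intro order_tendstoD(2)[OF p_tendsto_0]) simp
  then obtain J where J: "\<And>j. J \<le> j \<Longrightarrow> p j < 1 / (2 * Z)" by (auto simp: eventually_sequentially)
  have "Z \<le> alpha M T E n" if n: "max (Suc J) (nat \<lceil>2 * Z * real J\<rceil>) \<le> n" for n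
  proof -
    have "2 * Z * real J \<le> real n" using n by linarith
    then have J2: "real J \<le> real n / (2 * Z)" using Z by (simp add: field_simps)
    have "m n = (\<Sum>j<J. p j) + (\<Sum>j=J..<n. p j)"
      unfolding m_def lessThan_atLeast0 using n by (intro sum.atLeastLessThan_concat[symmetric]) auto
    also have "(\<Sum>j<J. p j) \<le> real J" using sum_mono[of "{..<J}" p "\<lambda>_. 1"] p_le_1 by simp
    also have "(\<Sum>j=J..<n. p j) \<le> (\<Sum>j=J..<n. 1 / (2 * Z))"
      using J by (intro sum_mono) (auto intro: less_imp_le)
    also have "\<dots> \<le> real n * (1 / (2 * Z))"
      using Z by (simp add: divide_right_mono)
    finally have "m n \<le> real n / Z" using J2 Z by (simp add: field_simps)
    then show ?thesis using m_pos[of n] n Z unfolding alpha_eq by (simp add: field_simps)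
  qed
  then show "\<forall>\<^sub>F n in sequentially. Z \<le> alpha M T E n" by (rule eventually_sequentiallyI)
qed

end

section \<open>Observables constant on hitting levels; translating the conditions on
  \<open>ell\<close> and \<open>Gam\<close>\<close>

locale level_observable = recurrent_system M T E
  for M :: "'a measure" and T :: "'a \<Rightarrow> 'a" and E :: "'a set" +
  fixes h :: "'a \<Rightarrow> real"
  assumes h_nonneg: "\<And>x. x \<in> space M \<Longrightarrow> 0 \<le> h x"
    and h_levels: "\<And>k. h constant_on hitting_level M T E k"
begin

definition \<gamma> :: "nat \<Rightarrow> real" where "\<gamma> k = the_elem (h ` hitting_level M T E k)"

definition F :: "nat \<Rightarrow> real" where "F n = (\<Sum>j<n. \<gamma> j * p j)"

abbreviation G :: "nat \<Rightarrow> real" where "G \<equiv> induced_value M T E h"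

lemma G_eq: "G n = (\<Sum>k<n. \<gamma> k)" by (simp add: induced_value_def \<gamma>_def)

lemma h_eq: "x \<in> hitting_level M T E k \<Longrightarrow> h x = \<gamma> k"
proof -
  assume x: "x \<in> hitting_level M T E k"
  then have "h ` hitting_level M T E k = {h x}"
    using h_levels[of k] unfolding constant_on_def by auto
  then show ?thesis by (simp add: \<gamma>_def)
qed

lemma \<gamma>_nonneg: "0 \<le> \<gamma> k"
proof -
  obtain x where "x \<in> hitting_level M T E k" using hitting_level_nonempty by blast
  then show ?thesis using h_eq[of x k] h_nonneg[of x] by (auto simp: hitting_level_def)
qed

lemma G_mono: "i \<le> j \<Longrightarrow> G i \<le> G j"
  unfolding G_eq by (intro sum_mono2) (auto simp: \<gamma>_nonneg)

lemma G_0 [simp]: "G 0 = 0" by (simp add: G_eq)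

lemma G_nonneg: "0 \<le> G n" using G_mono[of 0 n] by simp

lemma F_le_G: "F n \<le> G n"
  unfolding F_def G_eq using \<gamma>_nonneg p_le_1 p_nonneg by (intro sum_mono) (simp add: mult_left_le)

lemma F_nonneg: "0 \<le> F n"
  unfolding F_def by (intro sum_nonneg mult_nonneg_nonneg \<gamma>_nonneg p_nonneg)

text \<open>Integrating over the hitting levels, whose masses are \<open>p k\<close>, bounds the
  integral of \<open>f\<close> by the limit of \<open>F\<close>.\<close>

lemma F_at_top:
  assumes "(\<integral>\<^sup>+x. ennreal (f x) \<partial>M) = \<infinity>" and "AE x in M. f x \<le> h x"
  shows "filterlim F at_top sequentially"
proof -
  have "(\<integral>\<^sup>+x. ennreal (f x) \<partial>M) \<le> (\<integral>\<^sup>+x. (\<Sum>k. ennreal (\<gamma> k) * indicator (hitting_level M T E k) x) \<partial>M)"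
  proof (rule nn_integral_mono_AE)
    show "AE x in M. ennreal (f x) \<le> (\<Sum>k. ennreal (\<gamma> k) * indicator (hitting_level M T E k) x)"
      using assms(2) AE_frequently_hits AE_space
    proof eventually_elim
      case (elim x)
      define k where "k = hitting_time T E x"
      from elim(2) have "\<exists>k. (T ^^ k) x \<in> E" by (rule frequently_ex)
      then have k: "x \<in> hitting_level M T E k"
        using elim(3) unfolding hitting_level_def k_def by blast
      have "ennreal (f x) \<le> (\<Sum>j\<in>{k}. ennreal (\<gamma> j) * indicator (hitting_level M T E j) x)"
        using k h_eq[OF k] elim(1) by (simp add: ennreal_leI)
      also have "\<dots> \<le> (\<Sum>j. ennreal (\<gamma> j) * indicator (hitting_level M T E j) x)"
        by (rule sum_le_suminf) auto
      finally show ?case .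
    qed
  qed
  also have "\<dots> = (\<Sum>k. ennreal (\<gamma> k) * ennreal (p k))"
    by (subst nn_integral_suminf) (auto simp: nn_integral_cmult emeasure_hitting_level)
  also have "\<dots> = (\<Sum>k. ennreal (\<gamma> k * p k))" using \<gamma>_nonneg by (simp add: ennreal_mult')
  finally have inf: "(\<Sum>k. ennreal (\<gamma> k * p k)) = \<infinity>" using assms(1) by (simp add: top_unique)
  have nonneg: "0 \<le> \<gamma> k * p k" for k using \<gamma>_nonneg p_nonneg by simp
  have not: "\<not> summable (\<lambda>k. \<gamma> k * p k)"
    using inf nonneg suminf_ennreal2[of "\<lambda>k. \<gamma> k * p k"] by auto
  have mono: "mono F" unfolding F_def[abs_def] by (intro monoI sum_mono2) (auto simp: nonneg)
  have "\<exists>n. B \<le> F n" for B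
  proof (rule ccontr)
    assume "\<nexists>n. B \<le> F n"
    then have "summable (\<lambda>k. \<gamma> k * p k)"
      by (intro summableI_nonneg_bounded[of _ B] nonneg) (auto simp: F_def not_le less_imp_le)
    then show False using not by simp
  qed
  then show ?thesis
    unfolding filterlim_at_top eventually_sequentially using monoD[OF mono] by (meson order_trans)
qed

lemma G_at_top: "filterlim F at_top sequentially \<Longrightarrow> filterlim G at_top sequentially"
  by (rule filterlim_at_top_mono[of F]) (auto simp: F_le_G)

text \<open>\<open>Gam\<close> is a generalised inverse of the monotone \<open>G\<close>: it is at
  most \<open>k\<close> exactly if \<open>y < G k\<close>. The index \<open>0\<close>, excluded from
  the minimum in \<open>Gam\<close>, does no harm because \<open>G 0 = 0 \<le> y\<close>.\<close>

lemma return_ge_Gam: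
  assumes G: "filterlim G at_top sequentially" and y: "0 \<le> y"
  shows "return_ge T E (Gam M T E h y) = {x\<in>E. y < G (\<phi> x)}"
    and "G (Gam M T E h y - 1) \<le> y" "y < G (Gam M T E h y)" "1 \<le> Gam M T E h y"
proof -
  define n where "n = Gam M T E h y"
  have "\<forall>\<^sub>F k in sequentially. y < G k \<and> 1 \<le> k"
    using G eventually_ge_at_top[of 1] by (auto simp: filterlim_at_top_dense intro: eventually_conj)
  then have "\<exists>k. 1 \<le> k \<and> y < G k" by (auto simp: eventually_sequentially)
  then have n: "1 \<le> n \<and> y < G n" unfolding n_def Gam_def by (rule LeastI_ex)
  have least: "n \<le> k" if "1 \<le> k" "y < G k" for k
    unfolding n_def Gam_def by (rule Least_le) (use that in auto)
  have iff: "n \<le> k \<longleftrightarrow> y < G k" for k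
  proof
    assume "n \<le> k"
    then show "y < G k" using n G_mono[of n k] by linarith
  next
    assume k: "y < G k"
    have "k \<noteq> 0"
    proof
      assume "k = 0"
      with k have "y < 0" by simp
      with y show False by simp
    qed
    then show "n \<le> k" using least k by simp
  qed
  show "return_ge T E (Gam M T E h y) = {x\<in>E. y < G (\<phi> x)}"
    unfolding n_def[symmetric] by (auto simp: return_ge_def return_level_def return_gt_def iff[symmetric])
  have "\<not> n \<le> n - 1" using n by linarith
  then have "\<not> y < G (n - 1)" using iff[of "n - 1"] by blast
  then show "G (Gam M T E h y - 1) \<le> y" by (simp add: n_def)
  show "y < G (Gam M T E h y)" "1 \<le> Gam M T E h y" using n by (simp_all add: n_def)
qed

text \<open>Let \<open>I y\<close> be the mean of \<open>min (G (\<phi> x)) y\<close> and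
  \<open>y N = a N * e (a N)\<close>, with \<open>a\<close> and \<open>e\<close> short for
  \<open>alpha\<close> and \<open>ell\<close>. Since \<open>e (a N)\<close> is asymptotic to
  \<open>L N * m N\<close> and \<open>a N = N / m N\<close>, \<open>y N\<close> is asymptotic to
  \<open>G N\<close>. Then \<open>F N = I (G N)\<close>, \<open>I (y N)\<close>,
  \<open>e (y N)\<close>, \<open>e (a N)\<close> and \<open>L N * m N\<close> are successively
  equivalent, the step from \<open>y N\<close> to \<open>a N\<close> being super-slow variation with
  exponent \<open>1\<close>.\<close>

lemma truncated_mean_asymp:
  assumes F: "filterlim F at_top sequentially"
    and L: "\<forall>\<^sub>F n in sequentially. 0 < L n" and form: "\<And>n. 1 \<le> n \<Longrightarrow> G n = real n * L n"
    and ell_pos: "\<And>x. 0 < x \<Longrightarrow> 0 < ell M T E h x"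
    and slow: "((\<lambda>x. ell M T E h (x * ell M T E h x) / ell M T E h x) \<longlongrightarrow> 1) at_top"
    and equiv: "(\<lambda>N. ell M T E h (alpha M T E N) / (L N * (\<Sum>k=0..N. p k))) \<longlonglongrightarrow> 1"
  shows "(\<lambda>n. F n / (L n * m n)) \<longlonglongrightarrow> 1"
proof -
  interpret P: finite_measure P by (rule finite_measure_P)
  have GT: "filterlim G at_top sequentially" using F by (rule G_at_top)
  have [measurable]: "(\<lambda>x. G (\<phi> x)) \<in> borel_measurable P"
    by (rule measurable_compose[OF return_time_measurable_P]) simp
  define I where "I y = (\<integral>x. min (G (\<phi> x)) y \<partial>P)" for y
  have int: "integrable P (\<lambda>x. min (G (\<phi> x)) y)" if "0 \<le> y" for y
  proof (rule P.integrable_const_bound[of _ y])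
    have "0 \<le> min (G (\<phi> x)) y" for x using that G_nonneg by simp
    then show "AE x in P. norm (min (G (\<phi> x)) y) \<le> y" by (intro AE_I2) simp
  qed measurable
  have I_mono: "I y \<le> I z" if "0 \<le> y" "y \<le> z" for y z
    unfolding I_def by (intro integral_mono int) (use that in auto)
  \<comment> \<open>With monotonicity this confines \<open>I y / I z\<close> between
    \<open>1\<close> and \<open>y / z\<close>, so asymptotically equal arguments give asymptotically
    equal values of \<open>I\<close>.\<close>
  have I_scale: "I (r * y) \<le> r * I y" if "0 \<le> y" "1 \<le> r" for r y
  proof -
    have "I (r * y) \<le> (\<integral>x. r * min (G (\<phi> x)) y \<partial>P)"
      unfolding I_def
    proof (intro integral_mono integrable_mult_right int)
      fix x
      have "1 * G (\<phi> x) \<le> r * G (\<phi> x)" using that G_nonneg by (intro mult_right_mono) auto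
      then show "min (G (\<phi> x)) (r * y) \<le> r * min (G (\<phi> x)) y" by (auto simp: min_def)
    qed (use that in auto)
    then show ?thesis by (simp add: I_def)
  qed
  have I_G: "I (G n) = F n" for n
  proof -
    have "min (G k) (G n) = (\<Sum>l<n. \<gamma> l * (if l < k then 1 else 0))" for k
    proof -
      have "min (G k) (G n) = G (min k n)" using G_mono[of k n] G_mono[of n k] by (auto simp: min_def)
      also have "\<dots> = (\<Sum>l<n. \<gamma> l * (if l < k then 1 else 0))"
        unfolding G_eq by (rule sum.mono_neutral_cong_left) auto
      finally show ?thesis .
    qed
    then have "I (G n) = (\<integral>x. (\<Sum>l<n. \<gamma> l * (if l < \<phi> x then 1 else 0)) \<partial>P)" by (simp add: I_def)
    also have "\<dots> = (\<integral>x. (\<Sum>l<n. \<gamma> l * indicator (return_gt T E l) x) \<partial>P)"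
      by (intro Bochner_Integration.integral_cong sum.cong refl) (auto simp: return_gt_def indicator_def)
    also have "\<dots> = (\<Sum>l<n. \<integral>x. \<gamma> l * indicator (return_gt T E l) x \<partial>P)"
    proof (intro Bochner_Integration.integral_sum integrable_mult_right integrable_real_indicator)
      show "return_gt T E l \<in> sets P" for l
        using E_subset by (auto simp: sets_restrict_space_iff return_gt_def intro: return_gt_sets[unfolded return_gt_def])
      show "emeasure P (return_gt T E l) < \<infinity>" for l by (simp add: P.emeasure_eq_measure)
    qed
    also have "\<dots> = F n"
    proof -
      have "return_gt T E l \<inter> E = return_gt T E l" "return_gt T E l \<subseteq> E" for l by (auto simp: return_gt_def)
      then show ?thesis by (simp add: F_def p_def measure_P)
    qed
    finally show ?thesis .
  qed
  \<comment> \<open>Exchange the sum over integers with the integral; pointwise the sum counts the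
    integers below both \<open>y\<close> and \<open>G (\<phi> x)\<close>, as in
    \<open>card_nat_below\<close>.\<close>
  have ell_I: "I y \<le> ell M T E h y \<and> ell M T E h y \<le> I y + 1" if y: "0 \<le> y" for y
  proof -
    define D where "D = {k::nat. real k \<le> y}"
    have D: "finite D"
      by (rule finite_subset[of _ "{..nat \<lfloor>y\<rfloor>}"]) (auto simp: D_def le_nat_floor)
    have sub: "{x\<in>E. real k < G (\<phi> x)} \<subseteq> E" for k by auto
    have sets: "{x\<in>E. real k < G (\<phi> x)} \<in> sets P" for k
    proof -
      have "{x\<in>space P. real k < G (\<phi> x)} \<in> sets P" by measurable
      then show ?thesis by simp
    qed
    have "ell M T E h y = (\<Sum>k\<in>D. measure P {x\<in>E. real k < G (\<phi> x)})"
      unfolding ell_def D_def by (intro sum.cong refl) (simp add: return_ge_Gam[OF GT] measure_P[OF sub])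
    also have "\<dots> = (\<Sum>k\<in>D. \<integral>x. indicator {x\<in>E. real k < G (\<phi> x)} x \<partial>P)"
      by (intro sum.cong refl) (simp add: Int_absorb2[OF sub])
    also have "\<dots> = (\<integral>x. (\<Sum>k\<in>D. indicator {x\<in>E. real k < G (\<phi> x)} x) \<partial>P)"
      by (rule Bochner_Integration.integral_sum[symmetric])
         (auto intro!: integrable_real_indicator sets simp: P.emeasure_eq_measure)
    also have "\<dots> = (\<integral>x. real (card {k::nat. real k \<le> y \<and> real k < G (\<phi> x)}) \<partial>P)"
    proof (rule Bochner_Integration.integral_cong[OF refl])
      fix x assume "x \<in> space P"
      then have "(\<Sum>k\<in>D. indicator {x\<in>E. real k < G (\<phi> x)} x) = (\<Sum>k\<in>D. if real k < G (\<phi> x) then 1 else 0::real)"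
        by (intro sum.cong refl) auto
      also have "\<dots> = real (card {k\<in>D. real k < G (\<phi> x)})"
        using D by (simp add: sum.If_cases Int_def)
      finally show "(\<Sum>k\<in>D. indicator {x\<in>E. real k < G (\<phi> x)} x) =
          real (card {k::nat. real k \<le> y \<and> real k < G (\<phi> x)})" by (simp add: D_def)
    qed
    finally have eq: "ell M T E h y = (\<integral>x. real (card {k::nat. real k \<le> y \<and> real k < G (\<phi> x)}) \<partial>P)" .
    have meas: "(\<lambda>x. real (card {k::nat. real k \<le> y \<and> real k < G (\<phi> x)})) \<in> borel_measurable P"
      by (rule measurable_compose[OF return_time_measurable_P]) simp
    have intc: "integrable P (\<lambda>x. real (card {k::nat. real k \<le> y \<and> real k < G (\<phi> x)}))"
    proof (rule P.integrable_const_bound[of _ "y + 1"])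
      have "real (card {k::nat. real k \<le> y \<and> real k < G (\<phi> x)}) \<le> y + 1" for x
        using card_nat_below(2)[OF G_nonneg[of "\<phi> x"] y] min.cobounded2[of "G (\<phi> x)" y] by linarith
      then show "AE x in P. norm (real (card {k::nat. real k \<le> y \<and> real k < G (\<phi> x)})) \<le> y + 1"
        by (intro AE_I2) simp
    qed (rule meas)
    have "I y \<le> ell M T E h y"
      unfolding eq I_def by (intro integral_mono int intc y card_nat_below(1) G_nonneg)
    moreover have "ell M T E h y \<le> (\<integral>x. min (G (\<phi> x)) y + 1 \<partial>P)"
      unfolding eq by (intro integral_mono int intc y card_nat_below(2) G_nonneg
          Bochner_Integration.integrable_add) simp
    moreover have "(\<integral>x. min (G (\<phi> x)) y + 1 \<partial>P) = I y + 1"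
      using int[OF y] by (simp add: I_def measure_P measure_E)
    ultimately show ?thesis by simp
  qed
  define a where "a N = alpha M T E N" for N
  define e where "e = ell M T E h"
  define y where "y N = a N * e (a N)" for N
  have a_top: "filterlim a at_top sequentially" unfolding a_def[abs_def] by (rule alpha_at_top)
  \<comment> \<open>The sum in \<open>equiv\<close> includes the index \<open>N\<close>, so it is
    \<open>m (Suc N)\<close> and has to be brought back to \<open>m N\<close>.\<close>
  have mS: "(\<lambda>N. m (Suc N) / m N) \<longlonglongrightarrow> 1"
  proof -
    have "(\<lambda>N. p N / m N) \<longlonglongrightarrow> 0"
      by (rule real_tendsto_divide_at_top[OF p_tendsto_0 m_at_top])
    then have "(\<lambda>N. 1 + p N / m N) \<longlonglongrightarrow> 1 + 0" by (intro tendsto_add tendsto_const)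
    moreover have "\<forall>\<^sub>F N in sequentially. 1 + p N / m N = m (Suc N) / m N"
      using eventually_gt_at_top[of 0]
    proof eventually_elim
      case (elim N)
      then show ?case using m_pos[of N] by (simp add: m_def add_divide_distrib)
    qed
    ultimately show ?thesis using Lim_transform_eventually by fastforce
  qed
  have e_equiv: "(\<lambda>N. e (a N) / (L N * m N)) \<longlonglongrightarrow> 1"
  proof -
    have "(\<lambda>N. e (a N) / (L N * m (Suc N)) * (m (Suc N) / m N)) \<longlonglongrightarrow> 1 * 1"
    proof (intro tendsto_mult mS)
      show "(\<lambda>N. e (a N) / (L N * m (Suc N))) \<longlonglongrightarrow> 1"
        using equiv by (simp add: e_def a_def m_def atLeast0AtMost lessThan_Suc_atMost)
    qed
    moreover have "\<forall>\<^sub>F N in sequentially. e (a N) / (L N * m (Suc N)) * (m (Suc N) / m N) = e (a N) / (L N * m N)"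
    proof (intro always_eventually allI)
      fix N
      have "m (Suc N) \<noteq> 0" using m_pos[of "Suc N"] by simp
      then show "e (a N) / (L N * m (Suc N)) * (m (Suc N) / m N) = e (a N) / (L N * m N)" by simp
    qed
    ultimately show ?thesis using Lim_transform_eventually by fastforce
  qed
  have ev: "\<forall>\<^sub>F N in sequentially. 0 < N \<and> 0 < L N \<and> 0 < a N \<and> 0 < e (a N) \<and> 1 \<le> F N"
  proof -
    have "\<forall>\<^sub>F N in sequentially. 0 < a N" using a_top by (simp add: filterlim_at_top_dense)
    moreover have "\<forall>\<^sub>F N in sequentially. 1 \<le> F N" using F by (simp add: filterlim_at_top)
    ultimately show ?thesis using L eventually_gt_at_top[of 0]
      by eventually_elim (auto simp: e_def ell_pos)
  qed
  have y_equiv: "(\<lambda>N. y N / G N) \<longlonglongrightarrow> 1"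
  proof (rule Lim_transform_eventually[OF e_equiv])
    show "\<forall>\<^sub>F N in sequentially. e (a N) / (L N * m N) = y N / G N"
      using ev
    proof eventually_elim
      case (elim N)
      then show ?case using form[of N] by (simp add: y_def a_def alpha_eq)
    qed
  qed
  have IF: "(\<lambda>N. I (y N) / F N) \<longlonglongrightarrow> 1"
  proof (rule tendsto_sandwich)
    have "(\<lambda>N. min 1 (y N / G N)) \<longlonglongrightarrow> min 1 1" by (intro tendsto_min tendsto_const y_equiv)
    then show "(\<lambda>N. min 1 (y N / G N)) \<longlonglongrightarrow> 1" by simp
    have "(\<lambda>N. max 1 (y N / G N)) \<longlonglongrightarrow> max 1 1" by (intro tendsto_max tendsto_const y_equiv)
    then show "(\<lambda>N. max 1 (y N / G N)) \<longlonglongrightarrow> 1" by simp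
    have both: "\<forall>\<^sub>F N in sequentially. min 1 (y N / G N) \<le> I (y N) / F N \<and> I (y N) / F N \<le> max 1 (y N / G N)"
      using ev
    proof eventually_elim
      case (elim N)
      have G: "0 < G N" using elim F_le_G[of N] by simp
      have yp: "0 < y N" using elim by (simp add: y_def)
      have F: "0 < F N" using elim by simp
      show ?case
      proof (cases "y N \<le> G N")
        case True
        have "I (y N) \<le> F N" using I_mono[of "y N" "G N"] True yp I_G by simp
        moreover have "F N \<le> (G N / y N) * I (y N)"
          using I_scale[of "y N" "G N / y N"] True yp I_G[of N] by simp
        ultimately have "y N / G N \<le> I (y N) / F N" "I (y N) / F N \<le> 1"
          using G yp F by (simp_all add: field_simps)
        then show ?thesis by (meson max.cobounded1 min.cobounded2 order_trans)
      next
        case False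
        have "F N \<le> I (y N)" using I_mono[of "G N" "y N"] False G I_G[of N] by simp
        moreover have "I (y N) \<le> (y N / G N) * F N"
          using I_scale[of "G N" "y N / G N"] False G I_G[of N] by simp
        ultimately have "1 \<le> I (y N) / F N" "I (y N) / F N \<le> y N / G N"
          using G yp F by (simp_all add: field_simps)
        then show ?thesis by (meson max.cobounded2 min.cobounded1 order_trans)
      qed
    qed
    then show "\<forall>\<^sub>F N in sequentially. min 1 (y N / G N) \<le> I (y N) / F N"
      "\<forall>\<^sub>F N in sequentially. I (y N) / F N \<le> max 1 (y N / G N)"
      by (auto elim: eventually_mono)
  qed
  have eF: "(\<lambda>N. e (y N) / F N) \<longlonglongrightarrow> 1"
  proof (rule tendsto_sandwich[OF _ _ IF])
    have "(\<lambda>N. I (y N) / F N + 1 / F N) \<longlonglongrightarrow> 1 + 0"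
      by (intro tendsto_add IF real_tendsto_divide_at_top[OF tendsto_const F])
    then show "(\<lambda>N. I (y N) / F N + 1 / F N) \<longlonglongrightarrow> 1" by simp
    show "\<forall>\<^sub>F N in sequentially. I (y N) / F N \<le> e (y N) / F N"
      using ev
    proof eventually_elim
      case (elim N)
      then show ?case using ell_I[of "y N"] by (intro divide_right_mono) (auto simp: y_def e_def)
    qed
    show "\<forall>\<^sub>F N in sequentially. e (y N) / F N \<le> I (y N) / F N + 1 / F N"
      using ev
    proof eventually_elim
      case (elim N)
      then show ?case using ell_I[of "y N"]
        unfolding add_divide_distrib[symmetric] by (intro divide_right_mono) (auto simp: y_def e_def)
    qed
  qed
  have ee: "(\<lambda>N. e (y N) / e (a N)) \<longlonglongrightarrow> 1"
    using filterlim_compose[OF slow a_top] by (simp add: e_def y_def)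
  have "(\<lambda>N. (e (y N) / e (a N)) * (e (a N) / (L N * m N)) / (e (y N) / F N)) \<longlonglongrightarrow> 1 * 1 / 1"
    by (intro tendsto_mult tendsto_divide ee e_equiv eF) simp
  moreover have "\<forall>\<^sub>F N in sequentially.
      (e (y N) / e (a N)) * (e (a N) / (L N * m N)) / (e (y N) / F N) = F N / (L N * m N)"
    using ev
  proof eventually_elim
    case (elim N)
    have "0 < e (y N)" using elim by (simp add: e_def ell_pos y_def)
    then show ?case using elim by simp
  qed
  ultimately show ?thesis using Lim_transform_eventually by fastforce
qed

lemma G_interval_unique:
  assumes "G i \<le> y" "y < G (Suc i)" "G j \<le> y" "y < G (Suc j)"
  shows "i = j"
proof (rule ccontr)
  assume "i \<noteq> j"
  then consider "Suc i \<le> j" | "Suc j \<le> i" by linarith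
  then show False using G_mono[of "Suc i" j] G_mono[of "Suc j" i] assms by cases linarith+
qed

text \<open>Cut the integral at the points \<open>G n\<close>. On the piece from \<open>G n\<close>
  to \<open>G (Suc n)\<close>, of length \<open>\<gamma> n\<close>, the tail equals
  \<open>p n\<close>, the variable is at least \<open>G n\<close>, and the inner integral is at most
  \<open>F (Suc n)\<close>.\<close>

lemma summable_tail_squares:
  assumes GT: "filterlim G at_top sequentially" and y0: "0 < y0"
    and fin: "(\<integral>\<^sup>+ y\<in>{y0..}. ennreal
            (y * (measure M (return_ge T E (Gam M T E h y)))\<^sup>2
             / (LBINT t:{0..y}. measure M (return_ge T E (Gam M T E h t)))\<^sup>2) \<partial>lborel) < \<infinity>"
  shows "summable (\<lambda>n. \<gamma> n * G n * (p n)\<^sup>2 / (F (Suc n))\<^sup>2)"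
proof -
  define H where "H t = measure M (return_ge T E (Gam M T E h t))" for t
  define J where "J y = (LBINT t:{0..y}. H t)" for y
  have H_eq: "H t = p n" if "0 \<le> t" "G n \<le> t" "t < G (Suc n)" for t n
  proof -
    have "t < G k \<longleftrightarrow> n < k" for k
      using G_mono[of "Suc n" k] G_mono[of k n] that by (cases "n < k") auto
    then have "return_ge T E (Gam M T E h t) = return_gt T E n"
      unfolding return_ge_Gam(1)[OF GT that(1)] by (auto simp: return_gt_def)
    then show ?thesis by (simp add: H_def p_def)
  qed
  have interval: "\<exists>j. G j \<le> t \<and> t < G (Suc j)" if "0 \<le> t" for t
    using return_ge_Gam(2-4)[OF GT that] by (intro exI[of _ "Gam M T E h t - 1"]) simp
  \<comment> \<open>An explicit step function that agrees with \<open>H\<close> below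
    \<open>G (Suc n)\<close>; its integrability and its integral are immediate, so no separate
    measurability argument for \<open>H\<close> arises.\<close>
  define st where "st n t = (\<Sum>j<Suc n. p j * indicator {G j..<G (Suc j)} t)" for n t
  have ind_int: "integrable lborel (\<lambda>t. p j * indicator {G j..<G (Suc j)} t)" for j
    using G_mono[of j "Suc j"] by (intro integrable_mult_right integrable_real_indicator) auto
  have st_int: "integrable lborel (st n)" for n
    unfolding st_def[abs_def] by (intro Bochner_Integration.integrable_sum ind_int)
  have st_integral: "(\<integral>t. st n t \<partial>lborel) = F (Suc n)" for n
  proof -
    have "(\<integral>t. st n t \<partial>lborel) = (\<Sum>j<Suc n. \<integral>t. p j * indicator {G j..<G (Suc j)} t \<partial>lborel)"
      unfolding st_def by (intro Bochner_Integration.integral_sum ind_int)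
    also have "\<dots> = F (Suc n)"
      unfolding F_def
    proof (intro sum.cong refl)
      fix j
      have "G (Suc j) - G j = \<gamma> j" by (simp add: G_eq)
      then show "(\<integral>t. p j * indicator {G j..<G (Suc j)} t \<partial>lborel) = \<gamma> j * p j"
        using G_mono[of j "Suc j"] by simp
    qed
    finally show ?thesis .
  qed
  have st_H: "st n t = H t" if t: "0 \<le> t" "t < G (Suc n)" for n t
  proof -
    obtain j where j: "G j \<le> t" "t < G (Suc j)" using interval[OF t(1)] by blast
    have "j < Suc n"
    proof (rule ccontr)
      assume "\<not> j < Suc n"
      then show False using G_mono[of "Suc n" j] j t by simp
    qed
    have "st n t = (\<Sum>i<Suc n. if i = j then p j else 0)"
      unfolding st_def
    proof (intro sum.cong refl)
      fix i
      show "p i * indicator {G i..<G (Suc i)} t = (if i = j then p j else 0)"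
      proof (cases "i = j")
        case False
        then have "t \<notin> {G i..<G (Suc i)}" using j G_interval_unique[of i t j] by fastforce
        then show ?thesis using False by simp
      qed (use j in simp)
    qed
    also have "\<dots> = p j" using \<open>j < Suc n\<close> by simp
    finally show ?thesis using H_eq[OF t(1) j] by simp
  qed
  \<comment> \<open>Positivity matters as much as the upper bound: if \<open>J y\<close> were
    \<open>0\<close>, division by zero would make the integrand \<open>0\<close> and spoil its lower
    bound.\<close>
  have J: "0 < J y \<and> J y \<le> F (Suc n)" if y: "0 < y" "G n \<le> y" "y < G (Suc n)" for y n
  proof -
    have eq: "indicator {0..y} t *\<^sub>R H t = indicator {0..y} t * st n t" for t
    proof (cases "t \<in> {0..y}")
      case True
      then have "st n t = H t" using y by (intro st_H) auto
      then show ?thesis by simp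
    qed simp
    have J_eq: "J y = (\<integral>t. indicator {0..y} t * st n t \<partial>lborel)"
      unfolding J_def set_lebesgue_integral_def eq ..
    have int: "integrable lborel (\<lambda>t. indicator {0..y} t * st n t)"
      using integrable_mult_indicator[OF _ st_int[of n], of "{0..y}"] by simp
    have st0: "0 \<le> st n t" for t
      unfolding st_def by (intro sum_nonneg) (auto simp: p_nonneg)
    have "J y \<le> (\<integral>t. st n t \<partial>lborel)"
      unfolding J_eq by (intro integral_mono int st_int) (auto simp: indicator_def st0)
    moreover have "(\<integral>t. p n * indicator {0..y} t \<partial>lborel) \<le> J y"
      unfolding J_eq
    proof (intro integral_mono int integrable_mult_right)
      fix t
      show "p n * indicator {0..y} t \<le> indicator {0..y} t * st n t"
      proof (cases "t \<in> {0..y}")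
        case True
        then obtain j where j: "G j \<le> t" "t < G (Suc j)" using interval[of t] by auto
        have "j \<le> n"
        proof (rule ccontr)
          assume "\<not> j \<le> n"
          then show False using G_mono[of "Suc n" j] j y True by simp
        qed
        then have "p n \<le> p j" using antimonoD[OF p_antimono] by blast
        also have "p j = st n t" using st_H[of t n] H_eq[of t j] j y True by simp
        finally show ?thesis using True by simp
      qed simp
    next
      show "integrable lborel (indicat_real {0..y})"
        using y by (intro integrable_real_indicator) auto
    qed
    ultimately show ?thesis using y p_pos[of n] by (simp add: st_integral) (smt (verit) mult_pos_pos)
  qed
  define q where "q n = G n * (p n)\<^sup>2 / (F (Suc n))\<^sup>2" for n
  have q0: "0 \<le> q n" for n using G_nonneg by (simp add: q_def)
  define f where "f y = ennreal (y * (H y)\<^sup>2 / (J y)\<^sup>2) * indicator {y0..} y" for y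
  have f_fin: "(\<integral>\<^sup>+y. f y \<partial>lborel) < \<infinity>" using fin by (simp add: f_def H_def J_def)
  \<comment> \<open>From \<open>n1\<close> on, all pieces lie inside the domain of
    integration.\<close>
  obtain n1 where n1: "y0 \<le> G n1"
    using GT unfolding filterlim_at_top eventually_sequentially by blast
  have q_le: "ennreal (q n) \<le> f y" if n: "n1 \<le> n" and y: "G n \<le> y" "y < G (Suc n)" for n y
  proof -
    have yy: "y0 \<le> y" using n1 G_mono[OF n] y by linarith
    then have "0 < y" using y0 by linarith
    note JJ = J[OF this y]
    have "q n \<le> y * (p n)\<^sup>2 / (J y)\<^sup>2"
      unfolding q_def using y JJ \<open>0 < y\<close> by (intro frac_le mult_right_mono power_mono) auto
    then show ?thesis using yy H_eq[of y n] y \<open>0 < y\<close> by (simp add: f_def ennreal_leI)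
  qed
  define R where "R = enn2real (\<integral>\<^sup>+y. f y \<partial>lborel)"
  have bound: "(\<Sum>n=n1..<N. \<gamma> n * q n) \<le> R" for N
  proof -
    have "(\<Sum>n=n1..<N. ennreal (q n) * indicator {G n..<G (Suc n)} y) \<le> f y" for y
    proof (cases "\<exists>j\<in>{n1..<N}. G j \<le> y \<and> y < G (Suc j)")
      case True
      then obtain j where j: "j \<in> {n1..<N}" "G j \<le> y" "y < G (Suc j)" by blast
      have "(\<Sum>n=n1..<N. ennreal (q n) * indicator {G n..<G (Suc n)} y) =
          (\<Sum>n=n1..<N. if n = j then ennreal (q j) else 0)"
      proof (intro sum.cong refl)
        fix n
        show "ennreal (q n) * indicator {G n..<G (Suc n)} y = (if n = j then ennreal (q j) else 0)"
        proof (cases "n = j")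
          case False
          then have "y \<notin> {G n..<G (Suc n)}" using j G_interval_unique[of n y j] by fastforce
          then show ?thesis using False by simp
        qed (use j in simp)
      qed
      also have "\<dots> = ennreal (q j)" using j by simp
      also have "\<dots> \<le> f y" using q_le j by simp
      finally show ?thesis .
    next
      case False
      then have "(\<Sum>n=n1..<N. ennreal (q n) * indicator {G n..<G (Suc n)} y) = 0"
        by (intro sum.neutral) (auto simp: indicator_def)
      then show ?thesis by simp
    qed
    then have "(\<integral>\<^sup>+y. (\<Sum>n=n1..<N. ennreal (q n) * indicator {G n..<G (Suc n)} y) \<partial>lborel) \<le>
        (\<integral>\<^sup>+y. f y \<partial>lborel)" by (intro nn_integral_mono)
    moreover have "(\<integral>\<^sup>+y. (\<Sum>n=n1..<N. ennreal (q n) * indicator {G n..<G (Suc n)} y) \<partial>lborel) =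
        (\<Sum>n=n1..<N. ennreal (\<gamma> n * q n))"
    proof -
      have "(\<integral>\<^sup>+y. ennreal (q n) * indicator {G n..<G (Suc n)} y \<partial>lborel) = ennreal (\<gamma> n * q n)" for n
      proof -
        have "emeasure lborel {G n..<G (Suc n)} = ennreal (\<gamma> n)"
          using G_mono[of n "Suc n"] by (simp add: G_eq)
        then show ?thesis using \<gamma>_nonneg[of n] q0[of n]
          by (simp add: nn_integral_cmult ennreal_mult mult.commute)
      qed
      then show ?thesis by (subst nn_integral_sum) auto
    qed
    ultimately have "ennreal (\<Sum>n=n1..<N. \<gamma> n * q n) \<le> (\<integral>\<^sup>+y. f y \<partial>lborel)"
      using \<gamma>_nonneg q0 by (simp add: sum_ennreal)
    also have "\<dots> = ennreal R" unfolding R_def using f_fin by simp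
    finally show ?thesis by (simp add: R_def ennreal_le_iff)
  qed
  have "summable (\<lambda>n. \<gamma> (n + n1) * q (n + n1))"
  proof (rule summableI_nonneg_bounded[where x = R])
    show "0 \<le> \<gamma> (n + n1) * q (n + n1)" for n using \<gamma>_nonneg q0 by simp
    fix N
    have "(\<Sum>n<N. \<gamma> (n + n1) * q (n + n1)) = (\<Sum>n=n1..<N + n1. \<gamma> n * q n)"
      by (rule sum.reindex_bij_witness[of _ "\<lambda>n. n - n1" "\<lambda>n. n + n1"]) auto
    then show "(\<Sum>n<N. \<gamma> (n + n1) * q (n + n1)) \<le> R" using bound by simp
  qed
  then have "summable (\<lambda>n. \<gamma> n * q n)" by (subst (asm) summable_iff_shift)
  then show ?thesis by (simp add: q_def mult.assoc)
qed

text \<open>Replacing \<open>\<gamma> n\<close>, \<open>G n\<close> and \<open>F (Suc n)\<close> by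
  \<open>L n\<close>, \<open>n * L n\<close> and \<open>L n * m n\<close>, up to constants, cancels
  the factor \<open>(L n)\<^sup>2\<close>.\<close>

lemma summable_squares:
  assumes sm: "summable (\<lambda>n. \<gamma> n * G n * (p n)\<^sup>2 / (F (Suc n))\<^sup>2)"
    and L: "\<forall>\<^sub>F n in sequentially. 0 < L n" and form: "\<And>n. 1 \<le> n \<Longrightarrow> G n = real n * L n"
    and \<gamma>: "(\<lambda>n. \<gamma> n / L n) \<longlonglongrightarrow> 1" and F: "(\<lambda>n. F n / (L n * m n)) \<longlonglongrightarrow> 1"
  shows "summable (\<lambda>n. real n * (p n)\<^sup>2 / (m n)\<^sup>2)"
proof (rule summable_comparison_test_ev)
  show "summable (\<lambda>n. 8 * (\<gamma> n * G n * (p n)\<^sup>2 / (F (Suc n))\<^sup>2))" by (intro summable_mult sm)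
  \<comment> \<open>From \<open>4\<close> on, the last summand \<open>\<gamma> n * p n\<close> of
    \<open>F (Suc n)\<close> is at most half of \<open>L n * m n\<close>, so
    \<open>F (Suc n)\<close> stays below twice this product.\<close>
  have "\<forall>\<^sub>F n in sequentially. 4 \<le> m n" using m_at_top by (simp add: filterlim_at_top)
  moreover have "\<forall>\<^sub>F n in sequentially. 1 / 2 < \<gamma> n / L n" "\<forall>\<^sub>F n in sequentially. \<gamma> n / L n < 2"
    "\<forall>\<^sub>F n in sequentially. F n / (L n * m n) < 3 / 2" "\<forall>\<^sub>F n in sequentially. 1 / 2 < F n / (L n * m n)"
    by (rule order_tendstoD[OF \<gamma>] order_tendstoD[OF F], simp)+
  ultimately show "\<forall>\<^sub>F n in sequentially. norm (real n * (p n)\<^sup>2 / (m n)\<^sup>2) \<le>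
      8 * (\<gamma> n * G n * (p n)\<^sup>2 / (F (Suc n))\<^sup>2)"
    using L eventually_ge_at_top[of 1]
  proof eventually_elim
    case (elim n)
    have Lp: "0 < L n" and mp: "0 < m n" "4 \<le> m n" using elim by auto
    have g: "L n / 2 \<le> \<gamma> n" "\<gamma> n \<le> 2 * L n" using elim Lp by (auto simp: field_simps)
    have Fn: "F n \<le> 3 / 2 * (L n * m n)" "0 < F n"
      using elim Lp mp by (auto simp: field_simps zero_less_mult_iff)
    have "\<gamma> n * p n \<le> 2 * L n * 1" using g p_le_1 p_nonneg Lp by (intro mult_mono) auto
    moreover have "L n * 4 \<le> L n * m n" using mp Lp by (intro mult_left_mono) auto
    ultimately have FS: "F (Suc n) \<le> 2 * (L n * m n)" using Fn by (simp add: F_def)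
    have F0: "0 < F (Suc n)" using Fn \<gamma>_nonneg[of n] p_nonneg[of n] by (simp add: F_def add_pos_nonneg)
    \<comment> \<open>The factor \<open>8\<close> makes up for \<open>1 / 2\<close> in the lower
      bound of \<open>\<gamma> n\<close> and for \<open>2\<^sup>2\<close> in the
      denominator.\<close>
    have "real n * (p n)\<^sup>2 / (m n)\<^sup>2 = 8 * ((L n / 2) * (real n * L n) * (p n)\<^sup>2 / (2 * (L n * m n))\<^sup>2)"
      using Lp mp by (simp add: power2_eq_square)
    also have "\<dots> \<le> 8 * (\<gamma> n * G n * (p n)\<^sup>2 / (F (Suc n))\<^sup>2)"
      unfolding form[OF elim(7)] using g FS F0 Lp \<gamma>_nonneg
      by (intro mult_left_mono frac_le mult_right_mono power_mono mult_nonneg_nonneg) auto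
    finally show ?case by simp
  qed
qed

end

section \<open>Almost sure behaviour of Birkhoff sums\<close>

context mixing_tails
begin

lemma AE_eventually_concentrated:
  fixes \<gamma> :: "nat \<Rightarrow> real" and c n :: "nat \<Rightarrow> nat"
  defines "\<theta> b \<equiv> \<Sum>l<b. \<gamma> l * p l"
  assumes \<gamma>: "\<And>l. 0 \<le> \<gamma> l" and ev: "\<forall>\<^sub>F k in sequentially. 0 < n k \<and> 0 < \<theta> (c k)"
    and s1: "summable (\<lambda>k. (\<Sum>l<c k. \<gamma> l) / (real (n k) * \<theta> (c k)))"
    and s2: "summable (\<lambda>k. (\<Sum>j<n k. \<psi> j) / real (n k))"
  shows "AE x in P. \<forall>\<^sub>F k in sequentially.
    \<bar>(\<Sum>i<n k. \<Sum>l<min (X i x) (c k). \<gamma> l) - real (n k) * \<theta> (c k)\<bar> < real (n k) * \<theta> (c k) / 2"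
proof -
  define A where "A k = {x\<in>space P. real (n k) * \<theta> (c k) / 2 \<le>
      \<bar>(\<Sum>i<n k. \<Sum>l<min (X i x) (c k). \<gamma> l) - real (n k) * \<theta> (c k)\<bar>}" for k
  have "AE x in P. eventually (\<lambda>k. x \<in> space P - A k) sequentially"
  proof (rule borel_cantelli_AE1)
    have [measurable]: "(\<lambda>x. \<Sum>l<min (X i x) (c k). \<gamma> l) \<in> borel_measurable P" for i k
      by (rule measurable_compose[OF X_measurable]) simp
    show "A k \<in> sets P" for k unfolding A_def by measurable
    show "emeasure P (A k) < \<infinity>" for k by (simp add: emeasure_eq_measure)
    show "summable (\<lambda>k. measure P (A k))"
    proof (rule summable_comparison_test_ev)
      show "summable (\<lambda>k. 8 * real K * ((\<Sum>l<c k. \<gamma> l) / (real (n k) * \<theta> (c k))) +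
          8 * ((\<Sum>j<n k. \<psi> j) / real (n k)))"
        by (intro summable_add summable_mult s1 s2)
      show "\<forall>\<^sub>F k in sequentially. norm (measure P (A k)) \<le>
          8 * real K * ((\<Sum>l<c k. \<gamma> l) / (real (n k) * \<theta> (c k))) + 8 * ((\<Sum>j<n k. \<psi> j) / real (n k))"
        using ev
      proof eventually_elim
        case (elim k)
        then show ?case using deviation_le[of \<gamma> "c k" "n k"] \<gamma> by (simp add: A_def \<theta>_def)
      qed
    qed
  qed
  then show ?thesis
    using AE_space by eventually_elim (auto simp: A_def elim!: eventually_mono)
qed

lemma AE_eventually_max_le:
  assumes "summable (\<lambda>k. real (n k) * p (d k))"
  shows "AE x in P. \<forall>\<^sub>F k in sequentially. \<forall>i<n k. X i x \<le> d k"
proof -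
  define A where "A k = (\<Union>i<n k. {x\<in>space P. d k < X i x})" for k
  have "AE x in P. eventually (\<lambda>k. x \<in> space P - A k) sequentially"
  proof (rule borel_cantelli_AE1)
    show "A k \<in> sets P" for k unfolding A_def by measurable
    show "emeasure P (A k) < \<infinity>" for k by (simp add: emeasure_eq_measure)
    show "summable (\<lambda>k. measure P (A k))"
    proof (rule summable_comparison_test[OF _ assms], intro exI allI impI)
      fix k
      have "measure P (A k) \<le> (\<Sum>i<n k. measure P {x\<in>space P. d k < X i x})"
        unfolding A_def by (rule finite_measure_subadditive_finite) auto
      then show "norm (measure P (A k)) \<le> real (n k) * p (d k)" by (simp add: tail)
    qed
  qed
  then show ?thesis
    using AE_space by eventually_elim (auto simp: A_def not_less elim!: eventually_mono)
qed

end

section \<open>Mixing of return times and the number of returns at dyadic times\<close>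

context recurrent_system
begin

text \<open>From some lag \<open>K\<close> on, the coefficient is below \<open>1\<close>, hence
  finite, and can be treated as a real number. Below \<open>K\<close> it is set to \<open>0\<close>,
  which is consistent because pair bounds are claimed for lags at least \<open>K\<close> only;
  \<open>K \<ge> 1\<close> gives the value \<open>0\<close> at lag \<open>0\<close>.\<close>

lemma mixing_tails_return_times:
  assumes mix: "psi_mixing P (count_space UNIV) (\<lambda>n x. \<phi> ((S ^^ (n - 1)) x))"
    and sum: "(\<Sum>n. psi_coeff P (count_space UNIV) (\<lambda>n x. \<phi> ((S ^^ (n - 1)) x)) (Suc n)
              / of_nat (Suc n)) < (\<infinity>::ennreal)"
  obtains \<psi> K where "mixing_tails P (\<lambda>n x. \<phi> ((S ^^ n) x)) p \<psi> K" "\<psi> 0 = 0"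
    "summable (\<lambda>n. \<psi> n / real n)"
proof -
  define Y where "Y n x = \<phi> ((S ^^ (n - 1)) x)" for n x
  define c where "c = psi_coeff P (count_space UNIV) Y"
  have "\<forall>\<^sub>F n in sequentially. c n < 1"
    using mix unfolding psi_mixing_def c_def Y_def[abs_def] by (intro order_tendstoD(2)) auto
  then obtain K0 where K0: "\<And>n. K0 \<le> n \<Longrightarrow> c n < 1" by (auto simp: eventually_sequentially)
  define K where "K = max 1 K0"
  have K: "c n < 1" if "K \<le> n" for n using K0[of n] that by (simp add: K_def)
  define \<psi> where "\<psi> n = (if n < K then 0 else enn2real (c n))" for n
  have \<psi>_nonneg: "0 \<le> \<psi> n" for n by (simp add: \<psi>_def)
  have \<psi>_le: "ennreal (\<psi> n) \<le> c n" for n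
    using K[of n] by (cases "n < K") (auto simp: \<psi>_def ennreal_enn2real_if less_top[symmetric])
  have c_eq: "c n = ennreal (\<psi> n)" if "K \<le> n" for n
    using K[OF that] that by (auto simp: \<psi>_def less_top[symmetric] ennreal_enn2real_if)
  interpret fm: finite_measure P by (rule finite_measure_P)
  have Y_meas: "(\<lambda>x. \<phi> ((S ^^ n) x)) \<in> measurable P (count_space UNIV)" for n
    by (rule measurable_P) measurable
  have "mixing_tails P (\<lambda>n x. \<phi> ((S ^^ n) x)) p \<psi> K"
  proof (unfold_locales)
    show "measure P (space P) = 1" by (simp add: measure_P measure_E)
    show "(\<lambda>x. \<phi> ((S ^^ j) x)) \<in> measurable P (count_space UNIV)" for j by (rule Y_meas)
    show "0 \<le> \<psi> k" for k by (rule \<psi>_nonneg)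
    show tail: "measure P {x\<in>space P. l < \<phi> ((S ^^ j) x)} = p l" for j l
    proof -
      have "{x\<in>space P. l < \<phi> ((S ^^ j) x)} = {x\<in>E. (S ^^ j) x \<in> return_gt T E l}"
        using induced_pow_in_E by (auto simp: return_gt_def)
      moreover have "{x\<in>E. (S ^^ j) x \<in> return_gt T E l} \<subseteq> E" by auto
      moreover have "return_gt T E l \<subseteq> E" by (auto simp: return_gt_def)
      ultimately show ?thesis
        using measure_induced_pow_vimage[of "return_gt T E l" j] by (simp add: measure_P p_def)
    qed
    fix i j l l' assume ij: "i + K \<le> j"
    define B where "B = {x\<in>space P. l < \<phi> ((S ^^ i) x)}"
    define C where "C = {x\<in>space P. l' < \<phi> ((S ^^ j) x)}"
    have BC: "measure P B = p l" "measure P C = p l'" using tail by (simp_all add: B_def C_def)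
    have pos: "0 < p l" "0 < p l'" by (rule p_pos)+
    \<comment> \<open>The mixing coefficient indexes the variables from \<open>1\<close>, so the
      \<open>i\<close>-th iterate is \<open>Y (Suc i)\<close>; the lag \<open>j - i\<close> is
      unchanged.\<close>
    have "B = Y (Suc i) -` {l<..} \<inter> space P" by (auto simp: B_def Y_def)
    then have B: "B \<in> generated_field P (count_space UNIV) Y {1..Suc i}"
      unfolding generated_field_def by (intro sigma_sets.Basic) auto
    have "C = Y (Suc j) -` {l'<..} \<inter> space P" by (auto simp: C_def Y_def)
    moreover have "Suc j \<in> {Suc i + (j - i)..}" using ij by simp
    moreover have "{l'<..} \<in> sets (count_space UNIV :: nat measure)" by simp
    ultimately have "C \<in> {Y n -` R \<inter> space P |n R. n \<in> {Suc i + (j - i)..} \<and> R \<in> sets (count_space UNIV)}"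
      by (intro CollectI exI conjI)
    then have C: "C \<in> generated_field P (count_space UNIV) Y {Suc i + (j - i)..}"
      unfolding generated_field_def by (rule sigma_sets.Basic)
    have "ennreal \<bar>measure P (B \<inter> C) / (measure P B * measure P C) - 1\<bar> \<le> c (j - i)"
      unfolding c_def psi_coeff_def
    proof (rule Sup_upper, intro CollectI exI conjI)
      show "1 \<le> Suc i" "0 < measure P B" "0 < measure P C" using BC pos by auto
    qed (use B C in auto)
    also have "c (j - i) = ennreal (\<psi> (j - i))" using ij by (intro c_eq) simp
    finally have "\<bar>measure P (B \<inter> C) / (p l * p l') - 1\<bar> \<le> \<psi> (j - i)"
      using \<psi>_nonneg by (simp add: BC)
    then have "measure P (B \<inter> C) / (p l * p l') \<le> 1 + \<psi> (j - i)" by linarith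
    then have "measure P (B \<inter> C) \<le> (1 + \<psi> (j - i)) * (p l * p l')"
      using pos by (simp add: field_simps)
    moreover have "B \<inter> C = {x\<in>space P. l < \<phi> ((S ^^ i) x) \<and> l' < \<phi> ((S ^^ j) x)}"
      by (auto simp: B_def C_def)
    ultimately show "measure P {x\<in>space P. l < \<phi> ((S ^^ i) x) \<and> l' < \<phi> ((S ^^ j) x)}
        \<le> (1 + \<psi> (j - i)) * (p l * p l')" by simp
  qed
  moreover have "\<psi> 0 = 0" by (simp add: \<psi>_def K_def)
  moreover have "summable (\<lambda>n. \<psi> n / real n)"
  proof -
    have "ennreal (\<psi> (Suc n) / real (Suc n)) \<le> c (Suc n) / of_nat (Suc n)" for n
    proof -
      have "ennreal (\<psi> (Suc n) / real (Suc n)) = ennreal (\<psi> (Suc n)) / ennreal (real (Suc n))"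
        using \<psi>_nonneg by (intro divide_ennreal[symmetric]) auto
      also have "\<dots> \<le> c (Suc n) / of_nat (Suc n)"
        using \<psi>_le[of "Suc n"] unfolding ennreal_of_nat_eq_real_of_nat by (rule divide_right_mono_ennreal)
      finally show ?thesis .
    qed
    then have "(\<Sum>n. ennreal (\<psi> (Suc n) / real (Suc n))) \<le> (\<Sum>n. c (Suc n) / of_nat (Suc n))"
      by (intro suminf_le) auto
    also have "\<dots> < \<infinity>" using sum by (simp add: c_def Y_def[abs_def])
    finally have "summable (\<lambda>n. \<psi> (Suc n) / real (Suc n))"
      using \<psi>_nonneg by (intro summable_suminf_not_top) auto
    then show ?thesis by (subst (asm) summable_Suc_iff)
  qed
  ultimately show ?thesis by (rule that)
qed

text \<open>Eight times \<open>\<alpha>(2\<^sup>k)\<close>: enough returns to \<open>E\<close> that, by Chebyshev's lower bound, they almost surely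
  take longer than \<open>2\<^sup>k\<close> for all large \<open>k\<close>.\<close>
definition returns :: "nat \<Rightarrow> nat" where "returns k = nat \<lceil>8 * 2 ^ k / m (2 ^ k)\<rceil>"

lemma returns_ge: "8 * 2 ^ k / m (2 ^ k) \<le> real (returns k)"
  unfolding returns_def by linarith

lemma returns_pos: "0 < returns k"
proof -
  have "0 < 8 * 2 ^ k / m (2 ^ k)" using m_pos[of "2 ^ k"] by simp
  then show ?thesis using returns_ge[of k] by linarith
qed

lemma returns_le: "real (returns k) \<le> 16 * 2 ^ k / m (2 ^ k)"
proof -
  have "m (2 ^ k) \<le> 2 ^ k"
    unfolding m_def using sum_mono[of "{..<2 ^ k}" p "\<lambda>_. 1"] p_le_1 by simp
  then have "1 \<le> 8 * 2 ^ k / m (2 ^ k)" using m_pos[of "2 ^ k"] by (simp add: field_simps)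
  then show ?thesis unfolding returns_def by linarith
qed

text \<open>After interchanging the sums, \<open>\<psi> j\<close> is multiplied by the sum of
  \<open>1 / returns k\<close> over the \<open>k\<close> with \<open>returns k > j\<close>. As the
  number of returns grows geometrically, this is of order \<open>1 / j\<close>.\<close>

lemma summable_average:
  assumes \<psi>: "\<And>n. 0 \<le> \<psi> n" "\<psi> 0 = 0" "summable (\<lambda>n. \<psi> n / real n)"
    and double: "\<forall>\<^sub>F n in sequentially. m (2 * n) \<le> 3 / 2 * m n"
  shows "summable (\<lambda>k. (\<Sum>j<returns k. \<psi> j) / real (returns k))"
proof -
  obtain N where N: "\<And>n. N \<le> n \<Longrightarrow> m (2 * n) \<le> 3 / 2 * m n"
    using double by (auto simp: eventually_sequentially)
  \<comment> \<open>The number of returns before rounding up: the numerator doubles while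
    \<open>m\<close> grows by at most \<open>3 / 2\<close>, so the growth factor is at least
    \<open>4 / 3\<close>, which rounding could spoil.\<close>
  define a where "a k = 8 * 2 ^ (k + N) / m (2 ^ (k + N))" for k
  have a_pos: "0 < a k" for k using m_pos[of "2 ^ (k + N)"] by (simp add: a_def)
  have growth: "4 / 3 * a k \<le> a (Suc k)" for k
  proof -
    have "k + N \<le> 2 ^ (k + N)" using less_exp[of "k + N"] by simp
    then have "N \<le> 2 ^ (k + N)" by linarith
    then have "m (2 ^ (Suc k + N)) \<le> 3 / 2 * m (2 ^ (k + N))" using N[of "2 ^ (k + N)"] by simp
    then show ?thesis
      using m_pos[of "2 ^ (k + N)"] m_pos[of "2 ^ (Suc k + N)"] by (simp add: a_def field_simps)
  qed
  define K where "K k j = (if real j \<le> a k then real j / a k else 0)" for k j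
  have "summable (\<lambda>k. \<Sum>j\<in>{1..<returns (k + N)}. \<psi> j / real j * K k j)"
  proof (rule summable_kernel_sum[where C = "(4 / 3) / (4 / 3 - 1)"])
    show "(\<Sum>k<n. K k j) \<le> 4 / 3 / (4 / 3 - 1)" for n j
      unfolding K_def by (rule geometric_sum_recip_le) (use a_pos growth in auto)
  qed (use \<psi> a_pos in \<open>auto simp: K_def intro!: divide_nonneg_pos\<close>)
  then have "summable (\<lambda>k. (\<Sum>j<returns (k + N). \<psi> j) / real (returns (k + N)))"
  proof (rule summable_comparison_test[rotated], intro exI allI impI)
    fix k
    have le: "a k \<le> real (returns (k + N))" using returns_ge[of "k + N"] by (simp add: a_def)
    have "(\<Sum>j<returns (k + N). \<psi> j) / real (returns (k + N)) \<le> (\<Sum>j<returns (k + N). \<psi> j) / a k"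
      using le a_pos[of k] \<psi> by (intro divide_left_mono sum_nonneg mult_pos_pos) auto
    also have "\<dots> = (\<Sum>j\<in>{1..<returns (k + N)}. \<psi> j) / a k"
    proof -
      have "(\<Sum>j<returns (k + N). \<psi> j) = (\<Sum>j\<in>{1..<returns (k + N)}. \<psi> j)"
        by (rule sum.mono_neutral_right) (use \<psi>(2) in \<open>auto simp: not_le\<close>)
      then show ?thesis by simp
    qed
    also have "\<dots> = (\<Sum>j\<in>{1..<returns (k + N)}. \<psi> j / real j * K k j)"
      unfolding sum_divide_distrib
    proof (rule sum.cong[OF refl])
      fix j assume j: "j \<in> {1..<returns (k + N)}"
      have "real j \<le> a k"
        using j unfolding returns_def a_def by simp linarith
      then show "\<psi> j / a k = \<psi> j / real j * K k j" using j by (simp add: K_def)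
    qed
    finally show "norm ((\<Sum>j<returns (k + N). \<psi> j) / real (returns (k + N))) \<le>
        (\<Sum>j\<in>{1..<returns (k + N)}. \<psi> j / real j * K k j)"
      using \<psi> by (simp add: sum_nonneg)
  qed
  then show ?thesis by (subst (asm) summable_iff_shift)
qed

end

lemma sum_min_levels:
  fixes f :: "nat \<Rightarrow> real"
  shows "(\<Sum>l<a. if l < c then f l else 0) = (\<Sum>l<min a c. f l)"
  by (rule sum.mono_neutral_cong_right) auto

context level_observable
begin

text \<open>Apply \<open>sum_hitting_time\<close> to the indicator of the levels from
  \<open>d\<close> on: its sum over the \<open>n\<close> excursions vanishes, and so does each
  term.\<close>

lemma hitting_time_less_return_time:
  assumes x: "x \<in> E" and i: "i < (\<Sum>j<n. \<phi> ((S ^^ j) x))" and d: "\<And>j. j < n \<Longrightarrow> \<phi> ((S ^^ j) x) \<le> d"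
  shows "hitting_time T E ((T ^^ i) x) < d"
proof (rule ccontr)
  assume ge: "\<not> hitting_time T E ((T ^^ i) x) < d"
  define f :: "nat \<Rightarrow> real" where "f l = (if d \<le> l then 1 else 0)" for l
  have "(\<Sum>i<(\<Sum>j<n. \<phi> ((S ^^ j) x)). f (hitting_time T E ((T ^^ i) x))) = (\<Sum>j<n. \<Sum>l<\<phi> ((S ^^ j) x). f l)"
    by (rule sum_hitting_time[OF x])
  also have "\<dots> = 0" using d by (intro sum.neutral ballI) (fastforce simp: f_def)
  finally have "f (hitting_time T E ((T ^^ i) x)) = 0"
    using i by (subst (asm) sum_nonneg_eq_0_iff) (auto simp: f_def)
  then show False using ge by (simp add: f_def)
qed

text \<open>
  The points of the orbit whose hitting time lies in \<open>[c, d]\<close> contribute about \<open>\<Lambda>\<close> each,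
  whether they belong to a small, a large or the last, incomplete excursion.
\<close>
lemma birkhoff_sum_estimate:
  fixes f :: "'a \<Rightarrow> real" and \<gamma>' :: "nat \<Rightarrow> real" and \<Lambda> :: real
  assumes x: "x \<in> E" and N: "N \<le> (\<Sum>j<n. \<phi> ((S ^^ j) x))"
    and d: "\<And>j. j < n \<Longrightarrow> \<phi> ((S ^^ j) x) \<le> d"
    and f0: "\<And>i. 0 \<le> f ((T ^^ i) x)"
    and f: "\<And>i. \<gamma>' (hitting_time T E ((T ^^ i) x)) \<le> f ((T ^^ i) x)"
           "\<And>i. f ((T ^^ i) x) \<le> \<gamma> (hitting_time T E ((T ^^ i) x))"
    and \<Lambda>: "0 \<le> \<Lambda>" and e: "0 \<le> e"
    and near: "\<And>l. \<lbrakk>c \<le> l; l \<le> d\<rbrakk> \<Longrightarrow> \<bar>\<gamma> l - \<Lambda>\<bar> \<le> e * \<Lambda> \<and> \<bar>\<gamma>' l - \<Lambda>\<bar> \<le> e * \<Lambda>"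
  shows "\<bar>(\<Sum>i<N. f ((T ^^ i) x)) - real N * \<Lambda>\<bar> \<le> e * real N * \<Lambda> +
    (\<Sum>j<n. \<Sum>l<min (\<phi> ((S ^^ j) x)) c. \<gamma> l) + \<Lambda> * (\<Sum>j<n. real (min (\<phi> ((S ^^ j) x)) c))"
proof -
  define s where "s = (\<Sum>j<n. \<phi> ((S ^^ j) x))"
  define h where "h i = hitting_time T E ((T ^^ i) x)" for i
  \<comment> \<open>Both \<open>f\<close> and \<open>\<Lambda>\<close> are nonnegative, so below
    \<open>c\<close> their difference is at most \<open>\<gamma> l + \<Lambda>\<close>.\<close>
  define \<beta> where "\<beta> l = (if l < c then \<gamma> l + \<Lambda> else 0)" for l
  have \<beta>0: "0 \<le> \<beta> l" for l using \<gamma>_nonneg[of l] \<Lambda> by (simp add: \<beta>_def)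
  have pointwise: "\<bar>f ((T ^^ i) x) - \<Lambda>\<bar> \<le> e * \<Lambda> + \<beta> (h i)" if i: "i < N" for i
  proof (cases "h i < c")
    case True
    have "0 \<le> e * \<Lambda>" using e \<Lambda> by simp
    moreover have "0 \<le> f ((T ^^ i) x)" "f ((T ^^ i) x) \<le> \<gamma> (h i)" using f0 f unfolding h_def by auto
    ultimately show ?thesis using True \<Lambda> by (simp add: \<beta>_def)
  next
    case False
    have "h i < d"
      unfolding h_def using i N by (intro hitting_time_less_return_time[OF x _ d]) auto
    then have "\<bar>\<gamma> (h i) - \<Lambda>\<bar> \<le> e * \<Lambda> \<and> \<bar>\<gamma>' (h i) - \<Lambda>\<bar> \<le> e * \<Lambda>"
      using False by (intro near) auto
    then show ?thesis using f[of i] False by (simp add: \<beta>_def h_def abs_le_iff)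
  qed
  have "\<bar>(\<Sum>i<N. f ((T ^^ i) x)) - real N * \<Lambda>\<bar> = \<bar>\<Sum>i<N. f ((T ^^ i) x) - \<Lambda>\<bar>"
    by (simp add: sum_subtractf)
  also have "\<dots> \<le> (\<Sum>i<N. \<bar>f ((T ^^ i) x) - \<Lambda>\<bar>)" by (rule sum_abs)
  also have "\<dots> \<le> (\<Sum>i<N. e * \<Lambda> + \<beta> (h i))" by (intro sum_mono pointwise) auto
  also have "\<dots> = e * real N * \<Lambda> + (\<Sum>i<N. \<beta> (h i))" by (simp add: sum.distrib)
  \<comment> \<open>Since \<open>\<beta> \<ge> 0\<close>, the sum may be extended from
    \<open>N\<close> to the end of the \<open>n\<close>-th excursion. This disposes of the
    unfinished excursion.\<close>
  also have "(\<Sum>i<N. \<beta> (h i)) \<le> (\<Sum>i<s. \<beta> (h i))"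
    using N \<beta>0 by (intro sum_mono2) (auto simp: s_def)
  also have "\<dots> = (\<Sum>j<n. \<Sum>l<\<phi> ((S ^^ j) x). \<beta> l)"
    unfolding s_def h_def by (rule sum_hitting_time[OF x])
  also have "\<dots> = (\<Sum>j<n. \<Sum>l<min (\<phi> ((S ^^ j) x)) c. \<gamma> l + \<Lambda>)"
    unfolding \<beta>_def sum_min_levels ..
  also have "\<dots> = (\<Sum>j<n. \<Sum>l<min (\<phi> ((S ^^ j) x)) c. \<gamma> l) + \<Lambda> * (\<Sum>j<n. real (min (\<phi> ((S ^^ j) x)) c))"
    by (simp add: sum.distrib sum_distrib_left mult.commute)
  finally show ?thesis by (simp add: add.assoc)
qed

end

lemma dyadic_scale:
  obtains \<kappa> :: "nat \<Rightarrow> nat" where "\<And>N. N \<le> 2 ^ \<kappa> N" "\<And>N. 1 \<le> N \<Longrightarrow> 2 ^ \<kappa> N \<le> 2 * N"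
    "filterlim \<kappa> at_top sequentially"
proof -
  define \<kappa> where "\<kappa> N = (LEAST k. N \<le> 2 ^ k)" for N :: nat
  have 1: "N \<le> 2 ^ \<kappa> N" for N
    unfolding \<kappa>_def by (rule LeastI[of _ N]) (simp add: less_imp_le)
  have 2: "2 ^ \<kappa> N \<le> 2 * N" if "1 \<le> N" for N
  proof (cases "\<kappa> N")
    case 0
    then show ?thesis using that by simp
  next
    case (Suc k)
    then have "\<not> N \<le> 2 ^ k"
      unfolding \<kappa>_def using not_less_Least[of k "\<lambda>k. N \<le> 2 ^ k"] by simp
    then show ?thesis using Suc by simp
  qed
  have "filterlim \<kappa> at_top sequentially"
    unfolding filterlim_at_top
  proof
    fix Z :: nat
    have "Z \<le> \<kappa> N" if "2 ^ Z \<le> N" for N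
    proof -
      have "(2::nat) ^ Z \<le> 2 ^ \<kappa> N" using that 1[of N] by linarith
      then show ?thesis by simp
    qed
    then show "\<forall>\<^sub>F N in sequentially. Z \<le> \<kappa> N" by (rule eventually_sequentiallyI)
  qed
  with 1 2 show ?thesis by (rule that)
qed

section \<open>Almost sure asymptotics of the Birkhoff sums\<close>

context level_observable
begin

text \<open>
  The levels \<open>c k\<close> below which an excursion counts as small are chosen such that the small
  excursions carry only the fraction \<open>\<eta>\<close> of the truncated mean; the level \<open>c0 k\<close> only serves
  to bound the number of returns up to time \<open>2 ^ k\<close>.
\<close>
lemma AE_birkhoff_sum_close:
  fixes f :: "'a \<Rightarrow> real" and \<gamma>' L :: "nat \<Rightarrow> real"
  assumes mix: "mixing_tails P (\<lambda>n x. \<phi> ((S ^^ n) x)) p \<psi> K" "\<psi> 0 = 0" "summable (\<lambda>n. \<psi> n / real n)"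
    and L: "\<forall>\<^sub>F n in sequentially. 0 < L n" and form: "\<And>n. 1 \<le> n \<Longrightarrow> G n = real n * L n"
    and \<gamma>: "(\<lambda>n. \<gamma> n / L n) \<longlonglongrightarrow> 1" and \<gamma>': "(\<lambda>n. \<gamma>' n / L n) \<longlonglongrightarrow> 1"
    and F: "(\<lambda>n. F n / (L n * m n)) \<longlonglongrightarrow> 1"
    and sq: "summable (\<lambda>n. real n * (p n)\<^sup>2 / (m n)\<^sup>2)"
    and orbit: "AE x in M. \<forall>i. 0 \<le> f ((T ^^ i) x) \<and> \<gamma>' (hitting_time T E ((T ^^ i) x)) \<le> f ((T ^^ i) x) \<and>
        f ((T ^^ i) x) \<le> \<gamma> (hitting_time T E ((T ^^ i) x))"
    and \<epsilon>: "0 < \<epsilon>" "\<epsilon> \<le> 1"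
  shows "AE x in P. \<forall>\<^sub>F N in sequentially. \<bar>(\<Sum>i<N. f ((T ^^ i) x)) - G N\<bar> \<le> \<epsilon> * G N"
proof -
  interpret X: mixing_tails P "\<lambda>n x. \<phi> ((S ^^ n) x)" p \<psi> K by (rule mix(1))
  interpret ts: tail_sequence p
    by unfold_locales
       (use p_pos p_antimono p_le_1 sum_p_at_top sq in \<open>auto simp: m_def\<close>)
  have ts_m: "ts.m = m" by (simp add: fun_eq_iff ts.m_def m_def)
  note ts = ts.lower_level[unfolded ts_m] ts.upper_level[unfolded ts_m]
  have m_mono: "i \<le> j \<Longrightarrow> m i \<le> m j" for i j using ts.m_mono[unfolded ts_m] .
  have double: "\<forall>\<^sub>F n in sequentially. m (2 * n) \<le> 3 / 2 * m n"
    using ts.eventually_m_double_le[unfolded ts_m] .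
  have avg: "summable (\<lambda>k. (\<Sum>j<returns k. \<psi> j) / real (returns k))"
    by (rule summable_average) (use mix X.\<psi>_nonneg double in auto)
  \<comment> \<open>The final error is \<open>\<epsilon> / 2 + 384 * \<eta>\<close>, so any
    \<open>\<eta>\<close> up to \<open>\<epsilon> / 768\<close> would do.\<close>
  define \<eta> where "\<eta> = \<epsilon> / 2000"
  have \<eta>: "0 < \<eta>" "\<eta> \<le> 1 / 2" using \<epsilon> by (auto simp: \<eta>_def)
  obtain c0 :: "nat \<Rightarrow> nat" where c0: "summable (\<lambda>k. real (c0 k) / 2 ^ k)"
    "\<forall>\<^sub>F k in sequentially. 1 / 2 * m (2 ^ k) \<le> m (c0 k) \<and> m (c0 k) \<le> 2 * (1 / 2) * m (2 ^ k)"
    by (rule ts(1)[of "1 / 2"]) auto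
  obtain c :: "nat \<Rightarrow> nat" where c: "summable (\<lambda>k. real (c k) / 2 ^ k)"
    "\<forall>\<^sub>F k in sequentially. \<eta> * m (2 ^ k) \<le> m (c k) \<and> m (c k) \<le> 2 * \<eta> * m (2 ^ k)"
    "filterlim c at_top sequentially"
    by (rule ts(1)[OF \<eta>])
  obtain d :: "nat \<Rightarrow> nat" where d: "summable (\<lambda>k. 2 ^ k / real (d k))"
    "\<forall>\<^sub>F k in sequentially. 2 ^ k \<le> d k \<and> m (d k) \<le> 3 * m (2 ^ k)"
    by (rule ts(2))
  define D :: "nat \<Rightarrow> real" where "D k = m (2 ^ k)" for k
  have D: "0 < D k" for k using m_pos by (simp add: D_def)
  have n_ge: "8 * 2 ^ k \<le> real (returns k) * D k" for k
    using returns_ge[of k] D[of k] by (simp add: D_def field_simps)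
  have n_le: "real (returns k) * D k \<le> 16 * 2 ^ k" for k
    using returns_le[of k] D[of k] by (simp add: D_def field_simps)
  \<comment> \<open>The product \<open>returns k * m (b k)\<close> is at least
    \<open>8 * t * 2 ^ k\<close>, so the close-pair term in Chebyshev's inequality is dominated by
    the summable \<open>b k / 2 ^ k\<close>.\<close>
  have level_summable: "summable (\<lambda>k. real (b k) / (real (returns k) * m (b k)))"
    if "summable (\<lambda>k. real (b k) / 2 ^ k)" "\<forall>\<^sub>F k in sequentially. t * m (2 ^ k) \<le> m (b k)" "0 < t" for b t
  proof (rule summable_comparison_test_ev)
    show "summable (\<lambda>k. 1 / (8 * t) * (real (b k) / 2 ^ k))" by (intro summable_mult that)
    show "\<forall>\<^sub>F k in sequentially. norm (real (b k) / (real (returns k) * m (b k))) \<le> 1 / (8 * t) * (real (b k) / 2 ^ k)"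
      using that(2)
    proof eventually_elim
      case (elim k)
      have "8 * 2 ^ k * t \<le> (real (returns k) * D k) * t" using n_ge that(3) by (intro mult_right_mono) auto
      also have "\<dots> = real (returns k) * (t * D k)" by simp
      also have "\<dots> \<le> real (returns k) * m (b k)" using elim by (intro mult_left_mono) (auto simp: D_def)
      finally have le: "8 * 2 ^ k * t \<le> real (returns k) * m (b k)" .
      have "real (b k) / (real (returns k) * m (b k)) \<le> real (b k) / (8 * 2 ^ k * t)"
        using le that(3) by (intro divide_left_mono) (auto intro!: mult_pos_pos less_le_trans[OF _ le])
      then show ?case using ts.m_nonneg[unfolded ts_m, of "b k"] by (simp add: mult_ac)
    qed
  qed
  have concentrated: "AE x in P. \<forall>\<^sub>F k in sequentially.
      \<bar>(\<Sum>i<returns k. real (min (\<phi> ((S ^^ i) x)) (b k))) - real (returns k) * m (b k)\<bar> < real (returns k) * m (b k) / 2"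
    if "summable (\<lambda>k. real (b k) / 2 ^ k)" "\<forall>\<^sub>F k in sequentially. t * m (2 ^ k) \<le> m (b k)" "0 < t" for b t
  proof -
    have "\<forall>\<^sub>F k in sequentially. 0 < returns k \<and> 0 < (\<Sum>l<b k. 1 * p l)"
      using that(2)
    proof eventually_elim
      case (elim k)
      have "0 < t * m (2 ^ k)" using that(3) D[of k] by (simp add: D_def)
      then show ?case using elim returns_pos by (simp add: m_def)
    qed
    then show ?thesis
      using X.AE_eventually_concentrated[of "\<lambda>_. 1" returns b] level_summable[OF that] avg
      by (simp add: m_def)
  qed
  \<comment> \<open>\<open>E1\<close> bounds the time taken by the returns from below,
    \<open>E2\<close> and \<open>E3\<close> bound the number and the \<open>\<gamma>\<close>-weight
    of the points with hitting time below \<open>c k\<close>, and \<open>E4\<close> bounds all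
    excursions by \<open>d k\<close>.\<close>
  have E1: "AE x in P. \<forall>\<^sub>F k in sequentially.
      \<bar>(\<Sum>i<returns k. real (min (\<phi> ((S ^^ i) x)) (c0 k))) - real (returns k) * m (c0 k)\<bar> < real (returns k) * m (c0 k) / 2"
    by (rule concentrated[OF c0(1), of "1 / 2"]) (use c0(2) in \<open>auto elim: eventually_mono\<close>)
  have E2: "AE x in P. \<forall>\<^sub>F k in sequentially.
      \<bar>(\<Sum>i<returns k. real (min (\<phi> ((S ^^ i) x)) (c k))) - real (returns k) * m (c k)\<bar> < real (returns k) * m (c k) / 2"
    by (rule concentrated[OF c(1), of \<eta>]) (use c(2) \<eta> in \<open>auto elim: eventually_mono\<close>)
  have c_ev: "\<forall>\<^sub>F k in sequentially. Q (c k)" if "eventually Q sequentially" for Q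
    using c(3) that by (rule eventually_compose_filterlim[rotated])
  have c_pos: "\<forall>\<^sub>F k in sequentially. 1 \<le> c k \<and> 0 < L (c k) \<and> F (c k) \<le> 2 * (L (c k) * m (c k)) \<and>
      L (c k) * m (c k) \<le> 2 * F (c k)"
  proof (rule c_ev)
    have "\<forall>\<^sub>F n in sequentially. F n / (L n * m n) < 2" "\<forall>\<^sub>F n in sequentially. 1 / 2 < F n / (L n * m n)"
      by (rule order_tendstoD[OF F], simp)+
    then show "\<forall>\<^sub>F n in sequentially. 1 \<le> n \<and> 0 < L n \<and> F n \<le> 2 * (L n * m n) \<and> L n * m n \<le> 2 * F n"
      using L eventually_ge_at_top[of 1]
    proof eventually_elim
      case (elim n)
      then have "0 < L n * m n" using m_pos[of n] by simp
      then show ?case using elim by (simp add: field_simps)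
    qed
  qed
  have E3: "AE x in P. \<forall>\<^sub>F k in sequentially.
      \<bar>(\<Sum>i<returns k. \<Sum>l<min (\<phi> ((S ^^ i) x)) (c k). \<gamma> l) - real (returns k) * F (c k)\<bar> < real (returns k) * F (c k) / 2"
  proof (rule X.AE_eventually_concentrated[of \<gamma> returns c, folded F_def, OF \<gamma>_nonneg _ _ avg])
    show "\<forall>\<^sub>F k in sequentially. 0 < returns k \<and> 0 < F (c k)"
      using c_pos
    proof eventually_elim
      case (elim k)
      then have "0 < L (c k) * m (c k)" using m_pos[of "c k"] by simp
      then show ?case using elim returns_pos by simp
    qed
    show "summable (\<lambda>k. (\<Sum>l<c k. \<gamma> l) / (real (returns k) * F (c k)))"
    proof (rule summable_comparison_test_ev)
      show "summable (\<lambda>k. 2 * (real (c k) / (real (returns k) * m (c k))))"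
        by (intro summable_mult level_summable[OF c(1), of \<eta>]) (use c(2) \<eta> in \<open>auto elim: eventually_mono\<close>)
      show "\<forall>\<^sub>F k in sequentially. norm ((\<Sum>l<c k. \<gamma> l) / (real (returns k) * F (c k))) \<le>
          2 * (real (c k) / (real (returns k) * m (c k)))"
        using c_pos
      proof eventually_elim
        case (elim k)
        have pos: "0 < L (c k)" "0 < m (c k)" "0 < real (returns k)" using elim m_pos[of "c k"] returns_pos by auto
        have "(\<Sum>l<c k. \<gamma> l) = real (c k) * L (c k)" using form[of "c k"] elim by (simp add: G_eq)
        then have "(\<Sum>l<c k. \<gamma> l) / (real (returns k) * F (c k)) = real (c k) * L (c k) / (real (returns k) * F (c k))"
          by simp
        also have "\<dots> \<le> real (c k) * L (c k) / (real (returns k) * (L (c k) * m (c k) / 2))"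
          using elim pos by (intro divide_left_mono mult_left_mono mult_pos_pos) (auto intro: less_le_trans[of _ "L (c k) * m (c k) / 2"])
        also have "\<dots> = 2 * (real (c k) / (real (returns k) * m (c k)))"
          using pos by simp
        finally show ?case using \<gamma>_nonneg F_nonneg[of "c k"] by (simp add: sum_nonneg)
      qed
    qed
  qed
  have E4: "AE x in P. \<forall>\<^sub>F k in sequentially. \<forall>i<returns k. \<phi> ((S ^^ i) x) \<le> d k"
  proof (rule X.AE_eventually_max_le, rule summable_comparison_test_ev)
    \<comment> \<open>Monotonicity of \<open>p\<close> gives
      \<open>p (d k) \<le> m (d k) / d k\<close>. The factor \<open>3\<close> from
      \<open>m (d k)\<close> and \<open>16\<close> from the number of returns make
      \<open>48\<close>.\<close>
    show "summable (\<lambda>k. 48 * (2 ^ k / real (d k)))" by (intro summable_mult d)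
    show "\<forall>\<^sub>F k in sequentially. norm (real (returns k) * p (d k)) \<le> 48 * (2 ^ k / real (d k))"
      using d(2)
    proof eventually_elim
      case (elim k)
      have dk: "0 < real (d k)" using elim by (metis less_le_trans of_nat_0_less_iff zero_less_numeral zero_less_power)
      have "real (d k) * p (d k) = (\<Sum>j<d k. p (d k))" by simp
      also have "\<dots> \<le> m (d k)" unfolding m_def using antimonoD[OF p_antimono] by (intro sum_mono) auto
      also have "\<dots> \<le> 3 * D k" using elim by (simp add: D_def)
      finally have "p (d k) \<le> 3 * D k / real (d k)" using dk by (simp add: field_simps)
      then have "real (returns k) * p (d k) \<le> real (returns k) * (3 * D k / real (d k))" by (intro mult_left_mono) auto
      also have "\<dots> = 3 * (real (returns k) * D k) / real (d k)" by simp
      also have "\<dots> \<le> 3 * (16 * 2 ^ k) / real (d k)" using n_le[of k] by (intro divide_right_mono mult_left_mono) auto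
      finally show ?case using p_nonneg by simp
    qed
  qed
  \<comment> \<open>For \<open>c k \<le> l \<le> d k\<close>, \<open>m l\<close> is at most
    \<open>3 * D k \<le> 9 / 2 * m N\<close>, whence \<open>5\<close>, and at least
    \<open>\<eta> * D k \<ge> \<eta> * m N\<close>, whence \<open>1 / \<eta>\<close>.\<close>
  define r where "r = max 5 (1 / \<eta>)"
  have r: "1 \<le> r" "5 \<le> r" "1 / \<eta> \<le> r" by (auto simp: r_def)
  have LL: "(\<lambda>n. L n / L n) \<longlonglongrightarrow> 1"
    by (rule Lim_transform_eventually[OF tendsto_const]) (use L in \<open>auto elim: eventually_mono\<close>)
  note const = ts.almost_constant[unfolded ts_m, OF L _ \<gamma> _ LL r(1), folded F_def, OF F]
  have \<epsilon>2: "0 < \<epsilon> / 2" using \<epsilon> by simp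
  obtain N1 where N1: "\<And>x y. \<lbrakk>N1 \<le> x; N1 \<le> y; m x \<le> r * m y; m y \<le> r * m x\<rbrakk> \<Longrightarrow> \<bar>\<gamma> x - L y\<bar> \<le> \<epsilon> / 2 * L y"
    using const[OF \<gamma> \<epsilon>2] by blast
  obtain N2 where N2: "\<And>x y. \<lbrakk>N2 \<le> x; N2 \<le> y; m x \<le> r * m y; m y \<le> r * m x\<rbrakk> \<Longrightarrow> \<bar>\<gamma>' x - L y\<bar> \<le> \<epsilon> / 2 * L y"
    using const[OF \<gamma>' \<epsilon>2] by blast
  obtain N3 where N3: "\<And>x y. \<lbrakk>N3 \<le> x; N3 \<le> y; m x \<le> r * m y; m y \<le> r * m x\<rbrakk> \<Longrightarrow> \<bar>L x - L y\<bar> \<le> \<epsilon> / 2 * L y"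
    using const[OF LL \<epsilon>2] by blast
  define N0 where "N0 = Max {N1, N2, N3}"
  obtain \<kappa> :: "nat \<Rightarrow> nat" where \<kappa>: "\<And>N. N \<le> 2 ^ \<kappa> N" "\<And>N. 1 \<le> N \<Longrightarrow> 2 ^ \<kappa> N \<le> 2 * N"
    "filterlim \<kappa> at_top sequentially"
    using dyadic_scale by blast
  have \<kappa>_ev: "\<forall>\<^sub>F N in sequentially. Q (\<kappa> N)" if "eventually Q sequentially" for Q
    using \<kappa>(3) that by (rule eventually_compose_filterlim[rotated])
  have orbit': "AE x in P. \<forall>i. 0 \<le> f ((T ^^ i) x) \<and> \<gamma>' (hitting_time T E ((T ^^ i) x)) \<le> f ((T ^^ i) x) \<and>
        f ((T ^^ i) x) \<le> \<gamma> (hitting_time T E ((T ^^ i) x))"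
    using orbit E_sets by (subst AE_restrict_space_iff) (auto elim: eventually_mono)
  show ?thesis
    using E1 E2 E3 E4 orbit' AE_space
  proof eventually_elim
    case (elim x)
    have "x \<in> E" using elim(6) by simp
    note orb = elim(5)
    have c_large: "\<forall>\<^sub>F k in sequentially. N0 \<le> c k" using c(3) by (simp add: filterlim_at_top)
    show ?case
      using \<kappa>_ev[OF elim(1)] \<kappa>_ev[OF elim(2)] \<kappa>_ev[OF elim(3)] \<kappa>_ev[OF elim(4)]
        \<kappa>_ev[OF c0(2)] \<kappa>_ev[OF c(2)] \<kappa>_ev[OF d(2)] \<kappa>_ev[OF c_pos] \<kappa>_ev[OF c_large]
        double L eventually_ge_at_top[of "max 1 N0"]
    proof eventually_elim
      case (elim N)
      define k n where "k = \<kappa> N" and "n = returns k"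
      note ev = elim[folded k_def, folded n_def]
      have N: "1 \<le> N" "N0 \<le> N" using ev(12) by auto
      have L: "0 < L N" by (rule ev(11))
      have k1: "real N \<le> 2 ^ k" and k2: "2 ^ k \<le> 2 * real N"
        using \<kappa>(1)[of N] \<kappa>(2)[OF N(1)] unfolding k_def
        by (metis of_nat_le_iff of_nat_numeral of_nat_power, metis of_nat_le_iff of_nat_mult of_nat_numeral of_nat_power)
      have mN: "m N \<le> D k" "D k \<le> 3 / 2 * m N" "0 < m N"
      proof -
        show "m N \<le> D k" unfolding D_def k_def by (rule m_mono[OF \<kappa>(1)])
        have "D k \<le> m (2 * N)" unfolding D_def k_def by (rule m_mono[OF \<kappa>(2)[OF N(1)]])
        then show "D k \<le> 3 / 2 * m N" using ev(10) by linarith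
        show "0 < m N" using N by (intro m_pos) simp
      qed
      note nD = n_ge[of k, folded n_def] n_le[of k, folded n_def]
      \<comment> \<open>From \<open>8 * 2 ^ k\<close>, the level \<open>c0 k\<close> and the
        deviation each cost a factor \<open>2\<close>; the remaining \<open>2 * 2 ^ k\<close>
        exceeds \<open>N\<close>.\<close>
      have returns: "N \<le> (\<Sum>j<n. \<phi> ((S ^^ j) x))"
      proof -
        have "real n * (1 / 2 * D k) \<le> real n * m (c0 k)"
          using ev(5) by (intro mult_left_mono) (auto simp: D_def)
        then have "real n * D k / 2 \<le> real n * m (c0 k)" by simp
        moreover have "real n * m (c0 k) / 2 < (\<Sum>i<n. real (min (\<phi> ((S ^^ i) x)) (c0 k)))"
          using ev(1) by linarith
        ultimately have "real N \<le> (\<Sum>i<n. real (min (\<phi> ((S ^^ i) x)) (c0 k)))"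
          using nD(1) k1 by linarith
        also have "\<dots> \<le> (\<Sum>i<n. real (\<phi> ((S ^^ i) x)))" by (intro sum_mono) auto
        finally have "real N \<le> real (\<Sum>j<n. \<phi> ((S ^^ j) x))" by simp
        then show ?thesis by (simp only: of_nat_le_iff)
      qed
      have ratio: "m l \<le> r * m N" "m N \<le> r * m l" if l: "c k \<le> l" "m l \<le> 3 * D k" for l
      proof -
        have "5 * m N \<le> r * m N" using r mN by (intro mult_right_mono) auto
        then show "m l \<le> r * m N" using l mN by linarith
        have "\<eta> * D k \<le> m l" using ev(6) m_mono[OF l(1)] by (simp add: D_def)
        then have "m N \<le> 1 / \<eta> * m l" using \<eta> mN(1) by (simp add: field_simps) (meson mult_left_mono less_imp_le order_trans)
        also have "\<dots> \<le> r * m l"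
          using r ts.m_nonneg[unfolded ts_m, of l] by (intro mult_right_mono) auto
        finally show "m N \<le> r * m l" .
      qed
      have N0: "N1 \<le> N" "N2 \<le> N" "N3 \<le> N" "N1 \<le> c k" "N2 \<le> c k" "N3 \<le> c k"
        using N ev(9) by (simp_all add: N0_def)
      have near: "\<bar>\<gamma> l - L N\<bar> \<le> \<epsilon> / 2 * L N \<and> \<bar>\<gamma>' l - L N\<bar> \<le> \<epsilon> / 2 * L N" if l: "c k \<le> l" "l \<le> d k" for l
      proof -
        have "m l \<le> 3 * D k" using m_mono[OF l(2)] ev(7) by (simp add: D_def)
        note rat = ratio[OF l(1) this]
        show ?thesis using N1[OF _ _ rat] N2[OF _ _ rat] N0 l by auto
      qed
      have Lc: "L (c k) \<le> 3 / 2 * L N"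
      proof -
        have "m (c k) \<le> 2 * \<eta> * D k" using ev(6) by (simp add: D_def)
        also have "\<dots> \<le> 3 * D k" using \<eta> D[of k] by (intro mult_right_mono) auto
        finally have "m (c k) \<le> 3 * D k" .
        note rat = ratio[OF order_refl this]
        have "\<bar>L (c k) - L N\<bar> \<le> \<epsilon> / 2 * L N" using N3[OF _ _ rat] N0 by auto
        moreover have "\<epsilon> / 2 * L N \<le> 1 / 2 * L N" using \<epsilon> L by (intro mult_right_mono) auto
        ultimately show ?thesis by linarith
      qed
      have mc: "real n * m (c k) \<le> 2 * \<eta> * (16 * 2 ^ k)"
      proof -
        have "real n * m (c k) \<le> real n * (2 * \<eta> * D k)" using ev(6) by (intro mult_left_mono) (auto simp: D_def)
        also have "\<dots> = 2 * \<eta> * (real n * D k)" by simp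
        also have "\<dots> \<le> 2 * \<eta> * (16 * 2 ^ k)" using nD \<eta> by (intro mult_left_mono) auto
        finally show ?thesis .
      qed
      \<comment> \<open>\<open>64 = 2 * 16 * 2\<close>, from the choice of \<open>c\<close>, the
        number of returns and \<open>2 ^ k \<le> 2 * N\<close>. The deviation adds a factor
        \<open>3 / 2\<close> (hence \<open>96\<close>); in the \<open>\<gamma>\<close>-weighted sum,
        \<open>F \<le> 2 * L * m\<close> and \<open>L (c k) \<le> 3 / 2 * L N\<close> add a further
        factor \<open>3\<close> (hence \<open>288\<close>).\<close>
      have mc': "real n * m (c k) \<le> 64 * \<eta> * real N"
      proof -
        have "2 * \<eta> * (16 * 2 ^ k) \<le> 2 * \<eta> * (16 * (2 * real N))" using k2 \<eta> by (intro mult_left_mono) auto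
        then show ?thesis using mc by simp
      qed
      have small1: "(\<Sum>j<n. real (min (\<phi> ((S ^^ j) x)) (c k))) \<le> 96 * \<eta> * real N"
        using ev(2) mc' by linarith
      have small2: "(\<Sum>j<n. \<Sum>l<min (\<phi> ((S ^^ j) x)) (c k). \<gamma> l) \<le> 288 * \<eta> * real N * L N"
      proof -
        have "(\<Sum>j<n. \<Sum>l<min (\<phi> ((S ^^ j) x)) (c k). \<gamma> l) \<le> 3 / 2 * (real n * F (c k))"
          using ev(3) by linarith
        also have "\<dots> \<le> 3 / 2 * (real n * (2 * (L (c k) * m (c k))))"
          using ev(8) by (intro mult_left_mono) auto
        also have "\<dots> = 3 * (L (c k) * (real n * m (c k)))" by simp
        also have "\<dots> \<le> 3 * ((3 / 2 * L N) * (64 * \<eta> * real N))"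
          using L ts.m_nonneg[unfolded ts_m, of "c k"] by (intro mult_left_mono[OF mult_mono[OF Lc mc']]) auto
        finally show ?thesis by (simp add: mult_ac)
      qed
      have est: "\<bar>(\<Sum>i<N. f ((T ^^ i) x)) - real N * L N\<bar> \<le> \<epsilon> / 2 * real N * L N +
          (\<Sum>j<n. \<Sum>l<min (\<phi> ((S ^^ j) x)) (c k). \<gamma> l) + L N * (\<Sum>j<n. real (min (\<phi> ((S ^^ j) x)) (c k)))"
        by (rule birkhoff_sum_estimate[OF \<open>x \<in> E\<close> returns, where d = "d k" and \<gamma>' = \<gamma>'])
           (use ev(4) orb L \<epsilon> near in auto)
      have "L N * (\<Sum>j<n. real (min (\<phi> ((S ^^ j) x)) (c k))) \<le> L N * (96 * \<eta> * real N)"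
        using small1 L by (intro mult_left_mono) auto
      then have "\<bar>(\<Sum>i<N. f ((T ^^ i) x)) - real N * L N\<bar> \<le> (\<epsilon> / 2 + 384 * \<eta>) * (real N * L N)"
        using est small2 by (simp add: algebra_simps)
      also have "\<dots> \<le> \<epsilon> * (real N * L N)"
        using L \<epsilon> by (intro mult_right_mono) (auto simp: \<eta>_def)
      finally show ?case using form[OF N(1)] by simp
    qed
  qed
qed

lemma \<gamma>_eq_diff: "\<gamma> n = G (Suc n) - G n" by (simp add: G_eq)

lemma G_shift_ratio:
  assumes GT: "filterlim G at_top sequentially" and \<gamma>G: "(\<lambda>n. \<gamma> n / G n) \<longlonglongrightarrow> 0"
  shows "(\<lambda>n. G n / G (n + k)) \<longlonglongrightarrow> 1"
proof (induction k)
  case 0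
  have "\<forall>\<^sub>F n in sequentially. 0 < G n" using GT by (simp add: filterlim_at_top_dense)
  then have "\<forall>\<^sub>F n in sequentially. 1 = G n / G (n + 0)" by eventually_elim simp
  then show ?case by (rule Lim_transform_eventually[OF tendsto_const])
next
  case (Suc k)
  have pos: "\<forall>\<^sub>F n in sequentially. 0 < G n" using GT by (simp add: filterlim_at_top_dense)
  have "(\<lambda>n. 1 / (1 + \<gamma> n / G n)) \<longlonglongrightarrow> 1 / (1 + 0)"
    by (intro tendsto_divide tendsto_add tendsto_const \<gamma>G) simp
  moreover have "\<forall>\<^sub>F n in sequentially. 1 / (1 + \<gamma> n / G n) = G n / G (Suc n)"
    using pos
  proof eventually_elim
    case (elim n)
    have "1 + \<gamma> n / G n = G (Suc n) / G n" using elim by (simp add: G_eq field_simps)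
    then show ?case by simp
  qed
  ultimately have "(\<lambda>n. G n / G (Suc n)) \<longlonglongrightarrow> 1 / (1 + 0)" by (rule Lim_transform_eventually)
  then have "(\<lambda>n. G (n + k) / G (Suc (n + k))) \<longlonglongrightarrow> 1 / (1 + 0)"
    by (rule LIMSEQ_ignore_initial_segment)
  then have "(\<lambda>n. G n / G (n + k) * (G (n + k) / G (Suc (n + k)))) \<longlonglongrightarrow> 1 * (1 / (1 + 0))"
    by (intro tendsto_mult Suc)
  moreover have "\<forall>\<^sub>F n in sequentially. G n / G (n + k) * (G (n + k) / G (Suc (n + k))) = G n / G (n + Suc k)"
    using pos
  proof eventually_elim
    case (elim n)
    then have "0 < G (n + k)" using G_mono[of n "n + k"] by simp
    then show ?case by simp
  qed
  ultimately have "(\<lambda>n. G n / G (n + Suc k)) \<longlonglongrightarrow> 1 * (1 / (1 + 0))" by (rule Lim_transform_eventually)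
  then show ?case by simp
qed

text \<open>Almost every orbit enters \<open>E\<close>. The finitely many terms before the entrance
  are negligible against \<open>G\<close>, and the time shift is harmless because consecutive values
  of \<open>G\<close> have ratio tending to \<open>1\<close>.\<close>

lemma AE_limit_from_E:
  fixes f :: "'a \<Rightarrow> real"
  assumes lim: "AE x in P. (\<lambda>N. (\<Sum>i<N. f ((T ^^ i) x)) / G N) \<longlonglongrightarrow> 1"
    and GT: "filterlim G at_top sequentially" and \<gamma>G: "(\<lambda>n. \<gamma> n / G n) \<longlonglongrightarrow> 0"
  shows "AE x in M. (\<lambda>N. (\<Sum>i<N. f ((T ^^ i) x)) / G N) \<longlonglongrightarrow> 1"
proof -
  have "AE x in M. x \<in> E \<longrightarrow> (\<lambda>N. (\<Sum>i<N. f ((T ^^ i) x)) / G N) \<longlonglongrightarrow> 1"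
    using lim E_sets by (subst (asm) AE_restrict_space_iff) auto
  then have "AE x in M. \<forall>n. (T ^^ n) x \<in> E \<longrightarrow>
      (\<lambda>N. (\<Sum>i<N. f ((T ^^ i) ((T ^^ n) x))) / G N) \<longlonglongrightarrow> 1"
    by (rule AE_pow)
  then show ?thesis
    using AE_frequently_hits
  proof eventually_elim
    case (elim x)
    from elim(2) obtain k where k: "(T ^^ k) x \<in> E" using frequently_ex by blast
    define B where "B N = (\<Sum>i<N. f ((T ^^ i) ((T ^^ k) x)))" for N
    define C where "C = (\<Sum>i<k. f ((T ^^ i) x))"
    have B: "(\<lambda>N. B N / G N) \<longlonglongrightarrow> 1" using elim(1) k by (auto simp: B_def)
    have split: "(\<Sum>i<N + k. f ((T ^^ i) x)) = C + B N" for N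
    proof -
      have "(\<Sum>i<N + k. f ((T ^^ i) x)) = C + (\<Sum>i\<in>{k..<N + k}. f ((T ^^ i) x))"
        unfolding C_def lessThan_atLeast0 by (rule sum.atLeastLessThan_concat[symmetric]) auto
      also have "(\<Sum>i\<in>{k..<N + k}. f ((T ^^ i) x)) = (\<Sum>i<N. f ((T ^^ (i + k)) x))"
        by (rule sum.reindex_bij_witness[of _ "\<lambda>i. i + k" "\<lambda>i. i - k"]) auto
      finally show ?thesis by (simp add: B_def funpow_add)
    qed
    have "(\<lambda>N. C / G (N + k) + B N / G N * (G N / G (N + k))) \<longlonglongrightarrow> 0 + 1 * 1"
    proof (intro tendsto_add tendsto_mult B G_shift_ratio GT \<gamma>G)
      have "(\<lambda>N. C / G N) \<longlonglongrightarrow> 0" by (rule real_tendsto_divide_at_top[OF tendsto_const GT])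
      then show "(\<lambda>N. C / G (N + k)) \<longlonglongrightarrow> 0" by (rule LIMSEQ_ignore_initial_segment)
    qed
    moreover have "\<forall>\<^sub>F N in sequentially. C / G (N + k) + B N / G N * (G N / G (N + k)) =
        (\<Sum>i<N + k. f ((T ^^ i) x)) / G (N + k)"
    proof -
      have "\<forall>\<^sub>F n in sequentially. 0 < G n" using GT by (simp add: filterlim_at_top_dense)
      then show ?thesis by eventually_elim (simp add: split add_divide_distrib)
    qed
    ultimately have "(\<lambda>N. (\<Sum>i<N + k. f ((T ^^ i) x)) / G (N + k)) \<longlonglongrightarrow> 0 + 1 * 1"
      by (rule Lim_transform_eventually)
    then show ?case by (simp add: LIMSEQ_offset[of _ k])
  qed
qed

end

text \<open>The witness is the induced value of the upper bound \<open>g 2\<close>. Off a null set,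
  \<open>f\<close> induces values between those of \<open>g 1\<close> and \<open>g 2\<close>, whose
  ratio \<open>L 1 / L 2\<close> tends to \<open>1\<close>.\<close>

theorem theorem2p7:
  fixes M :: "'a measure" and T :: "'a \<Rightarrow> 'a" and E :: "'a set"
    and f :: "'a \<Rightarrow> real" and g :: "nat \<Rightarrow> 'a \<Rightarrow> real" and L :: "nat \<Rightarrow> real \<Rightarrow> real"
  assumes sigma_finite: "sigma_finite_measure M"
    and infinite_measure: "emeasure M (space M) = \<infinity>"
    and T_preserving: "preserves_measure M T"
    and T_conservative: "conservative M T"
    and T_ergodic: "ergodic M T"
    and E_sets: "E \<in> sets M"
    and E_measure: "emeasure M E = 1"
    and f_measurable: "f \<in> borel_measurable M"
    and f_nonneg: "\<forall>x\<in>space M. f x \<ge> 0"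
    and f_not_L1: "\<not> integrable M f"
    and i_mixing:
      "psi_mixing (restrict_space M E) (count_space UNIV)
         (\<lambda>n x. return_time T E ((induced_map T E ^^ (n - 1)) x))"
    and i_summable:
      "(\<Sum>n. psi_coeff (restrict_space M E) (count_space UNIV)
                (\<lambda>n x. return_time T E ((induced_map T E ^^ (n - 1)) x)) (Suc n)
              / of_nat (Suc n)) < (\<infinity>::ennreal)"
    and g_nonneg: "\<forall>i\<in>{1,2}. \<forall>x\<in>space M. g i x \<ge> 0"
    and g_levels: "\<forall>i\<in>{1,2}. \<forall>k. g i constant_on hitting_level M T E k"
    and ii_a: "AE x in M. g 1 x \<le> f x \<and> f x \<le> g 2 x"
    and ii_b_slow: "\<forall>i\<in>{1,2}. normalised_slowly_varying (L i)"
    and ii_b_form: "\<forall>i\<in>{1,2}. \<forall>n\<ge>1. induced_value M T E (g i) n = real n * L i (real n)"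
    and ii_b_equiv: "(\<lambda>n. L 1 (real n) / L 2 (real n)) \<longlonglongrightarrow> 1"
    and ii_c:
      "\<forall>i\<in>{1,2}. \<forall>\<xi>' :: nat \<Rightarrow> real.
         (\<exists>c>0. \<forall>\<^sub>F n in sequentially. c \<le> \<xi>' n \<and> \<xi>' n \<le> xi M T E n) \<longrightarrow>
         (\<lambda>n. L i (real n * \<xi>' n) / L i (real n)) \<longlonglongrightarrow> 1"
    and ii_d:
      "\<forall>i\<in>{1,2}. \<exists>y0>0.
         (\<integral>\<^sup>+ y\<in>{y0..}. ennreal
            (y * (measure M (return_ge T E (Gam M T E (g i) y)))\<^sup>2
             / (LBINT t:{0..y}. measure M (return_ge T E (Gam M T E (g i) t)))\<^sup>2) \<partial>lborel) < \<infinity>"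
    and ii_e_slow: "\<forall>i\<in>{1,2}. super_slowly_varying (ell M T E (g i)) (ell M T E (g i))"
    and ii_e_equiv:
      "\<forall>i\<in>{1,2}.
         (\<lambda>N. ell M T E (g i) (alpha M T E N)
              / (L i (real N) * (\<Sum>k=0..N. measure M (return_gt T E k)))) \<longlonglongrightarrow> 1"
  shows
    "\<exists>G :: nat \<Rightarrow> real.
       (\<forall>n. G n \<ge> 0) \<and>
       (\<exists>E'\<in>sets M. E' \<subseteq> E \<and> emeasure M E' = 1 \<and>
          (\<forall>x :: nat \<Rightarrow> 'a. (\<forall>n\<ge>1. x n \<in> return_level T E n \<inter> E') \<longrightarrow>
             (\<lambda>n. induced_obs T E f (x n) / G n) \<longlonglongrightarrow> 1)) \<and>
       (AE x in M. (\<lambda>N. (\<Sum>k=1..N. f ((T ^^ (k - 1)) x)) / G N) \<longlonglongrightarrow> 1)"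
proof -
  interpret recurrent_system M T E
    by unfold_locales (fact T_preserving T_conservative T_ergodic E_sets E_measure infinite_measure)+
  interpret A: level_observable M T E "g 2"
    by unfold_locales (use g_nonneg g_levels in auto)
  interpret B: level_observable M T E "g 1"
    by unfold_locales (use g_nonneg g_levels in auto)
  define \<Lambda> where "\<Lambda> n = L 2 (real n)" for n :: nat
  have form: "A.G n = real n * \<Lambda> n" if "1 \<le> n" for n
    using ii_b_form that by (simp add: \<Lambda>_def)
  have form1: "B.G n = real n * L 1 (real n)" if "1 \<le> n" for n
    using ii_b_form that by simp
  have slow1: "normalised_slowly_varying (L 1)" and slow2: "normalised_slowly_varying (L 2)"
    using ii_b_slow by auto
  have \<Lambda>_pos: "\<forall>\<^sub>F n in sequentially. 0 < \<Lambda> n"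
    using normalised_slowly_varying_increment(1)[OF slow2] by (simp add: \<Lambda>_def)
  have L1_pos: "\<forall>\<^sub>F n in sequentially. 0 < L 1 (real n)"
    using normalised_slowly_varying_increment(1)[OF slow1] .
  have \<gamma>: "(\<lambda>n. A.\<gamma> n / \<Lambda> n) \<longlonglongrightarrow> 1"
  proof (rule Lim_transform_eventually[OF normalised_slowly_varying_increment(2)[OF slow2]])
    show "\<forall>\<^sub>F n in sequentially. (real (Suc n) * L 2 (real (Suc n)) - real n * L 2 (real n)) / L 2 (real n) = A.\<gamma> n / \<Lambda> n"
      using eventually_ge_at_top[of 1]
    proof eventually_elim
      case (elim n)
      have "A.\<gamma> n = A.G (Suc n) - A.G n" by (rule A.\<gamma>_eq_diff)
      then show ?case using form[of n] form[of "Suc n"] elim by (simp add: \<Lambda>_def)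
    qed
  qed
  have "(\<lambda>n. B.\<gamma> n / L 1 (real n)) \<longlonglongrightarrow> 1"
  proof (rule Lim_transform_eventually[OF normalised_slowly_varying_increment(2)[OF slow1]])
    show "\<forall>\<^sub>F n in sequentially. (real (Suc n) * L 1 (real (Suc n)) - real n * L 1 (real n)) / L 1 (real n) = B.\<gamma> n / L 1 (real n)"
      using eventually_ge_at_top[of 1]
    proof eventually_elim
      case (elim n)
      have "B.\<gamma> n = B.G (Suc n) - B.G n" by (rule B.\<gamma>_eq_diff)
      then show ?case using form1[of n] form1[of "Suc n"] elim by simp
    qed
  qed
  \<comment> \<open>Both level sequences are compared with the single scale
    \<open>\<Lambda>\<close>, so that \<open>f\<close>, squeezed between them, is close to
    \<open>\<Lambda>\<close> as well.\<close>
  then have "(\<lambda>n. B.\<gamma> n / L 1 (real n) * (L 1 (real n) / L 2 (real n))) \<longlonglongrightarrow> 1 * 1"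
    by (intro tendsto_mult ii_b_equiv)
  moreover have "\<forall>\<^sub>F n in sequentially. B.\<gamma> n / L 1 (real n) * (L 1 (real n) / L 2 (real n)) = B.\<gamma> n / \<Lambda> n"
    using L1_pos by eventually_elim (simp add: \<Lambda>_def)
  ultimately have "(\<lambda>n. B.\<gamma> n / \<Lambda> n) \<longlonglongrightarrow> 1 * 1" by (rule Lim_transform_eventually)
  then have \<gamma>': "(\<lambda>n. B.\<gamma> n / \<Lambda> n) \<longlonglongrightarrow> 1" by simp
  have "(\<integral>\<^sup>+x. ennreal (f x) \<partial>M) = \<infinity>"
  proof (rule ccontr)
    assume "(\<integral>\<^sup>+x. ennreal (f x) \<partial>M) \<noteq> \<infinity>"
    then have "integrable M f"
      using f_measurable f_nonneg by (intro integrableI_nonneg AE_I2) (auto simp: less_top)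
    then show False using f_not_L1 by simp
  qed
  then have F_top: "filterlim A.F at_top sequentially"
    by (rule A.F_at_top) (use ii_a in \<open>auto elim: eventually_mono\<close>)
  have G_top: "filterlim A.G at_top sequentially" by (rule A.G_at_top[OF F_top])
  have ell_pos: "0 < ell M T E (g 2) x" if "0 < x" for x
    using ii_e_slow that by (auto simp: super_slowly_varying_def)
  have slow: "((\<lambda>x. ell M T E (g 2) (x * ell M T E (g 2) x) / ell M T E (g 2) x) \<longlongrightarrow> 1) at_top"
  proof -
    have "uniform_limit {0..1} (\<lambda>x \<delta>. ell M T E (g 2) (x * ell M T E (g 2) x powr \<delta>) / ell M T E (g 2) x) (\<lambda>_. 1) at_top"
      using ii_e_slow by (auto simp: super_slowly_varying_def)
    then have "((\<lambda>x. ell M T E (g 2) (x * ell M T E (g 2) x powr 1) / ell M T E (g 2) x) \<longlongrightarrow> 1) at_top"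
      by (rule tendsto_uniform_limitI) simp
    moreover have "\<forall>\<^sub>F x in at_top. ell M T E (g 2) (x * ell M T E (g 2) x powr 1) / ell M T E (g 2) x =
        ell M T E (g 2) (x * ell M T E (g 2) x) / ell M T E (g 2) x"
      using eventually_gt_at_top[of 0]
    proof eventually_elim
      case (elim x)
      then show ?case using ell_pos[of x] by simp
    qed
    ultimately show ?thesis by (rule Lim_transform_eventually)
  qed
  have F_asymp: "(\<lambda>n. A.F n / (\<Lambda> n * m n)) \<longlonglongrightarrow> 1"
  proof (rule A.truncated_mean_asymp[OF F_top \<Lambda>_pos form ell_pos slow])
    show "(\<lambda>N. ell M T E (g 2) (alpha M T E N) / (\<Lambda> N * (\<Sum>k=0..N. p k))) \<longlonglongrightarrow> 1"
      using ii_e_equiv by (simp add: \<Lambda>_def p_def)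
  qed
  obtain y0 where y0: "0 < y0"
    "(\<integral>\<^sup>+ y\<in>{y0..}. ennreal
            (y * (measure M (return_ge T E (Gam M T E (g 2) y)))\<^sup>2
             / (LBINT t:{0..y}. measure M (return_ge T E (Gam M T E (g 2) t)))\<^sup>2) \<partial>lborel) < \<infinity>"
    using ii_d by blast
  have sq: "summable (\<lambda>n. real n * (p n)\<^sup>2 / (m n)\<^sup>2)"
    by (rule A.summable_squares[OF A.summable_tail_squares[OF G_top y0] \<Lambda>_pos form \<gamma> F_asymp])
  obtain \<psi> K where mix: "mixing_tails P (\<lambda>n x. \<phi> ((S ^^ n) x)) p \<psi> K" "\<psi> 0 = 0"
    "summable (\<lambda>n. \<psi> n / real n)"
    using mixing_tails_return_times[OF i_mixing i_summable] by blast
  have orbit: "AE x in M. \<forall>i. 0 \<le> f ((T ^^ i) x) \<and> B.\<gamma> (hitting_time T E ((T ^^ i) x)) \<le> f ((T ^^ i) x) \<and>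
        f ((T ^^ i) x) \<le> A.\<gamma> (hitting_time T E ((T ^^ i) x))"
    using AE_pow[OF ii_a] AE_frequently_hits AE_space
  proof eventually_elim
    case (elim x)
    show ?case
    proof
      fix i
      \<comment> \<open>A visit to \<open>E\<close> at or after time \<open>i\<close> is needed,
        since otherwise \<open>T ^^ i\<close> of the point would lie in no hitting level.\<close>
      obtain k where k: "i \<le> k" "(T ^^ k) x \<in> E"
        using elim(2) by (auto simp: frequently_sequentially)
      have sp: "(T ^^ i) x \<in> space M" by (rule pow_space[OF elim(3)])
      have "(T ^^ (k - i)) ((T ^^ i) x) = (T ^^ (k - i + i)) x" by (simp add: funpow_add)
      then have "(T ^^ (k - i)) ((T ^^ i) x) \<in> E" using k by simp
      then have lev: "(T ^^ i) x \<in> hitting_level M T E (hitting_time T E ((T ^^ i) x))"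
        using sp unfolding hitting_level_def by blast
      show "0 \<le> f ((T ^^ i) x) \<and> B.\<gamma> (hitting_time T E ((T ^^ i) x)) \<le> f ((T ^^ i) x) \<and>
        f ((T ^^ i) x) \<le> A.\<gamma> (hitting_time T E ((T ^^ i) x))"
        using elim(1) f_nonneg sp A.h_eq[OF lev] B.h_eq[OF lev] by metis
    qed
  qed
  have "AE x in P. \<forall>q. \<forall>\<^sub>F N in sequentially.
      \<bar>(\<Sum>i<N. f ((T ^^ i) x)) - A.G N\<bar> \<le> 1 / real (Suc q) * A.G N"
    unfolding AE_all_countable
    by (intro allI A.AE_birkhoff_sum_close[OF mix \<Lambda>_pos form \<gamma> \<gamma>' F_asymp sq orbit]) auto
  then have "AE x in P. (\<lambda>N. (\<Sum>i<N. f ((T ^^ i) x)) / A.G N) \<longlonglongrightarrow> 1"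
  proof eventually_elim
    case (elim x)
    show ?case
    proof (rule LIMSEQ_I)
      fix e :: real assume "0 < e"
      then obtain q where q: "1 / real (Suc q) < e"
        using reals_Archimedean[of e] by (auto simp: inverse_eq_divide)
      have "\<forall>\<^sub>F N in sequentially. 0 < A.G N" using G_top by (simp add: filterlim_at_top_dense)
      then have "\<forall>\<^sub>F N in sequentially. norm ((\<Sum>i<N. f ((T ^^ i) x)) / A.G N - 1) < e"
        using spec[OF elim, of q]
      proof eventually_elim
        case (elim N)
        have "(\<Sum>i<N. f ((T ^^ i) x)) / A.G N - 1 = ((\<Sum>i<N. f ((T ^^ i) x)) - A.G N) / A.G N"
          using elim(1) by (simp add: diff_divide_distrib)
        then have "norm ((\<Sum>i<N. f ((T ^^ i) x)) / A.G N - 1) = \<bar>(\<Sum>i<N. f ((T ^^ i) x)) - A.G N\<bar> / A.G N"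
          using elim(1) by (simp add: abs_divide)
        also have "\<dots> \<le> 1 / real (Suc q)" using elim by (simp only: pos_divide_le_eq)
        finally show ?case using q by linarith
      qed
      then show "\<exists>no. \<forall>N\<ge>no. norm ((\<Sum>i<N. f ((T ^^ i) x)) / A.G N - 1) < e"
        by (simp add: eventually_sequentially)
    qed
  qed
  then have "AE x in M. (\<lambda>N. (\<Sum>i<N. f ((T ^^ i) x)) / A.G N) \<longlonglongrightarrow> 1"
  proof (rule A.AE_limit_from_E[OF _ G_top])
    have "(\<lambda>n. A.\<gamma> n / \<Lambda> n / real n) \<longlonglongrightarrow> 0"
      by (rule real_tendsto_divide_at_top[OF \<gamma> filterlim_real_sequentially])
    moreover have "\<forall>\<^sub>F n in sequentially. A.\<gamma> n / \<Lambda> n / real n = A.\<gamma> n / A.G n"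
      using eventually_ge_at_top[of 1] by eventually_elim (simp add: form mult.commute)
    ultimately show "(\<lambda>n. A.\<gamma> n / A.G n) \<longlonglongrightarrow> 0" by (rule Lim_transform_eventually)
  qed
  moreover have "(\<Sum>i<N. f ((T ^^ i) x)) = (\<Sum>k=1..N. f ((T ^^ (k - 1)) x))" for N x
    by (rule sum.reindex_bij_witness[of _ "\<lambda>k. k - 1" Suc]) auto
  ultimately have birkhoff: "AE x in M. (\<lambda>N. (\<Sum>k=1..N. f ((T ^^ (k - 1)) x)) / A.G N) \<longlonglongrightarrow> 1" by simp
  \<comment> \<open>The exceptional set refers to the whole orbit, since \<open>induced_obs\<close>
    evaluates \<open>f\<close> along the entire excursion.\<close>
  obtain N0 where N0: "{x\<in>space M. \<not> (\<forall>n. g 1 ((T ^^ n) x) \<le> f ((T ^^ n) x) \<and> f ((T ^^ n) x) \<le> g 2 ((T ^^ n) x))} \<subseteq> N0"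
    "emeasure M N0 = 0" "N0 \<in> sets M"
    using AE_pow[OF ii_a] by (rule AE_E)
  have "emeasure M (E - N0) = 1"
    using emeasure_Diff_null_set[of N0 M E] N0 E_sets E_measure by (auto simp: null_sets_def)
  moreover have "(\<lambda>n. induced_obs T E f (x n) / A.G n) \<longlonglongrightarrow> 1"
    if x: "\<forall>n\<ge>1. x n \<in> return_level T E n \<inter> (E - N0)" for x :: "nat \<Rightarrow> 'a"
  proof (rule tendsto_sandwich[OF _ _ ii_b_equiv tendsto_const])
    have bounds: "B.G n \<le> induced_obs T E f (x n) \<and> induced_obs T E f (x n) \<le> A.G n" if n: "1 \<le> n" for n
    proof -
      have xn: "x n \<in> return_level T E n" "x n \<in> E" "x n \<notin> N0" using x n by auto
      have le: "g 1 ((T ^^ j) (x n)) \<le> f ((T ^^ j) (x n)) \<and> f ((T ^^ j) (x n)) \<le> g 2 ((T ^^ j) (x n))" for j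
        using xn N0(1) E_subset by blast
      have "induced_obs T E (g 1) (x n) \<le> induced_obs T E f (x n)"
        "induced_obs T E f (x n) \<le> induced_obs T E (g 2) (x n)"
        unfolding induced_obs_def using le by (auto intro!: sum_mono)
      then show ?thesis
        using induced_obs_eq_induced_value[OF T_measurable E_subset A.h_levels xn(1) n]
          induced_obs_eq_induced_value[OF T_measurable E_subset B.h_levels xn(1) n] by simp
    qed
    show "\<forall>\<^sub>F n in sequentially. L 1 (real n) / L 2 (real n) \<le> induced_obs T E f (x n) / A.G n"
      using \<Lambda>_pos eventually_ge_at_top[of 1]
    proof eventually_elim
      case (elim n)
      have "L 1 (real n) / L 2 (real n) = B.G n / A.G n"
        using elim form[of n] form1[of n] by (simp add: \<Lambda>_def)
      then show ?case using bounds[OF elim(2)] A.G_nonneg[of n] by (simp add: divide_right_mono)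
    qed
    show "\<forall>\<^sub>F n in sequentially. induced_obs T E f (x n) / A.G n \<le> 1"
      using \<Lambda>_pos eventually_ge_at_top[of 1]
    proof eventually_elim
      case (elim n)
      then have "0 < A.G n" using form[of n] by simp
      then show ?case using bounds[OF elim(2)] by simp
    qed
  qed
  ultimately show ?thesis
    using birkhoff A.G_nonneg N0(3) E_sets
    by (intro exI[of _ A.G] conjI allI bexI[of _ "E - N0"]) auto
qed

end
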